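(* Let $X$ be a set of countably infinite or weakly compact cardinality $\kappa$. Then there exist (exactly) $\kappa$ maximal clones on $X$ which contain all permutations of $X$.
   Context: Let $\mathcal{O}^{(n)}$ be the set of all functions $X^n\to X$ and $\mathcal{O}=\bigcup_{n\ge1}\mathcal{O}^{(n)}$. A clone on $X$ is a subset of $\mathcal{O}$ containing all projections and closed under composition. A maximal clone is a dual atom of the lattice of clones on $X$ (ordered by inclusion), i.e. a clone $\mathcal{C}\ne\mathcal{O}$ such that no clone lies strictly between $\mathcal{C}$ and $\mathcal{O}$. An uncountable cardinal $\kappa$ is weakly compact if $\kappa\to(\kappa)^2_2$. *)

theory Defs
  imports "HOL-Library.Ramsey" "HOL-Library.Equipollence" "HOL-Library.Countable_Set"
    "HOL-Library.FuncSet"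
begin

text \<open>The base set is the universe of a type \<open>'a\<close>. An \<open>n\<close>-tuple is a list of
  length \<open>n\<close>. An \<open>n\<close>-ary operation is a pair of its arity and a function that is extensional
  outside the \<open>n\<close>-tuples, so that two such pairs are equal iff they are equal as functions
  from \<open>n\<close>-tuples to elements.\<close>

type_synonym 'a operation = "nat \<times> ('a list \<Rightarrow> 'a)"

definition tuples :: "nat \<Rightarrow> 'a list set" where
  "tuples n = {xs. length xs = n}"

definition operations_of_arity :: "nat \<Rightarrow> 'a operation set" where
  "operations_of_arity n = {n} \<times> (tuples n \<rightarrow>\<^sub>E UNIV)"

definition operations :: "'a operation set" where
  "operations = (\<Union>n\<in>{1..}. operations_of_arity n)"

definition projection :: "nat \<Rightarrow> nat \<Rightarrow> 'a operation" where
  "projection n i = (n, \<lambda>xs\<in>tuples n. xs ! i)"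

text \<open>\<open>compose_op m f gs\<close> is the \<open>m\<close>-ary operation \<open>f (g\<^sub>1, \<dots>, g\<^sub>n)\<close>, where \<open>gs\<close> lists the
  underlying functions of the \<open>m\<close>-ary inner operations.\<close>

definition compose_op :: "nat \<Rightarrow> ('a list \<Rightarrow> 'a) \<Rightarrow> ('a list \<Rightarrow> 'a) list \<Rightarrow> 'a operation" where
  "compose_op m f gs = (m, \<lambda>xs\<in>tuples m. f (map (\<lambda>g. g xs) gs))"

definition clone :: "'a operation set \<Rightarrow> bool" where
  "clone C \<longleftrightarrow>
     C \<subseteq> operations \<and>
     (\<forall>n i. i < n \<longrightarrow> projection n i \<in> C) \<and>
     (\<forall>n f m gs. (n, f) \<in> C \<longrightarrow> length gs = n \<longrightarrow> (\<forall>g\<in>set gs. (m, g) \<in> C) \<longrightarrow>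
        compose_op m f gs \<in> C)"

definition maximal_clone :: "'a operation set \<Rightarrow> bool" where
  "maximal_clone C \<longleftrightarrow>
     clone C \<and> C \<noteq> operations \<and> \<not> (\<exists>D. clone D \<and> C \<subset> D \<and> D \<subset> operations)"

definition unary_op :: "('a \<Rightarrow> 'a) \<Rightarrow> 'a operation" where
  "unary_op p = (1, \<lambda>xs\<in>tuples 1. p (xs ! 0))"

definition permutation_ops :: "'a operation set" where
  "permutation_ops = unary_op ` {p. bij p}"

text \<open>Cardinality \<open>\<kappa>\<close> of \<open>A\<close> is uncountable and satisfies \<open>\<kappa> \<rightarrow> (\<kappa>)\<^sup>2\<^sub>2\<close>. Both conditions are
  invariant under equipollence, so they are stated for the set \<open>A\<close> itself.\<close>

definition weakly_compact_cardinality :: "'b set \<Rightarrow> bool" where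
  "weakly_compact_cardinality A \<longleftrightarrow>
     uncountable A \<and>
     (\<forall>c \<in> nsets A 2 \<rightarrow> {..<2::nat}. \<exists>H \<subseteq> A. H \<approx> A \<and> (\<exists>i<2. c ` nsets H 2 \<subseteq> {i}))"

end

theory Submission
  imports Defs
begin

text \<open>Call a set small if its cardinality is below \<open>\<kappa>\<close>. From \<open>\<kappa> \<rightarrow> (\<kappa>)\<^sup>2\<^sub>2\<close> one gets regularity
  of \<open>\<kappa>\<close> and, by colouring pairs lexicographically, a large set on which each member of a family
  of \<open>\<kappa>\<close> many predicates is eventually constant; this is all the partition calculus that is used.

  Upper bound: every proper clone above the permutations preserves one of the sets \<open>small_fibred\<close>,
  \<open>mostly_small_fibred\<close>, \<open>missing V\<close>, \<open>almost_onto_or_below W\<close>, \<open>almost_unary\<close>,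
  \<open>nowhere_injective\<close>, and the sets depending on a parameter depend only on its cardinality.
  Indeed, not preserving the first four kinds puts into the clone successively richer unary
  operations, until it contains all those whose nonempty fibres are large. On a large set with large
  complement these induce all unary functions, so there the theorem of Gavrilov and
  Goldstern--Shelah on clones above the unary operations applies: not preserving the last two sets
  yields an injective binary operation.

  Lower bound: the clone preserving \<open>missing V\<close> contains every operation whose range has a large
  complement, so it can only be contained in clones of the list of the same form, and those are
  pairwise incomparable for distinct cardinalities of \<open>V\<close>. As \<open>\<kappa>\<close> is a strong limit, there are
  \<open>\<kappa>\<close> many of them.\<close>

section \<open>Large and small sets under the partition property\<close>

text \<open>Permutations can imitate an injection on a set only if its domain and its image have
  equipollent complements; hence sets are halved again and again, one half being sacrificed to keep
  complements large. Failure to preserve a set \<open>T\<close> of functions yields an operation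
  \<open>f\<close> of the clone and arguments from \<open>T\<close>, but these arguments need not be
  operations of the clone. The recurring task is to replace them by members without destroying the
  value of \<open>f\<close>: by passing to a set on which they are injective, constant or functions
  of one coordinate, or by adjusting their ranges.

  Functions whose nonempty fibres are all large are the right unary target because two of them
  differ only by permutations on both sides as soon as their ranges, and the complements of their
  ranges, have equal cardinalities. A minimal cardinality not yet attained can therefore be played
  against a violation of the set named after it. On the binary side the obstacle is that injectivity
  is obtained only above the diagonal, with no control over the values below it.\<close>

definition wle :: "'a \<Rightarrow> 'a \<Rightarrow> bool" (infix "\<sqsubseteq>" 50) where
  "x \<sqsubseteq> y \<longleftrightarrow> (x, y) \<in> card_of UNIV"

definition wless :: "'a \<Rightarrow> 'a \<Rightarrow> bool" (infix "\<sqsubset>" 50) where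
  "x \<sqsubset> y \<longleftrightarrow> x \<sqsubseteq> y \<and> x \<noteq> y"

lemma Well_order_UNIV: "well_order_on (UNIV :: 'a set) (card_of (UNIV :: 'a set))"
  using card_of_well_order_on by blast

global_interpretation wo: wellorder "(\<sqsubseteq>) :: 'a \<Rightarrow> 'a \<Rightarrow> bool" "(\<sqsubset>)"
proof -
  let ?r = "card_of (UNIV :: 'a set)"
  have lin: "linear_order ?r" and wf: "wf (?r - Id)"
    using Well_order_UNIV unfolding well_order_on_def by auto
  have r: "refl ?r" "trans ?r" "antisym ?r" "total ?r"
    using lin unfolding linear_order_on_def partial_order_on_def preorder_on_def by auto
  interpret linorder "(\<sqsubseteq>) :: 'a \<Rightarrow> 'a \<Rightarrow> bool" "(\<sqsubset>)"
  proof
    fix x y z :: 'a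
    show "x \<sqsubset> y \<longleftrightarrow> x \<sqsubseteq> y \<and> \<not> y \<sqsubseteq> x"
      using r(1,3) unfolding wless_def wle_def by (auto dest: antisymD reflD)
    show "x \<sqsubseteq> x" using r(1) unfolding wle_def by (auto dest: reflD)
    show "x \<sqsubseteq> y \<Longrightarrow> y \<sqsubseteq> z \<Longrightarrow> x \<sqsubseteq> z" using r(2) unfolding wle_def by (auto dest: transD)
    show "x \<sqsubseteq> y \<Longrightarrow> y \<sqsubseteq> x \<Longrightarrow> x = y" using r(3) unfolding wle_def by (auto dest: antisymD)
    show "x \<sqsubseteq> y \<or> y \<sqsubseteq> x" using r(1,4) unfolding wle_def total_on_def
      by (cases "x = y") (auto dest: reflD)
  qed
  have eq: "?r - Id = {(x, y). x \<sqsubset> y}" unfolding wless_def wle_def by auto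
  show "class.wellorder ((\<sqsubseteq>) :: 'a \<Rightarrow> 'a \<Rightarrow> bool) (\<sqsubset>)"
  proof
    fix P :: "'a \<Rightarrow> bool" and a
    assume IH: "\<And>x. (\<And>y. y \<sqsubset> x \<Longrightarrow> P y) \<Longrightarrow> P x"
    show "P a" by (rule wf_induct_rule[OF wf[unfolded eq]]) (use IH in auto)
  qed
qed

lemma wless_wf: "wf {(x, y :: 'a). x \<sqsubset> y}"
  using wo.wf by (simp add: wo.wf)

abbreviation seg :: "'a \<Rightarrow> 'a set" where
  "seg x \<equiv> {y. y \<sqsubset> x}"

definition small :: "'a set \<Rightarrow> bool" where
  "small A \<longleftrightarrow> \<not> A \<approx> (UNIV :: 'a set)"

lemma small_iff_not_lepoll: "small (A :: 'a set) \<longleftrightarrow> \<not> (UNIV :: 'a set) \<lesssim> A"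
  unfolding small_def
  by (meson eqpoll_imp_lepoll eqpoll_sym lepoll_antisym subset_UNIV subset_imp_lepoll)

lemma small_lepoll: "A \<lesssim> B \<Longrightarrow> small B \<Longrightarrow> small (A :: 'a set)" for B :: "'a set"
  unfolding small_iff_not_lepoll using lepoll_trans by blast

lemma small_mono: "A \<subseteq> B \<Longrightarrow> small B \<Longrightarrow> small A"
  using small_lepoll subset_imp_lepoll by blast

lemma small_image: "small A \<Longrightarrow> small (f ` A)" for f :: "'a \<Rightarrow> 'a"
  using small_lepoll image_lepoll by blast

lemma small_inj_image: "inj_on f A \<Longrightarrow> small (f ` A) \<longleftrightarrow> small A" for f :: "'a \<Rightarrow> 'a"
  unfolding small_def by simp

lemma large_lepoll: "\<not> small A \<Longrightarrow> (B :: 'a set) \<lesssim> (A :: 'a set)"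
  unfolding small_iff_not_lepoll not_not
  by (rule lepoll_trans[OF subset_imp_lepoll[OF subset_UNIV]])

lemma large_eqpoll: "\<not> small (A :: 'a set) \<Longrightarrow> \<not> small (B :: 'a set) \<Longrightarrow> A \<approx> B"
  unfolding small_def not_not by (metis eqpoll_sym eqpoll_trans)

lemma large_bij:
  assumes "\<not> small A"
  obtains b :: "'a \<Rightarrow> 'a" where "bij_betw b UNIV A"
  using eqpoll_sym[of A UNIV] assms that unfolding small_def eqpoll_def by auto

lemma lepoll_total: "A \<lesssim> B \<or> B \<lesssim> A"
proof -
  have "ordLeq3 (card_of A) (card_of B) \<or> ordLeq3 (card_of B) (card_of A)"
    by (rule ordLeq_total[OF card_of_Well_order card_of_Well_order])
  then show ?thesis unfolding lepoll_def card_of_ordLeq[symmetric] .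
qed

lemma minimal_lepoll:
  assumes "P (V0 :: 'a set)"
  obtains V where "P V" "\<forall>V'. P V' \<longrightarrow> V \<lesssim> V'"
proof -
  have "\<exists>r\<in>card_of ` {V. P V}. \<forall>r'\<in>card_of ` {V. P V}. ordLeq3 r r'"
    by (rule exists_minim_Card_order) (use assms in \<open>auto simp: card_of_Card_order\<close>)
  then obtain V where V: "P V" "\<And>V'. P V' \<Longrightarrow> ordLeq3 (card_of V) (card_of V')" by blast
  then show ?thesis using that unfolding card_of_ordLeq[symmetric] lepoll_def by blast
qed

text \<open>\<open>card_of UNIV\<close> is a well-order of least possible type, so its proper
  initial segments have smaller cardinality; an arbitrary well-order would not give this. It is what
  keeps the set of earlier choices small in every transfinite construction.\<close>

lemma small_seg: "small (seg (x :: 'a))"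
proof -
  let ?r = "card_of (UNIV :: 'a set)"
  have "ordLess2 (card_of (Order_Relation.underS ?r x)) ?r"
    by (rule card_of_underS[OF card_of_Card_order]) (simp add: Field_card_of)
  moreover have "Order_Relation.underS ?r x = seg x"
    unfolding Order_Relation.underS_def wless_def wle_def by auto
  ultimately show ?thesis
    unfolding small_def eqpoll_iff_card_of_ordIso using not_ordLess_ordIso by auto
qed

text \<open>A small set, well-ordered by \<open>card_of\<close>, is isomorphic to a proper initial
  segment of the universe. Segments thus represent all cardinalities below the full one, which
  bounds the number of parameters that matter.\<close>

lemma eqpoll_seg_or_large: "(\<exists>x. V \<approx> seg (x :: 'a)) \<or> \<not> small (V :: 'a set)"
proof (cases "small V")
  case True
  let ?r = "card_of (UNIV :: 'a set)"
  have "ordLess2 (card_of V) ?r"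
    using True unfolding small_iff_not_lepoll lepoll_def card_of_ordLeq
    by (metis card_of_ordLeq not_ordLeq_iff_ordLess card_of_Well_order)
  then have "\<exists>a\<in>Field ?r. ordIso2 (card_of V) (Restr ?r (Order_Relation.underS ?r a))"
    by (rule iffD1[OF ordLess_iff_ordIso_Restr[OF card_of_Well_order card_of_Well_order]])
  then obtain a where a: "ordIso2 (card_of V) (Restr ?r (Order_Relation.underS ?r a))" ..
  have u: "Order_Relation.underS ?r a = seg a"
    unfolding Order_Relation.underS_def wless_def wle_def by auto
  have "Field (Restr ?r (seg a)) = seg a"
    using wo.order_refl unfolding Field_def wle_def by fastforce
  then have "V \<approx> seg a"
    using card_of_cong[OF a] unfolding u eqpoll_iff_card_of_ordIso
    by (simp add: Field_card_of)
  then show ?thesis by blast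
qed auto

text \<open>The common form of both cases of the theorem. For a countably infinite base set, where
  every infinite subset has full size, it is the infinite Ramsey theorem for pairs.\<close>

locale ramsey_cardinal =
  fixes X :: "'a itself"
  assumes infinite_UNIV: "infinite (UNIV :: 'a set)"
    and partition: "\<And>c :: 'a set \<Rightarrow> bool. \<exists>H. H \<approx> (UNIV :: 'a set) \<and>
      ((\<forall>e\<in>nsets H 2. c e) \<or> (\<forall>e\<in>nsets H 2. \<not> c e))"
begin

abbreviation large :: "'a set \<Rightarrow> bool" where
  "large A \<equiv> \<not> small A"

lemma large_UNIV [simp]: "large UNIV"
  by (simp add: small_def)

lemma small_finite: "finite A \<Longrightarrow> small (A :: 'a set)"
  unfolding small_def using eqpoll_finite_iff infinite_UNIV by blast

lemma small_empty [simp]: "small ({} :: 'a set)"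
  and small_singleton [simp]: "small {a :: 'a}"
  by (auto intro: small_finite)

lemma large_nonempty: "large A \<Longrightarrow> \<exists>x. x \<in> A"
  using small_empty by (metis all_not_in_conv)

section \<open>The partition property on large sets, and regularity\<close>

lemma partition_in:
  assumes "large Z"
  obtains H where "H \<subseteq> Z" "large H"
    "(\<forall>x\<in>H. \<forall>y\<in>H. x \<sqsubset> y \<longrightarrow> R x y) \<or> (\<forall>x\<in>H. \<forall>y\<in>H. x \<sqsubset> y \<longrightarrow> \<not> R x y)"
proof -
  obtain b :: "'a \<Rightarrow> 'a" where b: "bij_betw b UNIV Z" by (rule large_bij[OF assms])
  \<comment> \<open>An unordered pair is coloured by \<open>R\<close> on its image taken in
    increasing order; the order being asymmetric, only one of the two orientations counts.\<close>
  define c where "c e \<longleftrightarrow> (\<exists>x\<in>e. \<exists>y\<in>e. b x \<sqsubset> b y \<and> R (b x) (b y))" for e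
  obtain H where H: "H \<approx> (UNIV :: 'a set)"
    "(\<forall>e\<in>nsets H 2. c e) \<or> (\<forall>e\<in>nsets H 2. \<not> c e)"
    using partition[of c] by blast
  have inj: "inj b" using b bij_betw_def by blast
  have c: "c {x, y} \<longleftrightarrow> R (b x) (b y)" if "b x \<sqsubset> b y" for x y
    using that wo.less_asym[OF that] unfolding c_def by auto
  have ns: "{x, y} \<in> nsets H 2" if "x \<in> H" "y \<in> H" "b x \<sqsubset> b y" for x y
    using that by auto
  show thesis
  proof (rule that)
    show "b ` H \<subseteq> Z" using b unfolding bij_betw_def by blast
    show "large (b ` H)"
      using H(1) inj small_inj_image[of b H] unfolding small_def by (metis inj_on_subset subset_UNIV)
    show "(\<forall>x\<in>b ` H. \<forall>y\<in>b ` H. x \<sqsubset> y \<longrightarrow> R x y) \<or> (\<forall>x\<in>b ` H. \<forall>y\<in>b ` H. x \<sqsubset> y \<longrightarrow> \<not> R x y)"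
      using H(2) c ns by blast
  qed
qed

text \<open>Regularity. Colour the pairs of a supposedly large \<open>Y\<close> by whether
  \<open>f\<close> agrees on them: a homogeneous set lies in one fibre or is mapped injectively, and
  either contradicts an assumption.\<close>

lemma small_UN_vimage:
  fixes f :: "'a \<Rightarrow> 'a"
  assumes "small (f ` Y)" "\<And>c. small {y \<in> Y. f y = c}"
  shows "small (Y :: 'a set)"
proof (rule ccontr)
  assume "large Y"
  then obtain H where H: "H \<subseteq> Y" "large H"
    "(\<forall>x\<in>H. \<forall>y\<in>H. x \<sqsubset> y \<longrightarrow> f x = f y) \<or> (\<forall>x\<in>H. \<forall>y\<in>H. x \<sqsubset> y \<longrightarrow> f x \<noteq> f y)"
    by (rule partition_in[where R = "\<lambda>x y. f x = f y"]) blast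
  from H(3) show False
  proof
    assume eq: "\<forall>x\<in>H. \<forall>y\<in>H. x \<sqsubset> y \<longrightarrow> f x = f y"
    obtain x where x: "x \<in> H" using large_nonempty H(2) by blast
    have "H \<subseteq> {y \<in> Y. f y = f x}"
    proof
      fix y assume y: "y \<in> H"
      then have "f y = f x" using eq x wo.neq_iff[of x y] by (cases "x = y") auto
      then show "y \<in> {y \<in> Y. f y = f x}" using H(1) y by auto
    qed
    then show False using assms(2) H(2) small_mono by blast
  next
    assume "\<forall>x\<in>H. \<forall>y\<in>H. x \<sqsubset> y \<longrightarrow> f x \<noteq> f y"
    then have "inj_on f H" by (metis inj_onI wo.neq_iff)
    then have "large (f ` H)" using H(2) small_inj_image by blast
    then show False using assms(1) H(1) small_mono image_mono by metis
  qed
qed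

lemma small_UN:
  fixes I :: "'a set"
  assumes "small I" "\<And>i. i \<in> I \<Longrightarrow> small (A i)"
  shows "small (\<Union>i\<in>I. A i :: 'a set)"
proof -
  define f where "f y = (SOME i. i \<in> I \<and> y \<in> A i)" for y
  have f: "f y \<in> I \<and> y \<in> A (f y)" if "y \<in> (\<Union>i\<in>I. A i)" for y
    unfolding f_def by (rule someI_ex) (use that in blast)
  show ?thesis
  proof (rule small_UN_vimage[where f = f])
    show "small (f ` (\<Union>i\<in>I. A i))"
      by (rule small_mono[OF _ assms(1)]) (use f in blast)
    fix c
    show "small {y \<in> (\<Union>i\<in>I. A i). f y = c}"
    proof (cases "c \<in> I")
      case True
      show ?thesis by (rule small_mono[OF _ assms(2)[OF True]]) (use f in blast)
    next
      case False
      then have "{y \<in> (\<Union>i\<in>I. A i). f y = c} = {}" using f by blast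
      then show ?thesis by (simp only: small_empty)
    qed
  qed
qed

lemma small_Un: "small A \<Longrightarrow> small B \<Longrightarrow> small (A \<union> B :: 'a set)"
proof -
  assume A: "small A" "small B"
  obtain a b :: 'a where ab: "a \<noteq> b"
    using infinite_UNIV by (metis finite.emptyI finite_insert insertI1 singletonD subsetI subset_antisym UNIV_I finite_subset)
  have "A \<union> B = (\<Union>i\<in>{a, b}. if i = a then A else B)" using ab by auto
  moreover have "small (\<Union>i\<in>{a, b}. if i = a then A else B)"
    by (rule small_UN) (use A in \<open>auto intro: small_finite\<close>)
  ultimately show ?thesis by simp
qed

lemma small_finite_UN:
  assumes "finite I" "\<And>i. i \<in> I \<Longrightarrow> small (A i)"
  shows "small (\<Union>i\<in>I. A i :: 'a set)"
  using assms by (induction I) (auto intro: small_Un)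

lemma large_Diff: "large A \<Longrightarrow> small B \<Longrightarrow> large (A - B :: 'a set)"
  using small_Un[of "A - B" B] small_mono[of A "A - B \<union> B"] by blast

lemma large_mono: "A \<subseteq> B \<Longrightarrow> large A \<Longrightarrow> large (B :: 'a set)"
  using small_mono by blast

lemma pigeonhole:
  fixes f :: "'a \<Rightarrow> 'a"
  assumes "large Y" "small (f ` Y)"
  obtains c where "large {y \<in> Y. f y = c}"
  using small_UN_vimage assms by blast

lemma small_atMost: "small {y. y \<sqsubseteq> (x :: 'a)}"
proof -
  have "{y. y \<sqsubseteq> x} = seg x \<union> {x}" using wo.le_less by auto
  then show ?thesis using small_Un small_seg small_singleton by metis
qed

lemma small_bounded:
  assumes "small (A :: 'a set)"
  obtains b where "\<And>a. a \<in> A \<Longrightarrow> a \<sqsubset> b"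
proof -
  have "small (\<Union>a\<in>A. {y. y \<sqsubseteq> a})" by (rule small_UN[OF assms small_atMost])
  then have "(\<Union>a\<in>A. {y. y \<sqsubseteq> a}) \<noteq> UNIV" using large_UNIV by metis
  then obtain b where "b \<notin> (\<Union>a\<in>A. {y. y \<sqsubseteq> a})" by blast
  then show ?thesis by (intro that[of b]) (simp add: wo.not_le)
qed

lemma large_above: "large A \<Longrightarrow> \<exists>y\<in>A. x \<sqsubset> (y :: 'a)"
  using small_mono[OF _ small_atMost[of x], of A] by (force simp: wo.not_le[symmetric])

lemma prod_eqpoll: "(UNIV :: ('a \<times> 'a) set) \<approx> (UNIV :: 'a set)"
  using card_of_Times_same_infinite[OF infinite_UNIV]
  unfolding eqpoll_iff_card_of_ordIso UNIV_Times_UNIV .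

lemma prod_bij: obtains e :: "'a \<Rightarrow> 'a \<times> 'a" where "bij e"
  using eqpoll_sym[OF prod_eqpoll] unfolding eqpoll_def by blast

text \<open>Two distinct rows of the square of the base set, transported into \<open>A\<close>, are
  disjoint and large.\<close>

lemma large_split:
  assumes "large A"
  obtains B where "B \<subseteq> A" "large B" "large (A - B :: 'a set)"
proof -
  obtain e :: "'a \<Rightarrow> 'a \<times> 'a" where e: "bij e" by (rule prod_bij)
  obtain b :: "'a \<Rightarrow> 'a" where b: "bij_betw b UNIV A" by (rule large_bij[OF assms])
  obtain p q :: 'a where pq: "p \<noteq> q"
    using infinite_UNIV by (metis (full_types) UNIV_I ex_new_if_finite finite.emptyI finite_insert insertI1)
  define g where "g r x = b (inv e (r, x))" for r x
  have ginj: "g r x = g r' x' \<longleftrightarrow> r = r' \<and> x = x'" for r x r' x'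
    using e b unfolding g_def
    by (metis UNIV_I bij_betw_def bij_inv_eq_iff inj_on_def prod.inject)
  have gA: "g r x \<in> A" for r x using b unfolding g_def bij_betw_def by blast
  have lg: "large (range (g r))" for r
    using ginj small_inj_image[of "g r" UNIV] by (auto simp: inj_on_def)
  show thesis
  proof (rule that)
    show "range (g p) \<subseteq> A" using gA by blast
    show "large (range (g p))" by (rule lg)
    show "large (A - range (g p))"
      by (rule large_mono[OF _ lg[of q]]) (use gA ginj pq in auto)
  qed
qed

section \<open>Transfinite selection and eventually constant predicates\<close>

lemma select:
  fixes Z :: "'a \<Rightarrow> 'a set" and Bad :: "'a \<Rightarrow> 'a set \<Rightarrow> 'a set"
  assumes "\<And>i. large (Z i)" "\<And>i P. small P \<Longrightarrow> small (Bad i P)"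
  obtains w where "\<And>i. w i \<in> Z i" "\<And>i. w i \<notin> Bad i (w ` seg i)"
proof -
  \<comment> \<open>The points are chosen by recursion along the well-order: the choices before
    \<open>i\<close> are indexed by \<open>seg i\<close> and form a small set, so the forbidden
    points are few and cannot exhaust \<open>Z i\<close>.\<close>
  define F where "F w i = (SOME z. z \<in> Z i - Bad i (w ` seg i))" for w :: "'a \<Rightarrow> 'a" and i
  define w where "w = wfrec {(x, y). x \<sqsubset> y} F"
  have adm: "adm_wf {(x, y :: 'a). x \<sqsubset> y} F"
    unfolding adm_wf_def F_def by (auto intro!: arg_cong[where f = Eps] simp: image_def)
  have w: "w i = F w i" for i
    unfolding w_def using wfrec_fixpoint[OF wless_wf adm] by metis
  have "w i \<in> Z i - Bad i (w ` seg i)" for i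
  proof -
    have "large (Z i - Bad i (w ` seg i))"
      by (intro large_Diff assms small_image small_seg)
    then have "\<exists>z. z \<in> Z i - Bad i (w ` seg i)" by (rule large_nonempty)
    then show ?thesis by (subst w) (simp only: F_def, rule someI_ex)
  qed
  then show ?thesis using that by blast
qed

lemma thin:
  assumes "large Z" "\<And>P. small P \<Longrightarrow> small (Bad P)"
  obtains S where "S \<subseteq> Z" "large S" "\<And>s. s \<in> S \<Longrightarrow> s \<notin> Bad {p \<in> S. p \<sqsubset> (s :: 'a)}"
proof -
  \<comment> \<open>Everything up to an earlier choice is forbidden as well. So \<open>w\<close> is
    increasing, and the points chosen before \<open>s\<close> are exactly the members of the
    selected set below \<open>s\<close>.\<close>
  define B where "B P = Bad P \<union> (\<Union>p\<in>P. {z. z \<sqsubseteq> p})" for P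
  have B: "small (B P)" if "small P" for P
    unfolding B_def by (intro small_Un small_UN assms(2) that small_atMost)
  obtain w :: "'a \<Rightarrow> 'a" where w: "\<And>i. w i \<in> Z" "\<And>i. w i \<notin> B (w ` seg i)"
    using select[of "\<lambda>_. Z" "\<lambda>_. B", OF assms(1) B] by blast
  have mono: "w i \<sqsubset> w j" if "i \<sqsubset> j" for i j
    using w(2)[of j] that unfolding B_def by (auto simp: wo.not_le)
  then have iff: "w i \<sqsubset> w j \<longleftrightarrow> i \<sqsubset> j" for i j
    by (metis wo.less_asym wo.neq_iff)
  have "inj w" by (rule injI) (metis iff wo.neq_iff)
  show thesis
  proof (rule that)
    show "range w \<subseteq> Z" using w by blast
    show "large (range w)" using small_inj_image[OF \<open>inj w\<close>] by simp
    fix s assume "s \<in> range w"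
    then obtain i where s: "s = w i" by blast
    have "{p \<in> range w. p \<sqsubset> s} = w ` seg i" unfolding s using iff by auto
    then show "s \<notin> Bad {p \<in> range w. p \<sqsubset> s}" using w(2)[of i] s unfolding B_def by auto
  qed
qed

text \<open>Each \<open>z\<close> is read as a 0-1 sequence indexed by \<open>i\<close>. On a set
  homogeneous for lexicographic comparison these sequences are monotone. Once the coordinates before
  \<open>i\<close> have been made constant by removing a small set, coordinate \<open>i\<close> is
  itself monotone and changes at most once.\<close>

lemma stabilize:
  fixes P :: "'a \<Rightarrow> 'a \<Rightarrow> bool"
  assumes "large Z"
  obtains S where "S \<subseteq> Z" "large S" "\<And>i. small {z \<in> S. P i z} \<or> small {z \<in> S. \<not> P i z}"
proof -
  define R where "R x y \<longleftrightarrow> (\<exists>i. (\<forall>k. k \<sqsubset> i \<longrightarrow> P k x = P k y) \<and> \<not> P i x \<and> P i y)" for x y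
  obtain S where S: "S \<subseteq> Z" "large S"
    "(\<forall>x\<in>S. \<forall>y\<in>S. x \<sqsubset> y \<longrightarrow> R x y) \<or> (\<forall>x\<in>S. \<forall>y\<in>S. x \<sqsubset> y \<longrightarrow> \<not> R x y)"
    by (rule partition_in[OF assms, where R = R])
  have "small {z \<in> S. P i z} \<or> small {z \<in> S. \<not> P i z}" for i
  proof (induction i rule: wo.less_induct)
    case (less i)
    \<comment> \<open>\<open>E k\<close> holds the exceptional points of coordinate
      \<open>k\<close>; by regularity their union over all \<open>k\<close> below \<open>i\<close>
      is small.\<close>
    define E where "E k = (if small {z \<in> S. P k z} then {z \<in> S. P k z} else {z \<in> S. \<not> P k z})" for k
    have "small (\<Union>k\<in>seg i. E k)"
      by (rule small_UN[OF small_seg]) (use less.IH in \<open>auto simp: E_def\<close>)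
    define S' where "S' = S - (\<Union>k\<in>seg i. E k)"
    have same: "P k x = P k y" if "x \<in> S'" "y \<in> S'" "k \<sqsubset> i" for x y k
      using that unfolding S'_def E_def by (auto split: if_splits)
    have Rx: "R x y" if "x \<in> S'" "y \<in> S'" "\<not> P i x" "P i y" for x y
      using that same unfolding R_def by blast
    have nR: "\<not> R x y" if "x \<in> S'" "y \<in> S'" "P i x" "\<not> P i y" for x y
    proof
      assume "R x y"
      then obtain j where j: "\<forall>k. k \<sqsubset> j \<longrightarrow> P k x = P k y" "\<not> P j x" "P j y" unfolding R_def by blast
      then show False using same[OF that(1,2), of j] that(3,4) by (metis wo.neq_iff)
    qed
    have "S' \<subseteq> S" unfolding S'_def by blast
    then have mono: "(\<forall>x\<in>S'. \<forall>y\<in>S'. x \<sqsubset> y \<longrightarrow> P i x \<longrightarrow> P i y) \<or> (\<forall>x\<in>S'. \<forall>y\<in>S'. x \<sqsubset> y \<longrightarrow> \<not> P i x \<longrightarrow> \<not> P i y)"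
      using S(3) Rx nR by (meson subsetD)
    have "small {z \<in> S'. P i z} \<or> small {z \<in> S'. \<not> P i z}"
      using mono
    proof
      assume m: "\<forall>x\<in>S'. \<forall>y\<in>S'. x \<sqsubset> y \<longrightarrow> P i x \<longrightarrow> P i y"
      show ?thesis
      proof (cases "\<exists>x\<in>S'. P i x")
        case True
        then obtain x where "x \<in> S'" "P i x" by blast
        then have "{z \<in> S'. \<not> P i z} \<subseteq> {z. z \<sqsubseteq> x}" using m by (auto simp: wo.not_less[symmetric])
        then show ?thesis using small_mono small_atMost by blast
      next
        case False
        then have "{z \<in> S'. P i z} = {}" by blast
        then show ?thesis by (simp only: small_empty simp_thms)
      qed
    next
      assume m: "\<forall>x\<in>S'. \<forall>y\<in>S'. x \<sqsubset> y \<longrightarrow> \<not> P i x \<longrightarrow> \<not> P i y"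
      show ?thesis
      proof (cases "\<exists>x\<in>S'. \<not> P i x")
        case True
        then obtain x where "x \<in> S'" "\<not> P i x" by blast
        then have "{z \<in> S'. P i z} \<subseteq> {z. z \<sqsubseteq> x}" using m by (auto simp: wo.not_less[symmetric])
        then show ?thesis using small_mono small_atMost by blast
      next
        case False
        then have "{z \<in> S'. \<not> P i z} = {}" by blast
        then show ?thesis by (simp only: small_empty simp_thms)
      qed
    qed
    then show ?case
    proof
      assume "small {z \<in> S'. P i z}"
      then have "small ({z \<in> S'. P i z} \<union> (\<Union>k\<in>seg i. E k))"
        using \<open>small (\<Union>k\<in>seg i. E k)\<close> small_Un by blast
      then have "small {z \<in> S. P i z}" by (rule small_mono[rotated]) (auto simp: S'_def)
      then show ?thesis ..
    next
      assume "small {z \<in> S'. \<not> P i z}"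
      then have "small ({z \<in> S'. \<not> P i z} \<union> (\<Union>k\<in>seg i. E k))"
        using \<open>small (\<Union>k\<in>seg i. E k)\<close> small_Un by blast
      then have "small {z \<in> S. \<not> P i z}" by (rule small_mono[rotated]) (auto simp: S'_def)
      then show ?thesis ..
    qed
  qed
  then show ?thesis using that S by blast
qed

text \<open>The strong limit property. If the base set could be embedded into the power set of
  \<open>V\<close>, the characteristic functions would stabilise at all elements of \<open>V\<close>
  off a single small set, and all the remaining subsets would coincide.\<close>

lemma small_Pow:
  assumes "small (V :: 'a set)"
  shows "\<not> (UNIV :: 'a set) \<lesssim> Pow V"
proof
  assume "(UNIV :: 'a set) \<lesssim> Pow V"
  then obtain e :: "'a \<Rightarrow> 'a set" where e: "inj e" "range e \<subseteq> Pow V"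
    unfolding lepoll_def by (elim exE conjE)
  obtain S where S: "large S" "\<And>i. small {z \<in> S. i \<in> e z} \<or> small {z \<in> S. i \<notin> e z}"
    by (rule stabilize[OF large_UNIV, of "\<lambda>i z. i \<in> e z"]) blast
  define E where "E k = (if small {z \<in> S. k \<in> e z} then {z \<in> S. k \<in> e z} else {z \<in> S. k \<notin> e z})" for k
  have "small (\<Union>k\<in>V. E k)"
    by (rule small_UN[OF assms]) (use S(2) in \<open>auto simp: E_def\<close>)
  then have l: "large (S - (\<Union>k\<in>V. E k))" by (rule large_Diff[OF S(1)])
  then obtain x where x: "x \<in> S - (\<Union>k\<in>V. E k)" using large_nonempty by blast
  have "e y = e x" if y: "y \<in> S - (\<Union>k\<in>V. E k)" for y
  proof -
    have "k \<in> e y \<longleftrightarrow> k \<in> e x" if "k \<in> V" for k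
      using x y that unfolding E_def by (auto split: if_splits)
    then show ?thesis using e(2) by blast
  qed
  then have "S - (\<Union>k\<in>V. E k) \<subseteq> {x}" using injD[OF e(1)] by (intro subsetI) simp
  then show False using l small_mono[OF _ small_singleton] by blast
qed

end

section \<open>Clones and preserved sets of functions\<close>

definition operation_of :: "nat \<Rightarrow> ('a list \<Rightarrow> 'a) \<Rightarrow> 'a operation" where
  "operation_of n F = (n, restrict F (tuples n))"

lemma operation_of_cong:
  "(\<And>xs. length xs = n \<Longrightarrow> F xs = G xs) \<Longrightarrow> operation_of n F = operation_of n G"
  unfolding operation_of_def tuples_def by (auto intro: restrict_ext)

lemma operation_of_in_operations: "n \<ge> 1 \<Longrightarrow> operation_of n F \<in> operations"
  unfolding operation_of_def operations_def operations_of_arity_def by auto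

lemma operationsD:
  assumes "(n, f) \<in> operations"
  shows "n \<ge> 1" "operation_of n f = (n, f)"
  using assms unfolding operation_of_def operations_def operations_of_arity_def
  by (auto simp: PiE_restrict)

lemma unary_op_eq: "unary_op p = operation_of 1 (\<lambda>xs. p (xs ! 0))"
  unfolding unary_op_def operation_of_def ..

definition unaries :: "'a operation set \<Rightarrow> ('a \<Rightarrow> 'a) set" where
  "unaries C = {p. unary_op p \<in> C}"

definition binaries :: "'a operation set \<Rightarrow> ('a \<times> 'a \<Rightarrow> 'a) set" where
  "binaries C = {p. operation_of 2 (\<lambda>xs. p (xs ! 0, xs ! 1)) \<in> C}"

definition subst :: "('a list \<Rightarrow> 'a) \<Rightarrow> ('b \<Rightarrow> 'a) list \<Rightarrow> 'b \<Rightarrow> 'a" where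
  "subst f ts = (\<lambda>z. f (map (\<lambda>t. t z) ts))"

text \<open>A function from \<open>'b\<close> to \<open>'a\<close> is a tuple indexed by
  \<open>'b\<close>, so \<open>T\<close> is a relation of possibly infinite arity and
  \<open>Pol T\<close> its clone of polymorphisms. The index type stays open because sets of unary
  functions (\<open>'b\<close> is \<open>'a\<close>) and of binary functions (\<open>'b\<close> is
  \<open>'a \<times> 'a\<close>) both occur.\<close>

definition Pol :: "('b \<Rightarrow> 'a) set \<Rightarrow> 'a operation set" where
  "Pol T = {(n, f). (n, f) \<in> operations \<and>
     (\<forall>ts. length ts = n \<longrightarrow> set ts \<subseteq> T \<longrightarrow> subst f ts \<in> T)}"

lemma clone_subset: "clone C \<Longrightarrow> C \<subseteq> operations"
  unfolding clone_def by blast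

lemma clone_compose:
  assumes C: "clone C" and F: "operation_of n F \<in> C" "length Gs = n"
    and G: "\<And>G. G \<in> set Gs \<Longrightarrow> operation_of m G \<in> C"
  shows "operation_of m (subst F Gs) \<in> C"
proof -
  let ?gs = "map (\<lambda>G. restrict G (tuples m)) Gs"
  have "compose_op m (restrict F (tuples n)) ?gs \<in> C"
    using C F G unfolding clone_def operation_of_def by auto
  also have "compose_op m (restrict F (tuples n)) ?gs = operation_of m (subst F Gs)"
    using F(2) unfolding compose_op_def operation_of_def subst_def
    by (auto simp: tuples_def comp_def intro!: restrict_ext)
  finally show ?thesis .
qed

lemma clone_projection:
  "clone C \<Longrightarrow> i < n \<Longrightarrow> operation_of n (\<lambda>xs. xs ! i) \<in> C"
  unfolding clone_def projection_def operation_of_def by blast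

lemma clone_Pol: "clone (Pol T)"
  unfolding clone_def
proof (intro conjI allI impI)
  show "Pol T \<subseteq> operations" unfolding Pol_def by auto
next
  fix n i :: nat assume i: "i < n"
  have "subst (\<lambda>xs\<in>tuples n. xs ! i) ts \<in> T" if "length ts = n" "set ts \<subseteq> T" for ts
  proof -
    have "subst (\<lambda>xs\<in>tuples n. xs ! i) ts = ts ! i"
      using that(1) i unfolding subst_def by (auto simp: tuples_def)
    then show ?thesis using that i nth_mem[of i ts] by auto
  qed
  moreover have "projection n i \<in> operations"
    unfolding projection_def using i operation_of_in_operations[of n]
    by (auto simp: operation_of_def)
  ultimately show "projection n i \<in> Pol T" unfolding Pol_def projection_def by auto
next
  fix n m f and gs :: "('a list \<Rightarrow> 'a) list"
  assume f: "(n, f) \<in> Pol T" and gs: "length gs = n" "\<forall>g\<in>set gs. (m, g) \<in> Pol T"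
  have n: "n \<ge> 1" using f operationsD(1) unfolding Pol_def by auto
  then obtain g where "g \<in> set gs" using gs(1) by (cases gs) auto
  then have m: "m \<ge> 1" using gs(2) operationsD(1) unfolding Pol_def by auto
  have "subst (\<lambda>xs\<in>tuples m. f (map (\<lambda>g. g xs) gs)) ts \<in> T"
    if ts: "length ts = m" "set ts \<subseteq> T" for ts
  proof -
    have "subst g ts \<in> T" if "g \<in> set gs" for g
      using gs(2) that ts unfolding Pol_def by auto
    then have "set (map (\<lambda>g. subst g ts) gs) \<subseteq> T" by auto
    then have "subst f (map (\<lambda>g. subst g ts) gs) \<in> T"
      using f gs(1) unfolding Pol_def by simp
    moreover have "subst f (map (\<lambda>g. subst g ts) gs) = subst (\<lambda>xs\<in>tuples m. f (map (\<lambda>g. g xs) gs)) ts"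
      using ts(1) unfolding subst_def by (auto simp: tuples_def comp_def)
    ultimately show ?thesis by simp
  qed
  then show "compose_op m f gs \<in> Pol T"
    using operation_of_in_operations[OF m] unfolding Pol_def compose_op_def operation_of_def by auto
qed

lemma not_subset_PolE:
  assumes "C \<subseteq> operations" "\<not> C \<subseteq> Pol T"
  obtains n f ts where "(n, f) \<in> C" "length ts = n" "set ts \<subseteq> T" "subst f ts \<notin> T"
  using assms unfolding Pol_def by force

lemma unary_Pol:
  assumes "unary_op u \<in> Pol T" "t \<in> T"
  shows "u \<circ> t \<in> T"
proof -
  have "subst (\<lambda>xs\<in>tuples 1. u (xs ! 0)) [t] \<in> T"
    using assms unfolding Pol_def unary_op_def by auto
  then show ?thesis by (simp add: subst_def tuples_def comp_def)
qed

lemma binary_Pol: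
  assumes "operation_of 2 (\<lambda>xs. p (xs ! 0, xs ! 1)) \<in> Pol T" "s \<in> T" "t \<in> T"
  shows "(\<lambda>z. p (s z, t z)) \<in> T"
proof -
  have "subst (\<lambda>xs\<in>tuples 2. p (xs ! 0, xs ! 1)) [s, t] \<in> T"
    using assms unfolding Pol_def operation_of_def by auto
  then show ?thesis by (simp add: subst_def tuples_def)
qed

context
  fixes C :: "'a operation set"
  assumes C: "clone C"
begin

lemma member_operation_of: "(n, f) \<in> C \<longleftrightarrow> (n, f) \<in> operations \<and> operation_of n f \<in> C"
  using clone_subset[OF C] operationsD(2) by (metis subsetD)

lemma subst_unaries:
  assumes "operation_of n f \<in> C" "length ps = n" "set ps \<subseteq> unaries C"
  shows "subst f ps \<in> unaries C"
proof -
  have "operation_of 1 (subst f (map (\<lambda>p xs. p (xs ! 0)) ps)) \<in> C"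
    by (rule clone_compose[OF C assms(1)])
      (use assms(2,3) in \<open>auto simp: unaries_def unary_op_eq\<close>)
  then show ?thesis unfolding unaries_def unary_op_eq by (simp add: subst_def comp_def)
qed

lemma subst_binaries:
  assumes "operation_of n f \<in> C" "length ps = n" "set ps \<subseteq> binaries C"
  shows "subst f ps \<in> binaries C"
proof -
  have "operation_of 2 (subst f (map (\<lambda>p xs. p (xs ! 0, xs ! 1)) ps)) \<in> C"
    by (rule clone_compose[OF C assms(1)])
      (use assms(2,3) in \<open>auto simp: binaries_def\<close>)
  then show ?thesis unfolding binaries_def by (simp add: subst_def comp_def)
qed

lemma unaries_comp: "p \<in> unaries C \<Longrightarrow> q \<in> unaries C \<Longrightarrow> p \<circ> q \<in> unaries C"
  using subst_unaries[of 1 "\<lambda>xs. p (xs ! 0)" "[q]"]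
  by (simp add: subst_def comp_def unaries_def[of C] unary_op_eq)

lemma binaries_fst: "fst \<in> binaries C" and binaries_snd: "snd \<in> binaries C"
  using clone_projection[OF C, of 0 2] clone_projection[OF C, of 1 2] by (simp_all add: binaries_def)

lemma binaries_unary: "p \<in> unaries C \<Longrightarrow> q \<in> binaries C \<Longrightarrow> (\<lambda>z. p (q z)) \<in> binaries C"
  using subst_binaries[of 1 "\<lambda>xs. p (xs ! 0)" "[q]"]
  by (simp add: subst_def unaries_def unary_op_eq)

lemma binaries_comp:
  "p \<in> binaries C \<Longrightarrow> q \<in> binaries C \<Longrightarrow> r \<in> binaries C \<Longrightarrow> (\<lambda>z. p (q z, r z)) \<in> binaries C"
  using subst_binaries[of 2 "\<lambda>xs. p (xs ! 0, xs ! 1)" "[q, r]"]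
  by (simp add: subst_def binaries_def[of C])

end

context ramsey_cardinal
begin

lemma pairing: obtains p :: "'a \<times> 'a \<Rightarrow> 'a" where "bij p"
  using prod_eqpoll unfolding eqpoll_def by blast

text \<open>Nesting a binary bijection encodes any number of arguments injectively as one, inside
  the clone; every operation is then a unary function of the code.\<close>

lemma binaries_generate:
  fixes C :: "'a operation set"
  assumes C: "clone C" and bin: "binaries C = UNIV"
  shows "C = operations"
proof -
  obtain p :: "'a \<times> 'a \<Rightarrow> 'a" where p: "bij p" by (rule pairing)
  have code: "\<exists>c. inj_on c (tuples n) \<and> operation_of n c \<in> C" if "n \<ge> 1" for n
    using that
  proof (induction n rule: nat_induct_at_least)
    case base
    have "inj_on (\<lambda>xs :: 'a list. xs ! 0) (tuples 1)"
      by (auto simp: inj_on_def tuples_def length_Suc_conv)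
    then show ?case using clone_projection[OF C, of 0 1] by auto
  next
    case (Suc n)
    then obtain c where c: "inj_on c (tuples n)" "operation_of n c \<in> C" by blast
    have "operation_of (Suc n) (subst c (map (\<lambda>i xs. xs ! Suc i) [0..<n])) \<in> C"
      by (rule clone_compose[OF C c(2)]) (auto intro: clone_projection[OF C])
    also have "operation_of (Suc n) (subst c (map (\<lambda>i xs. xs ! Suc i) [0..<n])) =
      operation_of (Suc n) (\<lambda>xs. c (tl xs))"
    proof (rule operation_of_cong)
      fix xs :: "'a list"
      assume "length xs = Suc n"
      then have "map (\<lambda>i. xs ! Suc i) [0..<n] = tl xs" by (auto simp: list_eq_iff_nth_eq nth_tl)
      then show "subst c (map (\<lambda>i xs. xs ! Suc i) [0..<n]) xs = c (tl xs)"
        by (simp add: subst_def comp_def)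
    qed
    finally have tl: "operation_of (Suc n) (\<lambda>xs. c (tl xs)) \<in> C" .
    have "operation_of 2 (\<lambda>xs. p (xs ! 0, xs ! 1)) \<in> C"
      using UNIV_I[of p, folded bin] by (simp add: binaries_def)
    then have "operation_of (Suc n) (subst (\<lambda>xs. p (xs ! 0, xs ! 1)) [\<lambda>xs. xs ! 0, \<lambda>xs. c (tl xs)]) \<in> C"
      by (rule clone_compose[OF C]) (use tl clone_projection[OF C] in auto)
    then have "operation_of (Suc n) (\<lambda>xs. p (xs ! 0, c (tl xs))) \<in> C"
      by (simp add: subst_def)
    moreover have "inj_on (\<lambda>xs. p (xs ! 0, c (tl xs))) (tuples (Suc n))"
    proof (rule inj_onI)
      fix xs ys :: "'a list"
      assume xs: "xs \<in> tuples (Suc n)" and ys: "ys \<in> tuples (Suc n)"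
        and "p (xs ! 0, c (tl xs)) = p (ys ! 0, c (tl ys))"
      then have eq: "xs ! 0 = ys ! 0" "c (tl xs) = c (tl ys)" using p by (auto dest: bij_is_inj injD)
      from eq(2) have tl: "tl xs = tl ys"
        by (rule inj_onD[OF c(1)]) (use xs ys in \<open>simp_all add: tuples_def\<close>)
      obtain a as b bs where "xs = a # as" "ys = b # bs"
        using xs ys by (auto simp: tuples_def length_Suc_conv)
      then show "xs = ys" using eq(1) tl by simp
    qed
    ultimately show ?case by blast
  qed
  have "(n, f) \<in> C" if f: "(n, f) \<in> operations" for n f
  proof -
    obtain c where c: "inj_on c (tuples n)" "operation_of n c \<in> C"
      using code operationsD(1)[OF f] by blast
    define u where "u = f \<circ> inv_into (tuples n) c"
    \<comment> \<open>Only binary functions are known to be in \<open>C\<close>, so \<open>u\<close>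
      enters as a binary function that ignores its second argument, and a second copy of
      \<open>c\<close> fills that place.\<close>
    have "(\<lambda>z. u (fst z)) \<in> binaries C" unfolding bin by (rule UNIV_I)
    then have "operation_of 2 (\<lambda>xs. u (xs ! 0)) \<in> C" by (simp add: binaries_def)
    then have "operation_of n (subst (\<lambda>xs. u (xs ! 0)) [c, c]) \<in> C"
      by (rule clone_compose[OF C]) (use c in auto)
    moreover have "operation_of n (subst (\<lambda>xs. u (xs ! 0)) [c, c]) = operation_of n f"
      by (rule operation_of_cong) (use c(1) in \<open>auto simp: subst_def u_def tuples_def\<close>)
    ultimately show ?thesis using operationsD(2)[OF f] by simp
  qed
  then show ?thesis using clone_subset[OF C] by auto
qed

end

section \<open>Clones containing all unary operations\<close>

definition diag :: "'a set \<Rightarrow> ('a \<times> 'a) set" where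
  "diag S = {(x, y). x \<in> S \<and> y \<in> S \<and> x \<sqsubset> y}"

text \<open>By regularity a small range is the same as a bounded one, so these are the functions
  dominated by a function of one of their two arguments.\<close>

definition almost_unary :: "('a \<times> 'a \<Rightarrow> 'a) set" where
  "almost_unary = {t. (\<forall>x. small (range (\<lambda>y. t (x, y)))) \<or> (\<forall>y. small (range (\<lambda>x. t (x, y))))}"

definition nowhere_injective :: "('a \<times> 'a \<Rightarrow> 'a) set" where
  "nowhere_injective = {t. \<forall>S. \<not> small S \<longrightarrow> \<not> inj_on t (diag S)}"

section \<open>Canonical forms on large sets and injectivity above the diagonal\<close>

context ramsey_cardinal
begin

text \<open>The partition relation for triples, reduced to pairs: by \<open>stabilize\<close>,
  applied to predicates indexed by coded pairs, \<open>Q u v z\<close> has a limit value for all but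
  few \<open>z\<close>. A set homogeneous for this limit colouring is taken, and \<open>thin\<close>
  avoids the exceptional \<open>z\<close>.\<close>

lemma partition_triples:
  fixes Q :: "'a \<Rightarrow> 'a \<Rightarrow> 'a \<Rightarrow> bool"
  assumes "large Z"
  obtains S where "S \<subseteq> Z" "large S"
    "(\<forall>u\<in>S. \<forall>v\<in>S. \<forall>z\<in>S. u \<sqsubset> v \<longrightarrow> v \<sqsubset> z \<longrightarrow> Q u v z) \<or>
     (\<forall>u\<in>S. \<forall>v\<in>S. \<forall>z\<in>S. u \<sqsubset> v \<longrightarrow> v \<sqsubset> z \<longrightarrow> \<not> Q u v z)"
proof -
  obtain d :: "'a \<Rightarrow> 'a \<times> 'a" where d: "bij d" by (rule prod_bij)
  obtain S1 where S1: "S1 \<subseteq> Z" "large S1"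
    "\<And>i. small {z \<in> S1. Q (fst (d i)) (snd (d i)) z} \<or> small {z \<in> S1. \<not> Q (fst (d i)) (snd (d i)) z}"
    by (rule stabilize[OF assms, of "\<lambda>i. Q (fst (d i)) (snd (d i))"]) blast
  have st: "small {z \<in> S1. Q u v z} \<or> small {z \<in> S1. \<not> Q u v z}" for u v
    using S1(3)[of "inv d (u, v)"] by (simp add: bij_is_surj[OF d] surj_f_inv_f)
  define e where "e u v \<longleftrightarrow> small {z \<in> S1. \<not> Q u v z}" for u v
  obtain S2 where S2: "S2 \<subseteq> S1" "large S2"
    "(\<forall>x\<in>S2. \<forall>y\<in>S2. x \<sqsubset> y \<longrightarrow> e x y) \<or> (\<forall>x\<in>S2. \<forall>y\<in>S2. x \<sqsubset> y \<longrightarrow> \<not> e x y)"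
    by (rule partition_in[OF S1(2), where R = e])
  define B where "B u v = {z \<in> S1. Q u v z \<noteq> e u v}" for u v
  have B: "small (B u v)" for u v
    using st[of u v] unfolding B_def e_def by (cases "small {z \<in> S1. \<not> Q u v z}") auto
  have "small (\<Union>u\<in>P. \<Union>v\<in>P. B u v)" if "small P" for P
    by (intro small_UN that B)
  then obtain S where S: "S \<subseteq> S2" "large S"
    "\<And>s. s \<in> S \<Longrightarrow> s \<notin> (\<Union>u\<in>{p \<in> S. p \<sqsubset> s}. \<Union>v\<in>{p \<in> S. p \<sqsubset> s}. B u v)"
    using thin[OF S2(2), of "\<lambda>P. \<Union>u\<in>P. \<Union>v\<in>P. B u v"] by blast
  have eq: "Q u v z = e u v" if "u \<in> S" "v \<in> S" "z \<in> S" "u \<sqsubset> v" "v \<sqsubset> z" for u v z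
  proof -
    have "u \<sqsubset> z" using that(4,5) by (rule wo.less_trans)
    then have "z \<notin> B u v" using S(3)[OF that(3)] that by blast
    then show ?thesis using that S(1) S2(1) unfolding B_def by blast
  qed
  show thesis
  proof (rule that[of S])
    show "S \<subseteq> Z" using S(1) S2(1) S1(1) by blast
    show "large S" by (rule S(2))
    show "(\<forall>u\<in>S. \<forall>v\<in>S. \<forall>z\<in>S. u \<sqsubset> v \<longrightarrow> v \<sqsubset> z \<longrightarrow> Q u v z) \<or>
      (\<forall>u\<in>S. \<forall>v\<in>S. \<forall>z\<in>S. u \<sqsubset> v \<longrightarrow> v \<sqsubset> z \<longrightarrow> \<not> Q u v z)"
      using S2(3) S(1) eq by (meson subsetD)
  qed
qed

text \<open>The canonical form for pairs in the sense of Erdos and Rado. Equality is made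
  homogeneous along rows and then along columns. If values differ in both directions, thinning out
  the coincidences between distinct columns makes \<open>t\<close> injective on
  \<open>diag S\<close>, which is excluded. Constant functions fall under dependence on the first
  coordinate.\<close>

lemma canonical:
  fixes t :: "'a \<times> 'a \<Rightarrow> 'a"
  assumes t: "t \<in> nowhere_injective" and Z: "large Z"
  obtains S e where "S \<subseteq> Z" "large S"
    "(\<forall>z\<in>diag S. t z = e (fst z)) \<or> (\<forall>z\<in>diag S. t z = e (snd z))"
proof -
  obtain S1 where S1: "S1 \<subseteq> Z" "large S1"
    "(\<forall>u\<in>S1. \<forall>v\<in>S1. \<forall>z\<in>S1. u \<sqsubset> v \<longrightarrow> v \<sqsubset> z \<longrightarrow> t (u, v) = t (u, z)) \<or>
     (\<forall>u\<in>S1. \<forall>v\<in>S1. \<forall>z\<in>S1. u \<sqsubset> v \<longrightarrow> v \<sqsubset> z \<longrightarrow> t (u, v) \<noteq> t (u, z))"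
    by (rule partition_triples[OF Z, of "\<lambda>u v z. t (u, v) = t (u, z)"])
  from S1(3) show thesis
  proof
    assume eq: "\<forall>u\<in>S1. \<forall>v\<in>S1. \<forall>z\<in>S1. u \<sqsubset> v \<longrightarrow> v \<sqsubset> z \<longrightarrow> t (u, v) = t (u, z)"
    define e where "e x = t (x, SOME y. y \<in> S1 \<and> x \<sqsubset> y)" for x
    have "t (x, y) = e x" if xy: "x \<in> S1" "y \<in> S1" "x \<sqsubset> y" for x y
    proof -
      define y' where "y' = (SOME y. y \<in> S1 \<and> x \<sqsubset> y)"
      have "y' \<in> S1 \<and> x \<sqsubset> y'" unfolding y'_def by (rule someI[of _ y]) (use xy in blast)
      then have "t (x, y) = t (x, y')" using eq xy by (cases y y' rule: wo.linorder_cases) auto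
      then show ?thesis unfolding e_def y'_def .
    qed
    then show thesis using that[of S1 e] S1(1,2) by (auto simp: diag_def)
  next
    assume rows: "\<forall>u\<in>S1. \<forall>v\<in>S1. \<forall>z\<in>S1. u \<sqsubset> v \<longrightarrow> v \<sqsubset> z \<longrightarrow> t (u, v) \<noteq> t (u, z)"
    obtain S2 where S2: "S2 \<subseteq> S1" "large S2"
      "(\<forall>u\<in>S2. \<forall>v\<in>S2. \<forall>z\<in>S2. u \<sqsubset> v \<longrightarrow> v \<sqsubset> z \<longrightarrow> t (u, z) = t (v, z)) \<or>
       (\<forall>u\<in>S2. \<forall>v\<in>S2. \<forall>z\<in>S2. u \<sqsubset> v \<longrightarrow> v \<sqsubset> z \<longrightarrow> t (u, z) \<noteq> t (v, z))"
      by (rule partition_triples[OF S1(2), of "\<lambda>u v z. t (u, z) = t (v, z)"])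
    have S2Z: "S2 \<subseteq> Z" using S2(1) S1(1) by blast
    from S2(3) show thesis
    proof
      assume eq: "\<forall>u\<in>S2. \<forall>v\<in>S2. \<forall>z\<in>S2. u \<sqsubset> v \<longrightarrow> v \<sqsubset> z \<longrightarrow> t (u, z) = t (v, z)"
      define e where "e y = t (SOME x. x \<in> S2 \<and> x \<sqsubset> y, y)" for y
      have "t (x, y) = e y" if xy: "x \<in> S2" "y \<in> S2" "x \<sqsubset> y" for x y
      proof -
        define x' where "x' = (SOME x. x \<in> S2 \<and> x \<sqsubset> y)"
        have "x' \<in> S2 \<and> x' \<sqsubset> y" unfolding x'_def by (rule someI[of _ x]) (use xy in blast)
        then have "t (x, y) = t (x', y)" using eq xy by (cases x x' rule: wo.linorder_cases) auto
        then show ?thesis unfolding e_def x'_def .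
      qed
      then show thesis using that[of S2 e] S2Z S2(2) by (auto simp: diag_def)
    next
      assume cols: "\<forall>u\<in>S2. \<forall>v\<in>S2. \<forall>z\<in>S2. u \<sqsubset> v \<longrightarrow> v \<sqsubset> z \<longrightarrow> t (u, z) \<noteq> t (v, z)"
      \<comment> \<open>The columns \<open>z\<close> in which row \<open>x'\<close> repeats the
        value \<open>t (x, y)\<close>; injectivity along rows leaves at most one.\<close>
      define B where "B x y x' = {z \<in> S2. x' \<in> S2 \<and> x' \<sqsubset> z \<and> t (x', z) = t (x, y)}" for x y x'
      have B: "small (B x y x')" for x y x'
      proof -
        have "z = z'" if z: "z \<in> B x y x'" "z' \<in> B x y x'" for z z'
        proof -
          have "x' \<in> S1" "z \<in> S1" "z' \<in> S1" "x' \<sqsubset> z" "x' \<sqsubset> z'" "t (x', z) = t (x', z')"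
            using z S2(1) unfolding B_def by auto
          then show ?thesis using rows by (cases z z' rule: wo.linorder_cases) force+
        qed
        then have "B x y x' = {} \<or> (\<exists>z. B x y x' = {z})" by blast
        then show ?thesis by (elim disjE exE) simp_all
      qed
      have "small (\<Union>x\<in>P. \<Union>y\<in>P. \<Union>x'\<in>P. B x y x')" if "small P" for P
        by (intro small_UN that B)
      then obtain S where S: "S \<subseteq> S2" "large S"
        "\<And>s. s \<in> S \<Longrightarrow> s \<notin> (\<Union>x\<in>{p \<in> S. p \<sqsubset> s}. \<Union>y\<in>{p \<in> S. p \<sqsubset> s}. \<Union>x'\<in>{p \<in> S. p \<sqsubset> s}. B x y x')"
        using thin[OF S2(2), of "\<lambda>P. \<Union>x\<in>P. \<Union>y\<in>P. \<Union>x'\<in>P. B x y x'"] by blast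
      have neq: "t (x, y) \<noteq> t (x', y')"
        if "x \<in> S" "y \<in> S" "x \<sqsubset> y" "x' \<in> S" "y' \<in> S" "x' \<sqsubset> y'" "y \<sqsubset> y'" for x y x' y'
      proof
        assume "t (x, y) = t (x', y')"
        then have "y' \<in> B x y x'" using that S(1) unfolding B_def by auto
        moreover have "x \<sqsubset> y'" using that(3,7) by (rule wo.less_trans)
        ultimately show False using S(3)[OF that(5)] that by blast
      qed
      have "inj_on t (diag S)"
      proof (rule inj_onI)
        fix z z' assume z: "z \<in> diag S" "z' \<in> diag S" and eq: "t z = t z'"
        obtain x y x' y' where zz: "z = (x, y)" "z' = (x', y')" by (cases z; cases z')
        have xy: "x \<in> S" "y \<in> S" "x \<sqsubset> y" and xy': "x' \<in> S" "y' \<in> S" "x' \<sqsubset> y'"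
          using z unfolding zz diag_def by auto
        have y: "y = y'"
          using neq[OF xy xy'] neq[OF xy' xy] eq unfolding zz by (cases y y' rule: wo.linorder_cases) auto
        have "x \<in> S2" "x' \<in> S2" "y' \<in> S2" "x \<sqsubset> y'" "x' \<sqsubset> y'" "t (x, y') = t (x', y')"
          using xy xy' S(1) eq unfolding zz y by auto
        then have "x = x'" using cols by (cases x x' rule: wo.linorder_cases) force+
        then show "z = z'" using zz y by simp
      qed
      then have False using t S(2) unfolding nowhere_injective_def by blast
      then show thesis ..
    qed
  qed
qed

lemma diag_mono: "S \<subseteq> S' \<Longrightarrow> diag S \<subseteq> diag S'"
  unfolding diag_def by auto

lemma canonical_list:
  fixes ts :: "('a \<times> 'a \<Rightarrow> 'a) list"
  assumes "set ts \<subseteq> nowhere_injective" "large Z"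
  shows "\<exists>S \<subseteq> Z. large S \<and> (\<forall>t\<in>set ts. \<exists>e. (\<forall>z\<in>diag S. t z = e (fst z)) \<or> (\<forall>z\<in>diag S. t z = e (snd z)))"
  using assms(1)
proof (induction ts)
  case Nil
  then show ?case using assms(2) by auto
next
  case (Cons t ts)
  then obtain S where S: "S \<subseteq> Z" "large S"
    "\<And>t. t \<in> set ts \<Longrightarrow> \<exists>e. (\<forall>z\<in>diag S. t z = e (fst z)) \<or> (\<forall>z\<in>diag S. t z = e (snd z))"
    by auto
  have "t \<in> nowhere_injective" using Cons.prems by simp
  then obtain S' e where S': "S' \<subseteq> S" "large S'"
    "(\<forall>z\<in>diag S'. t z = e (fst z)) \<or> (\<forall>z\<in>diag S'. t z = e (snd z))"
    by (rule canonical[OF _ S(2)])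
  have "\<exists>e. (\<forall>z\<in>diag S'. t' z = e (fst z)) \<or> (\<forall>z\<in>diag S'. t' z = e (snd z))"
    if "t' \<in> set (t # ts)" for t'
  proof (cases "t' = t")
    case True
    then show ?thesis using S'(3) by blast
  next
    case False
    then have "t' \<in> set ts" using that by simp
    then show ?thesis using S(3)[of t'] diag_mono[OF S'(1)] by (meson subsetD)
  qed
  then show ?case using S'(1,2) S(1) by blast
qed

text \<open>Each \<open>k x\<close> is put between \<open>h x\<close> and all later
  \<open>h y\<close>. Strict comparison of the images thus expresses weak comparison of the
  arguments, and points of the diagonal are moved strictly above it.\<close>

lemma interleaved_embeddings:
  assumes "large S"
  obtains h k :: "'a \<Rightarrow> 'a" where "\<And>x. h x \<in> S" "\<And>x. k x \<in> S"
    "\<And>x y. h x \<sqsubset> k y \<longleftrightarrow> x \<sqsubseteq> y" "\<And>x y. k y \<sqsubset> h x \<longleftrightarrow> y \<sqsubset> x"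
proof -
  have "\<exists>q. q \<in> S \<and> p \<sqsubset> q" for p using large_above[OF assms] by blast
  then obtain nx where nx: "\<And>p. nx p \<in> S" "\<And>p. p \<sqsubset> nx p" by metis
  have "small (\<Union>p\<in>P. {z. z \<sqsubseteq> nx p})" if "small P" for P
    by (intro small_UN that small_atMost)
  then obtain h :: "'a \<Rightarrow> 'a" where h: "\<And>i. h i \<in> S" "\<And>i. h i \<notin> (\<Union>p\<in>h ` seg i. {z. z \<sqsubseteq> nx p})"
    using select[of "\<lambda>_. S" "\<lambda>_ P. \<Union>p\<in>P. {z. z \<sqsubseteq> nx p}", OF assms] by blast
  have lt: "nx (h y) \<sqsubset> h x" if "y \<sqsubset> x" for x y
    using h(2)[of x] that by (simp add: wo.not_le)
  have le: "h x \<sqsubset> nx (h y)" if "x \<sqsubseteq> y" for x y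
  proof (cases "x = y")
    case False
    then have "nx (h x) \<sqsubset> h y" using that by (intro lt) (simp add: wless_def)
    then show ?thesis by (rule wo.less_trans[OF wo.less_trans[OF nx(2)] nx(2)])
  qed (use nx(2) in simp)
  show thesis
  proof (rule that[of h "\<lambda>x. nx (h x)"])
    show "h x \<sqsubset> nx (h y) \<longleftrightarrow> x \<sqsubseteq> y" for x y
      using lt[of y x] le[of x y] wo.less_asym[of "h x" "nx (h y)"] wo.not_le[of x y] by auto
    show "nx (h y) \<sqsubset> h x \<longleftrightarrow> y \<sqsubset> x" for x y
      using lt[of y x] le[of x y] wo.less_asym[of "h x" "nx (h y)"] wo.not_le[of x y] by auto
  qed (use h nx in auto)
qed

lemma monotone_embedding:
  assumes "large S"
  obtains h :: "'a \<Rightarrow> 'a" where "\<And>x. h x \<in> S" "\<And>x y. x \<sqsubset> y \<Longrightarrow> h x \<sqsubset> h y"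
proof -
  obtain h k :: "'a \<Rightarrow> 'a" where h: "\<And>x. h x \<in> S" "\<And>x. k x \<in> S"
    "\<And>x y. h x \<sqsubset> k y \<longleftrightarrow> x \<sqsubseteq> y" "\<And>x y. k y \<sqsubset> h x \<longleftrightarrow> y \<sqsubset> x"
    by (rule interleaved_embeddings[OF assms]) blast
  have "h x \<sqsubset> h y" if "x \<sqsubset> y" for x y
    using h(3)[of x x] h(4)[of x y] h(4)[of y x] that wo.less_trans[of "h x" "k x" "h y"] by simp
  then show thesis using that h(1) by blast
qed

text \<open>It allows a bound that depends on a value to be exceeded without losing the value:
  \<open>x\<close> can be recovered from \<open>H' x\<close>.\<close>

lemma injective_above:
  obtains H' :: "'a \<Rightarrow> 'a" where "inj H'" "\<And>x. H x \<sqsubset> H' x"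
proof -
  have B: "small (P \<union> {z. z \<sqsubseteq> H i})" if "small P" for i P
    by (intro small_Un that small_atMost)
  have "\<exists>w :: 'a \<Rightarrow> 'a. \<forall>i. w i \<notin> w ` seg i \<union> {z. z \<sqsubseteq> H i}"
    by (rule select[of "\<lambda>_. UNIV" "\<lambda>i P. P \<union> {z. z \<sqsubseteq> H i}"]) (use B in auto)
  then obtain w :: "'a \<Rightarrow> 'a" where w: "\<And>i. w i \<notin> w ` seg i \<union> {z. z \<sqsubseteq> H i}" by blast
  have "w x \<noteq> w y" if "x \<sqsubset> y" for x y
    using w[of y] that by (metis UnI1 imageI mem_Collect_eq)
  then have "inj w" by (metis injI wo.neq_iff)
  then show thesis using that[of w] w by (simp add: wo.not_le)
qed

text \<open>On some \<open>diag S'\<close> the arguments \<open>ts\<close> of the violation agree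
  with functions of a single coordinate, and these belong to \<open>D\<close> since all unary
  operations do. A monotone embedding carries the result from \<open>diag S'\<close> to
  \<open>diag UNIV\<close>.\<close>

lemma diag_injective_binary:
  fixes D :: "'a operation set"
  assumes D: "clone D" and U: "unaries D = UNIV" and T: "\<not> D \<subseteq> Pol nowhere_injective"
  obtains g where "g \<in> binaries D" "inj_on g (diag UNIV)"
proof -
  obtain n f ts where f: "(n, f) \<in> D" "length ts = n" "set ts \<subseteq> nowhere_injective"
    "subst f ts \<notin> (nowhere_injective :: ('a \<times> 'a \<Rightarrow> 'a) set)"
    by (rule not_subset_PolE[OF clone_subset[OF D] T])
  from f(4) obtain S where S: "large S" "inj_on (subst f ts) (diag S)"
    unfolding nowhere_injective_def by blast
  obtain S' where S': "S' \<subseteq> S" "large S'"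
    "\<And>t. t \<in> set ts \<Longrightarrow> \<exists>e. (\<forall>z\<in>diag S'. t z = e (fst z)) \<or> (\<forall>z\<in>diag S'. t z = e (snd z))"
    using canonical_list[OF f(3) S(1)] by blast
  have un: "(\<lambda>z. e (fst z)) \<in> binaries D" "(\<lambda>z. e (snd z)) \<in> binaries D" for e
    using binaries_unary[OF D] binaries_fst[OF D] binaries_snd[OF D] U by auto
  have "\<forall>t\<in>set ts. \<exists>t'. t' \<in> binaries D \<and> (\<forall>z\<in>diag S'. t' z = t z)"
    using S'(3) un by metis
  then obtain \<chi> where \<chi>: "\<And>t. t \<in> set ts \<Longrightarrow> \<chi> t \<in> binaries D"
    "\<And>t z. t \<in> set ts \<Longrightarrow> z \<in> diag S' \<Longrightarrow> \<chi> t z = t z" by metis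
  define G where "G = subst f (map \<chi> ts)"
  have G: "G \<in> binaries D" unfolding G_def
    by (rule subst_binaries[OF D]) (use f(1,2) \<chi>(1) member_operation_of[OF D] in auto)
  have Gf: "G z = subst f ts z" if "z \<in> diag S'" for z
    unfolding G_def subst_def using \<chi>(2)[OF _ that] by (simp add: comp_def cong: map_cong)
  obtain h :: "'a \<Rightarrow> 'a" where h: "\<And>x. h x \<in> S'" "\<And>x y. x \<sqsubset> y \<Longrightarrow> h x \<sqsubset> h y"
    by (rule monotone_embedding[OF S'(2)]) blast
  have hinj: "h x = h y \<longleftrightarrow> x = y" for x y using h(2) by (metis wo.neq_iff)
  show thesis
  proof (rule that)
    show "(\<lambda>z. G (h (fst z), h (snd z))) \<in> binaries D" by (intro binaries_comp[OF D] G un)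
    show "inj_on (\<lambda>z. G (h (fst z), h (snd z))) (diag UNIV)"
    proof (rule inj_onI)
      fix z z' :: "'a \<times> 'a"
      assume z: "z \<in> diag UNIV" "z' \<in> diag UNIV"
        and eq: "G (h (fst z), h (snd z)) = G (h (fst z'), h (snd z'))"
      have hd: "(h (fst z), h (snd z)) \<in> diag S'" "(h (fst z'), h (snd z')) \<in> diag S'"
        using z h unfolding diag_def by auto
      then have "subst f ts (h (fst z), h (snd z)) = subst f ts (h (fst z'), h (snd z'))"
        using eq Gf by simp
      then have "(h (fst z), h (snd z)) = (h (fst z'), h (snd z'))"
        using inj_onD[OF S(2)] hd diag_mono[OF S'(1)] by blast
      then show "z = z'" using hinj by (simp add: prod_eq_iff)
    qed
  qed
qed

section \<open>Generating all binary operations from one that is injective above the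
  diagonal\<close>

context
  fixes D :: "'a operation set" and g :: "'a \<times> 'a \<Rightarrow> 'a"
  assumes D: "clone D" and U: "unaries D = UNIV"
    and g: "g \<in> binaries D" "inj_on g (diag UNIV)"
begin

lemma binaries_post: "q \<in> binaries D \<Longrightarrow> (\<lambda>z. p (q z)) \<in> binaries D"
  using binaries_unary[OF D] U by auto

lemma binaries_swap: "p \<in> binaries D \<Longrightarrow> (\<lambda>z. p (snd z, fst z)) \<in> binaries D"
  using binaries_comp[OF D _ binaries_snd[OF D] binaries_fst[OF D]] .

text \<open>Raising \<open>r z\<close> to \<open>H' (r z)\<close> moves the pair above the diagonal,
  where \<open>g\<close> is injective; as \<open>H'\<close> is injective too, a unary operation
  decodes both values. This is the substitute for a pairing operation throughout.\<close>

lemma bounded_pairing: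
  assumes p: "p \<in> binaries D" and r: "r \<in> binaries D" and le: "\<And>z. p z \<sqsubseteq> H (r z)"
  shows "(\<lambda>z. \<psi> (p z, r z)) \<in> binaries D"
proof -
  obtain H' :: "'a \<Rightarrow> 'a" where H': "inj H'" "\<And>x. H x \<sqsubset> H' x" by (rule injective_above[of H]) blast
  have dg: "(p z, H' (r z)) \<in> diag UNIV" for z
    using le[of z] H'(2)[of "r z"] wo.le_less_trans unfolding diag_def by auto
  define v where "v w = \<psi> (fst (inv_into (diag UNIV) g w), inv H' (snd (inv_into (diag UNIV) g w)))" for w
  have "(\<lambda>z. v (g (p z, H' (r z)))) \<in> binaries D"
    by (intro binaries_post[where p = v] binaries_comp[OF D g(1)] p binaries_post[OF r])
  moreover have "v (g (p z, H' (r z))) = \<psi> (p z, r z)" for z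
    unfolding v_def using inv_into_f_f[OF g(2) dg] H'(1) by simp
  ultimately show ?thesis by simp
qed

text \<open>After interleaving, \<open>g\<close> encodes the pairs with
  \<open>x \<sqsubseteq> y\<close> injectively, and by the separation hypothesis the codes of all
  other pairs are recognisable. One unary function can then decode and apply \<open>\<phi>\<close>
  to the former and return \<open>c\<close> on the latter.\<close>

lemma separated_diag:
  assumes S: "large S" and sep: "\<And>u v p q. u \<in> S \<Longrightarrow> v \<in> S \<Longrightarrow> p \<in> S \<Longrightarrow> q \<in> S \<Longrightarrow>
      u \<sqsubset> v \<Longrightarrow> p \<sqsubset> q \<Longrightarrow> g (v, u) \<noteq> g (p, q)"
  shows "(\<lambda>z. if fst z \<sqsubseteq> snd z then \<phi> z else c) \<in> binaries D"
proof -
  obtain h k :: "'a \<Rightarrow> 'a" where h: "\<And>x. h x \<in> S" "\<And>x. k x \<in> S"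
    "\<And>x y. h x \<sqsubset> k y \<longleftrightarrow> x \<sqsubseteq> y" "\<And>x y. k y \<sqsubset> h x \<longleftrightarrow> y \<sqsubset> x"
    by (rule interleaved_embeddings[OF S]) blast
  have hinj: "h x = h y \<longleftrightarrow> x = y" for x y using h(3,4) by (metis wo.neq_iff wo.order.refl wo.not_le)
  have kinj: "k x = k y \<longleftrightarrow> x = y" for x y using h(3,4) by (metis wo.neq_iff wo.order.refl wo.not_le)
  define G where "G z = g (h (fst z), k (snd z))" for z
  have G: "G \<in> binaries D" unfolding G_def
    by (intro binaries_comp[OF D g(1)] binaries_post[OF binaries_fst[OF D]] binaries_post[OF binaries_snd[OF D]])
  let ?L = "{z. fst z \<sqsubseteq> snd z} :: ('a \<times> 'a) set"
  have inj: "inj_on G ?L"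
  proof (rule inj_onI)
    fix z z' assume z: "z \<in> ?L" "z' \<in> ?L" and "G z = G z'"
    then have "(h (fst z), k (snd z)) = (h (fst z'), k (snd z'))"
      using h(3) unfolding G_def by (intro inj_onD[OF g(2)]) (auto simp: diag_def)
    then show "z = z'" using hinj kinj by (simp add: prod_eq_iff)
  qed
  have out: "G z \<notin> G ` ?L" if "z \<notin> ?L" for z
  proof
    assume "G z \<in> G ` ?L"
    then obtain z' where "fst z' \<sqsubseteq> snd z'" "g (h (fst z), k (snd z)) = g (h (fst z'), k (snd z'))"
      unfolding G_def by auto
    then show False
      using sep[of "k (snd z)" "h (fst z)" "h (fst z')" "k (snd z')"] h that by (auto simp: wo.not_le)
  qed
  define v where "v w = (if w \<in> G ` ?L then \<phi> (inv_into ?L G w) else c)" for w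
  have "v (G z) = (if fst z \<sqsubseteq> snd z then \<phi> z else c)" for z
    using out[of z] inv_into_f_f[OF inj, of z] unfolding v_def by auto
  then show ?thesis using binaries_post[OF G, of v] by simp
qed

text \<open>For \<open>x \<sqsupset> y\<close> the first coordinate decoded from \<open>g (k y, h x)\<close> is \<open>k y\<close>; for \<open>x \<sqsubseteq> y\<close>
  it is smaller. So it distinguishes the two cases, and it is bounded by a function of \<open>y\<close> alone,
  which is what \<open>bounded_pairing\<close> needs to combine it with other values.\<close>

lemma trapped_diag:
  assumes S: "large S" and trap: "\<And>u v p q. u \<in> S \<Longrightarrow> v \<in> S \<Longrightarrow>
      u \<sqsubset> v \<Longrightarrow> p \<sqsubset> q \<Longrightarrow> g (v, u) = g (p, q) \<Longrightarrow> q \<sqsubseteq> v"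
  shows "(\<lambda>z. if fst z \<sqsubseteq> snd z then \<phi> z else c) \<in> binaries D"
proof -
  obtain h k :: "'a \<Rightarrow> 'a" where h: "\<And>x. h x \<in> S" "\<And>x. k x \<in> S"
    "\<And>x y. h x \<sqsubset> k y \<longleftrightarrow> x \<sqsubseteq> y" "\<And>x y. k y \<sqsubset> h x \<longleftrightarrow> y \<sqsubset> x"
    by (rule interleaved_embeddings[OF S]) blast
  obtain bot :: 'a where bot: "\<And>x. bot \<sqsubseteq> x"
    by (rule that[of "wo.Least (\<lambda>_. True)"]) (rule wo.Least_le, simp)
  define first where "first w = (if w \<in> g ` diag UNIV then fst (inv_into (diag UNIV) g w) else bot)" for w
  have first: "first (g (p, q)) = p" if "p \<sqsubset> q" for p q
    using inv_into_f_f[OF g(2), of "(p, q)"] that unfolding first_def diag_def by force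
  define N where "N z = first (g (k (snd z), h (fst z)))" for z
  have N: "N \<in> binaries D" unfolding N_def
    by (intro binaries_post[where p = first] binaries_comp[OF D g(1)] binaries_post[OF binaries_fst[OF D]] binaries_post[OF binaries_snd[OF D]])
  have Ngt: "N z = k (snd z)" if "\<not> fst z \<sqsubseteq> snd z" for z
    unfolding N_def using h(4) that by (intro first) (simp add: wo.not_le)
  have Nle: "N z \<sqsubset> k (snd z)" if "fst z \<sqsubseteq> snd z" for z
  proof (cases "g (k (snd z), h (fst z)) \<in> g ` diag UNIV")
    case True
    then obtain p q where pq: "p \<sqsubset> q" "g (k (snd z), h (fst z)) = g (p, q)"
      unfolding diag_def by auto
    then have "q \<sqsubseteq> k (snd z)" using trap h that by blast
    then show ?thesis using pq first[OF pq(1)] unfolding N_def by (simp add: wo.less_le_trans)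
  next
    case False
    have "bot \<sqsubset> k (snd z)" using bot[of "h (snd z)"] h(3)[of "snd z" "snd z"] wo.le_less_trans[of bot "h (snd z)"] by simp
    then show ?thesis using False unfolding N_def first_def by simp
  qed
  have choice: "(\<lambda>z. if fst z \<sqsubseteq> snd z then \<alpha> (snd z) else \<beta> (snd z)) \<in> binaries D" for \<alpha> \<beta>
  proof -
    have "N z \<sqsubseteq> k (snd z)" for z using Ngt[of z] Nle[of z] by (cases "fst z \<sqsubseteq> snd z") auto
    then have "(\<lambda>z. case (N z, snd z) of (m, y) \<Rightarrow> if m \<noteq> k y then \<alpha> y else \<beta> y) \<in> binaries D"
      by (rule bounded_pairing[OF N binaries_snd[OF D]])
    moreover have "N z = k (snd z) \<longleftrightarrow> \<not> fst z \<sqsubseteq> snd z" for z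
      using Ngt[of z] Nle[of z] by (cases "fst z \<sqsubseteq> snd z") auto
    ultimately show ?thesis by simp
  qed
  obtain e :: "'a \<times> 'a \<Rightarrow> 'a" where e: "bij e" by (rule pairing)
  note [simp] = inv_f_f[OF bij_is_inj[OF e]]
  obtain a :: 'a where a: "a \<noteq> bot"
    using infinite_UNIV ex_new_if_finite[of "{bot}"] by auto
  \<comment> \<open>Swapping the arguments of \<open>choice\<close> gives tests of the form
    \<open>snd z \<sqsubseteq> fst z\<close> for functions of \<open>fst z\<close>, so
    \<open>lo\<close> erases the first argument on the diagonal too. The tags separate the three
    order relations: on the diagonal both equal \<open>bot\<close>, and \<open>snd z\<close>
    supplies the lost argument.\<close>
  define lo where "lo z = (if snd z \<sqsubseteq> fst z then bot else fst z)" for z :: "'a \<times> 'a"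
  define tag where "tag z = (if fst z \<sqsubseteq> snd z then bot else a)" for z :: "'a \<times> 'a"
  define tag' where "tag' z = (if snd z \<sqsubseteq> fst z then bot else a)" for z :: "'a \<times> 'a"
  have lo: "lo \<in> binaries D" unfolding lo_def using binaries_swap[OF choice[of "\<lambda>_. bot" "\<lambda>x. x"]] by (simp cong: if_cong)
  have tag: "tag \<in> binaries D" unfolding tag_def by (rule choice)
  have tag': "tag' \<in> binaries D"
    unfolding tag'_def using binaries_swap[OF choice[of "\<lambda>_. bot" "\<lambda>_. a"]] by simp
  have "lo z \<sqsubseteq> snd z" for z unfolding lo_def using bot by (auto simp: wo.not_le intro: wo.less_imp_le)
  then have e1: "(\<lambda>z. e (lo z, snd z)) \<in> binaries D"
    by (rule bounded_pairing[OF lo binaries_snd[OF D]])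
  have le_a: "tag z \<sqsubseteq> a" "tag' z \<sqsubseteq> a" for z unfolding tag_def tag'_def using bot by auto
  have e2: "(\<lambda>z. e (tag z, e (lo z, snd z))) \<in> binaries D"
    by (rule bounded_pairing[OF tag e1]) (rule le_a)
  have "(\<lambda>z. case (tag' z, e (tag z, e (lo z, snd z))) of (t', w) \<Rightarrow>
      (case inv e w of (t, w') \<Rightarrow> case inv e w' of (x, y) \<Rightarrow>
        if t = bot then (if t' = bot then \<phi> (y, y) else \<phi> (x, y)) else c)) \<in> binaries D"
    by (rule bounded_pairing[OF tag' e2]) (rule le_a)
  also have "(\<lambda>z. case (tag' z, e (tag z, e (lo z, snd z))) of (t', w) \<Rightarrow>
      (case inv e w of (t, w') \<Rightarrow> case inv e w' of (x, y) \<Rightarrow>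
        if t = bot then (if t' = bot then \<phi> (y, y) else \<phi> (x, y)) else c)) =
    (\<lambda>z. if fst z \<sqsubseteq> snd z then \<phi> z else c)"
  proof
    fix z :: "'a \<times> 'a"
    obtain x y where z: "z = (x, y)" by fastforce
    show "(case (tag' z, e (tag z, e (lo z, snd z))) of (t', w) \<Rightarrow>
      (case inv e w of (t, w') \<Rightarrow> case inv e w' of (x, y) \<Rightarrow>
        if t = bot then (if t' = bot then \<phi> (y, y) else \<phi> (x, y)) else c)) =
      (if fst z \<sqsubseteq> snd z then \<phi> z else c)"
      unfolding z using a wo.order.antisym[of x y] by (auto simp: tag_def tag'_def lo_def)
  qed
  finally show ?thesis .
qed

text \<open>A value \<open>g (v, u)\<close> from below the diagonal may coincide with the value of
  an increasing pair, which is then unique; the partition property decides uniformly whether there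
  is such a pair whose larger entry exceeds \<open>v\<close>. If always, thinning removes these
  entries and the values become separated. If never, all such entries are trapped at or below
  \<open>v\<close>.\<close>

lemma binaries_le_diag: "(\<lambda>z. if fst z \<sqsubseteq> snd z then \<phi> z else c) \<in> binaries D"
proof -
  define R where "R u v \<longleftrightarrow> (\<exists>p q. p \<sqsubset> q \<and> g (v, u) = g (p, q) \<and> v \<sqsubset> q)" for u v
  obtain S where S: "S \<subseteq> UNIV" "large S"
    "(\<forall>x\<in>S. \<forall>y\<in>S. x \<sqsubset> y \<longrightarrow> R x y) \<or> (\<forall>x\<in>S. \<forall>y\<in>S. x \<sqsubset> y \<longrightarrow> \<not> R x y)"
    by (rule partition_in[OF large_UNIV, where R = R])
  have uniq: "p = p' \<and> q = q'" if "p \<sqsubset> q" "p' \<sqsubset> q'" "g (p, q) = g (p', q')" for p q p' q'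
    using inj_onD[OF g(2) that(3)] that(1,2) unfolding diag_def by simp
  from S(3) show ?thesis
  proof
    assume R: "\<forall>x\<in>S. \<forall>y\<in>S. x \<sqsubset> y \<longrightarrow> R x y"
    define B where "B u v = {q. \<exists>p. p \<sqsubset> q \<and> g (v, u) = g (p, q)}" for u v
    have B: "small (B u v)" for u v
    proof -
      have "q = q'" if "q \<in> B u v" "q' \<in> B u v" for q q' using that uniq unfolding B_def by force
      then have "B u v = {} \<or> (\<exists>q. B u v = {q})" by blast
      then show ?thesis by (elim disjE exE) simp_all
    qed
    have "small (\<Union>u\<in>P. \<Union>v\<in>P. B u v)" if "small P" for P
      by (intro small_UN that B)
    then obtain S' where S': "S' \<subseteq> S" "large S'"
      "\<And>s. s \<in> S' \<Longrightarrow> s \<notin> (\<Union>u\<in>{p \<in> S'. p \<sqsubset> s}. \<Union>v\<in>{p \<in> S'. p \<sqsubset> s}. B u v)"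
      using thin[OF S(2), of "\<lambda>P. \<Union>u\<in>P. \<Union>v\<in>P. B u v"] by blast
    show ?thesis
    proof (rule separated_diag[OF S'(2)])
      fix u v p q
      assume uv: "u \<in> S'" "v \<in> S'" and pq: "p \<in> S'" "q \<in> S'" and lt: "u \<sqsubset> v" "p \<sqsubset> q"
      show "g (v, u) \<noteq> g (p, q)"
      proof
        assume eq: "g (v, u) = g (p, q)"
        have "R u v" using R S'(1) uv lt by blast
        then have vq: "v \<sqsubset> q" using uniq lt(2) eq unfolding R_def by metis
        moreover have "u \<sqsubset> q" by (rule wo.less_trans[OF lt(1) vq])
        moreover have "q \<in> B u v" using eq lt(2) unfolding B_def by blast
        ultimately show False using S'(3)[OF pq(2)] uv by blast
      qed
    qed
  next
    assume "\<forall>x\<in>S. \<forall>y\<in>S. x \<sqsubset> y \<longrightarrow> \<not> R x y"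
    then show ?thesis
      by (intro trapped_diag[OF S(2)]) (metis R_def wo.not_le)
  qed
qed

text \<open>Regularity bounds the column of \<open>y\<close> by some \<open>H y\<close>. The two
  halves of \<open>t\<close>, cut at the diagonal, are then bounded by a function of
  \<open>snd z\<close>, so one half can be stored together with \<open>snd z\<close> and the other
  half added to this code.\<close>

lemma binaries_small_columns:
  assumes t: "\<And>y. small (range (\<lambda>x. t (x, y)))"
  shows "t \<in> binaries D"
proof -
  obtain c :: 'a where True by blast
  obtain e :: "'a \<times> 'a \<Rightarrow> 'a" where e: "bij e" by (rule pairing)
  note [simp] = inv_f_f[OF bij_is_inj[OF e]]
  have "\<exists>b. \<forall>a \<in> insert c (range (\<lambda>x. t (x, y))). a \<sqsubseteq> b" for y
  proof -
    have "small (insert c (range (\<lambda>x. t (x, y))))"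
      using small_Un[OF small_singleton[of c] t[of y]] by simp
    then show ?thesis using small_bounded wo.less_imp_le by metis
  qed
  then obtain H where H: "\<And>y a. a \<in> insert c (range (\<lambda>x. t (x, y))) \<Longrightarrow> a \<sqsubseteq> H y" by metis
  define z1 where "z1 z = (if fst z \<sqsubseteq> snd z then t z else c)" for z
  define z2 where "z2 z = (if snd z \<sqsubseteq> fst z then t z else c)" for z
  have z1: "z1 \<in> binaries D" unfolding z1_def by (rule binaries_le_diag)
  have z2: "z2 \<in> binaries D" unfolding z2_def
    using binaries_swap[OF binaries_le_diag[of "\<lambda>z. t (snd z, fst z)" c]] by (simp cong: if_cong)
  have b: "z1 z \<sqsubseteq> H (snd z)" "z2 z \<sqsubseteq> H (snd z)" for z
    using H[of _ "snd z"] by (cases z; auto simp: z1_def z2_def)+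
  have w: "(\<lambda>z. e (z1 z, snd z)) \<in> binaries D"
    by (rule bounded_pairing[OF z1 binaries_snd[OF D] b(1)])
  \<comment> \<open>Reading \<open>z1\<close> unless it is \<open>c\<close>, and \<open>z2\<close>
    otherwise, is safe: if \<open>z1 z = c\<close> on its own half, then \<open>t z = c\<close> and
    \<open>z2 z\<close> is \<open>c\<close> as well.\<close>
  have "(\<lambda>z. case (z2 z, e (z1 z, snd z)) of (a, w) \<Rightarrow>
      (if fst (inv e w) \<noteq> c then fst (inv e w) else a)) \<in> binaries D"
    by (rule bounded_pairing[OF z2 w, of "\<lambda>w. H (snd (inv e w))"]) (simp add: b)
  also have "(\<lambda>z. case (z2 z, e (z1 z, snd z)) of (a, w) \<Rightarrow>
      (if fst (inv e w) \<noteq> c then fst (inv e w) else a)) = t"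
  proof
    fix z
    show "(case (z2 z, e (z1 z, snd z)) of (a, w) \<Rightarrow> (if fst (inv e w) \<noteq> c then fst (inv e w) else a)) = t z"
      using wo.linear[of "fst z" "snd z"] by (auto simp: z1_def z2_def)
  qed
  finally show ?thesis .
qed

lemma almost_unary_subset: "almost_unary \<subseteq> binaries D"
proof
  fix t :: "'a \<times> 'a \<Rightarrow> 'a" assume "t \<in> almost_unary"
  then consider "\<And>x. small (range (\<lambda>y. t (x, y)))" | "\<And>y. small (range (\<lambda>x. t (x, y)))"
    unfolding almost_unary_def by blast
  then show "t \<in> binaries D"
  proof cases
    case 1
    then have "(\<lambda>z. t (snd z, fst z)) \<in> binaries D" by (intro binaries_small_columns) simp
    from binaries_swap[OF this] show ?thesis by simp
  next
    case 2
    then show ?thesis by (rule binaries_small_columns)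
  qed
qed

text \<open>Two almost unary operations \<open>m\<close>, \<open>n\<close> steer \<open>G\<close> to a value \<open>M\<close> that codes the larger of
  the two arguments and hence bounds both.\<close>

lemma not_almost_unary_generates:
  assumes G: "G \<in> binaries D" "G \<notin> almost_unary"
  shows "binaries D = UNIV"
proof -
  obtain x0 y0 where x0: "large (range (\<lambda>y. G (x0, y)))" and y0: "large (range (\<lambda>x. G (x, y0)))"
    using G(2) unfolding almost_unary_def by blast
  obtain \<beta> :: "'a \<Rightarrow> 'a" where \<beta>: "bij_betw \<beta> UNIV (range (\<lambda>y. G (x0, y)))" by (rule large_bij[OF x0])
  obtain \<alpha> :: "'a \<Rightarrow> 'a" where \<alpha>: "bij_betw \<alpha> UNIV (range (\<lambda>x. G (x, y0)))" by (rule large_bij[OF y0])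
  \<comment> \<open>\<open>b\<close> and \<open>a\<close> are unary reparametrisations under which
    the row \<open>x0\<close> and the column \<open>y0\<close> of \<open>G\<close> become injective,
    with values listed by \<open>\<beta>\<close> and \<open>\<alpha>\<close>.\<close>
  define b where "b y = inv (\<lambda>y. G (x0, y)) (\<beta> y)" for y
  have b: "G (x0, b y) = \<beta> y" for y
    unfolding b_def by (rule f_inv_into_f[of _ "\<lambda>y. G (x0, y)"]) (use bij_betwE[OF \<beta>] in auto)
  define a where "a x = inv (\<lambda>x. G (x, y0)) (\<alpha> x)" for x
  have a: "G (a x, y0) = \<alpha> x" for x
    unfolding a_def by (rule f_inv_into_f[of _ "\<lambda>x. G (x, y0)"]) (use bij_betwE[OF \<alpha>] in auto)
  define m where "m z = (if fst z \<sqsubseteq> snd z then x0 else a (fst z))" for z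
  define n where "n z = (if fst z \<sqsubseteq> snd z then b (snd z) else y0)" for z
  have "small (range (\<lambda>y. m (x, y)))" "small (range (\<lambda>y. n (y, x)))" for x
    by (rule small_finite, rule finite_subset[of _ "{x0, a x}"], use m_def in auto)
      (rule small_finite, rule finite_subset[of _ "{b x, y0}"], use n_def in auto)
  then have "m \<in> almost_unary" "n \<in> almost_unary" unfolding almost_unary_def by simp_all
  then have mn: "m \<in> binaries D" "n \<in> binaries D" using almost_unary_subset by auto
  define M where "M z = G (m z, n z)" for z
  have M: "M \<in> binaries D" unfolding M_def by (intro binaries_comp[OF D G(1)] mn)
  have Mz: "M z = (if fst z \<sqsubseteq> snd z then \<beta> (snd z) else \<alpha> (fst z))" for z
    unfolding M_def m_def n_def using a b by simp
  \<comment> \<open>The ranges of \<open>\<beta>\<close> and \<open>\<alpha>\<close> may overlap, so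
    \<open>M z\<close> need not reveal which case applied; the maximum of both decodings is an upper
    bound in either case.\<close>
  define K where "K w = wo.max (inv \<beta> w) (inv \<alpha> w)" for w
  have inv: "inv \<beta> (\<beta> y) = y" "inv \<alpha> (\<alpha> y) = y" for y
    by (rule inv_f_f[OF bij_betw_imp_inj_on[OF \<beta>]], rule inv_f_f[OF bij_betw_imp_inj_on[OF \<alpha>]])
  have K: "fst z \<sqsubseteq> K (M z) \<and> snd z \<sqsubseteq> K (M z)" for z
  proof (cases "fst z \<sqsubseteq> snd z")
    case True
    have "snd z \<sqsubseteq> K (M z)" unfolding K_def Mz using True inv by simp
    then show ?thesis using wo.order_trans[OF True] by simp
  next
    case False
    have "fst z \<sqsubseteq> K (M z)" unfolding K_def Mz using False inv by simp
    then show ?thesis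
      using wo.order_trans[of "snd z" "fst z"] False wo.linear[of "fst z" "snd z"] by auto
  qed
  obtain e :: "'a \<times> 'a \<Rightarrow> 'a" where e: "bij e" by (rule pairing)
  note [simp] = inv_f_f[OF bij_is_inj[OF e]]
  have w: "(\<lambda>z. e (fst z, M z)) \<in> binaries D"
    by (rule bounded_pairing[OF binaries_fst[OF D] M, of K]) (use K in blast)
  have "\<phi> \<in> binaries D" for \<phi>
  proof -
    have "(\<lambda>z. case (snd z, e (fst z, M z)) of (y, w) \<Rightarrow> \<phi> (fst (inv e w), y)) \<in> binaries D"
      by (rule bounded_pairing[OF binaries_snd[OF D] w, of "\<lambda>w. K (snd (inv e w))"]) (use K in simp)
    then show ?thesis by simp
  qed
  then show ?thesis by blast
qed

end

text \<open>The violation of \<open>nowhere_injective\<close> comes first: it gives \<open>g\<close>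
  and with it all almost unary operations, so the arguments in a violation of
  \<open>almost_unary\<close> are themselves in the clone.\<close>

theorem clone_above_unaries:
  fixes D :: "'a operation set"
  assumes D: "clone D" and U: "unaries D = UNIV"
    and T1: "\<not> D \<subseteq> Pol almost_unary" and T2: "\<not> D \<subseteq> Pol nowhere_injective"
  shows "D = operations"
proof -
  obtain g where g: "g \<in> binaries D" "inj_on g (diag UNIV)"
    by (rule diag_injective_binary[OF D U T2])
  obtain n f ts where f: "(n, f) \<in> D" "length ts = n" "set ts \<subseteq> almost_unary"
    "subst f ts \<notin> (almost_unary :: ('a \<times> 'a \<Rightarrow> 'a) set)"
    by (rule not_subset_PolE[OF clone_subset[OF D] T1])
  have "subst f ts \<in> binaries D"
    by (rule subst_binaries[OF D _ f(2)])
      (use f(1,3) member_operation_of[OF D] almost_unary_subset[OF D U g] in auto)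
  then show ?thesis
    using binaries_generate[OF D not_almost_unary_generates[OF D U g _ f(4)]] by blast
qed

end

section \<open>Functions with large fibres\<close>

definition small_fibred :: "('a \<Rightarrow> 'a) set" where
  "small_fibred = {f. \<forall>y. small (f -` {y})}"

definition mostly_small_fibred :: "('a \<Rightarrow> 'a) set" where
  "mostly_small_fibred = {f. small {y. \<not> small (f -` {y})}}"

definition missing :: "'a set \<Rightarrow> ('a \<Rightarrow> 'a) set" where
  "missing V = {f. V \<lesssim> - range f}"

definition almost_onto_or_below :: "'a set \<Rightarrow> ('a \<Rightarrow> 'a) set" where
  "almost_onto_or_below W = {f. small (- range f) \<or> \<not> W \<lesssim> range f}"

definition large_fibred :: "('a \<Rightarrow> 'a) set" where
  "large_fibred = {f. \<forall>x. \<not> small (f -` {f x})}"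

section \<open>Extending partial maps to permutations and to functions with large fibres\<close>

context ramsey_cardinal
begin

lemma large_fibredI: "(\<And>x :: 'a. large (f -` {f x})) \<Longrightarrow> f \<in> large_fibred"
  unfolding large_fibred_def by simp

lemma large_fibredD: "f \<in> large_fibred \<Longrightarrow> large (f -` {f (x :: 'a)})"
  unfolding large_fibred_def by simp

lemma large_fibred_post:
  fixes f h :: "'a \<Rightarrow> 'a"
  shows "f \<in> large_fibred \<Longrightarrow> (\<lambda>x. h (f x)) \<in> large_fibred"
proof (rule large_fibredI)
  fix x assume "f \<in> large_fibred"
  from large_fibredD[OF this, of x] show "large ((\<lambda>x. h (f x)) -` {h (f x)})"
    by (rule large_mono[rotated]) auto
qed

lemma large_Un_cases: "large (A \<union> B) \<Longrightarrow> large A \<or> large (B :: 'a set)"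
  using small_Un by blast

lemma large_Compl: "small A \<Longrightarrow> large (- A :: 'a set)"
  using large_Diff[OF large_UNIV, of A] by (simp add: Compl_eq_Diff_UNIV)

text \<open>The means by which permutations imitate other functions: the two complements, being
  large, are equipollent, and any bijection between them completes the injection.\<close>

lemma extend_to_bij:
  assumes "inj_on a W" "large (- W)" "large (- (a ` W))"
  obtains \<pi> :: "'a \<Rightarrow> 'a" where "bij \<pi>" "\<And>x. x \<in> W \<Longrightarrow> \<pi> x = a x"
proof -
  obtain b where b: "bij_betw b (- W) (- (a ` W))"
    using large_eqpoll[OF assms(2,3)] unfolding eqpoll_def by blast
  define \<pi> where "\<pi> x = (if x \<in> W then a x else b x)" for x
  have "bij_betw \<pi> W (a ` W)"
    using assms(1) by (simp add: bij_betw_def inj_on_def \<pi>_def)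
  moreover have "bij_betw \<pi> (- W) (- (a ` W))"
    using b by (rule bij_betw_cong[THEN iffD1, rotated]) (simp add: \<pi>_def)
  ultimately have "bij_betw \<pi> (W \<union> - W) (a ` W \<union> - (a ` W))"
    by (rule bij_betw_combine) simp
  then show thesis using that[of \<pi>] by (simp add: \<pi>_def)
qed

lemma bij_image_eq:
  assumes "A \<approx> B" "- A \<approx> - B"
  obtains \<sigma> :: "'a \<Rightarrow> 'a" where "bij \<sigma>" "\<sigma> ` A = B"
proof -
  obtain a b where a: "bij_betw a A B" and b: "bij_betw b (- A) (- B)"
    using assms unfolding eqpoll_def by blast
  define \<sigma> where "\<sigma> x = (if x \<in> A then a x else b x)" for x
  have A: "bij_betw \<sigma> A B"
    using a by (rule bij_betw_cong[THEN iffD1, rotated]) (simp add: \<sigma>_def)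
  moreover have "bij_betw \<sigma> (- A) (- B)"
    using b by (rule bij_betw_cong[THEN iffD1, rotated]) (simp add: \<sigma>_def)
  ultimately have "bij_betw \<sigma> (A \<union> - A) (B \<union> - B)"
    by (rule bij_betw_combine) simp
  then show thesis using that[of \<sigma>] bij_betw_imp_surj_on[OF A] by simp
qed

lemma injective_or_constant:
  fixes m :: "'a \<Rightarrow> 'a"
  assumes "large Z"
  shows "\<exists>Z' \<subseteq> Z. large Z' \<and> (inj_on m Z' \<or> (\<exists>c. \<forall>z\<in>Z'. m z = c))"
proof (cases "\<exists>c. large {z \<in> Z. m z = c}")
  case True
  then obtain c where c: "large {z \<in> Z. m z = c}" ..
  show ?thesis by (rule exI[of _ "{z \<in> Z. m z = c}"]) (use c in auto)
next
  case False
  then have sm: "small (\<Union>p\<in>P. {z \<in> Z. m z = m p})" if "small P" for P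
    by (intro small_UN that) simp
  obtain S where S: "S \<subseteq> Z" "large S" "\<And>s. s \<in> S \<Longrightarrow> s \<notin> (\<Union>p\<in>{p \<in> S. p \<sqsubset> s}. {z \<in> Z. m z = m p})"
    using thin[OF assms, of "\<lambda>P. \<Union>p\<in>P. {z \<in> Z. m z = m p}", OF sm] by blast
  have "m x \<noteq> m y" if "x \<in> S" "y \<in> S" "x \<sqsubset> y" for x y
    using S(3)[OF that(2)] S(1) that by auto
  then have "inj_on m S" by (metis inj_onI wo.neq_iff)
  then show ?thesis using S(1,2) by blast
qed

lemma injective_or_constant_list:
  fixes ms :: "('a \<Rightarrow> 'a) list"
  assumes "large Z"
  shows "\<exists>Z' \<subseteq> Z. large Z' \<and> (\<forall>m\<in>set ms. inj_on m Z' \<or> (\<exists>c. \<forall>z\<in>Z'. m z = c))"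
proof (induction ms)
  case Nil
  then show ?case using assms by auto
next
  case (Cons m ms)
  then obtain Y where Y: "Y \<subseteq> Z" "large Y" "\<And>m. m \<in> set ms \<Longrightarrow> inj_on m Y \<or> (\<exists>c. \<forall>z\<in>Y. m z = c)"
    by blast
  obtain Z' where Z': "Z' \<subseteq> Y" "large Z'" "inj_on m Z' \<or> (\<exists>c. \<forall>z\<in>Z'. m z = c)"
    using injective_or_constant[OF Y(2)] by blast
  have "inj_on m' Z' \<or> (\<exists>c. \<forall>z\<in>Z'. m' z = c)" if "m' \<in> set ms" for m'
    using Y(3)[OF that] inj_on_subset[OF _ Z'(1)] Z'(1) by (meson subsetD)
  then show ?case using Z' Y(1) by (intro exI[of _ Z']) auto
qed

text \<open>If \<open>U\<close> is small, every subset of it has a large complement; otherwise a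
  copy of \<open>V\<close> inside one half of \<open>U\<close> leaves the other half free.\<close>

lemma embed_with_large_complement:
  assumes "V \<lesssim> (U :: 'a set)"
  obtains V' where "V' \<subseteq> U" "V' \<approx> (V :: 'a set)" "large (- V')"
proof (cases "small U")
  case True
  obtain j where j: "inj_on j V" "j ` V \<subseteq> U" using assms unfolding lepoll_def by blast
  have "small (j ` V)" using True j(2) small_mono by blast
  then show thesis using that[OF j(2)] inj_on_image_eqpoll_self[OF j(1)] large_Compl by blast
next
  case False
  then obtain B where B: "B \<subseteq> U" "large B" "large (U - B)" by (rule large_split)
  obtain j where j: "inj_on j V" "j ` V \<subseteq> B"
    using large_lepoll[OF B(2), of V] unfolding lepoll_def by blast
  have "large (- (j ` V))" by (rule large_mono[OF _ B(3)]) (use j(2) in blast)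
  then show thesis using that[of "j ` V"] inj_on_image_eqpoll_self[OF j(1)] j(2) B(1) by blast
qed

text \<open>A source of functions with large fibres, since any function of \<open>p x\<close> and
  \<open>q x\<close> alone has them. The label \<open>q x\<close> lets several prescriptions be
  carried out side by side.\<close>

lemma large_fibres_cover:
  obtains p :: "'a \<Rightarrow> 'a" and q :: "'a \<Rightarrow> nat" where "\<And>z j. large {x. p x = z \<and> q x = j}"
proof -
  obtain e :: "'a \<Rightarrow> 'a \<times> 'a" where e: "bij e" by (rule prod_bij)
  obtain i :: "nat \<Rightarrow> 'a" where i: "inj i"
    using infinite_UNIV infinite_countable_subset by blast
  define p where "p x = fst (e x)" for x
  define q where "q x = inv i (fst (e (snd (e x))))" for x
  have [simp]: "e (inv e z) = z" for z using e by (simp add: bij_is_surj surj_f_inv_f)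
  have "large {x. p x = z \<and> q x = j}" for z j
  proof (rule large_mono)
    let ?h = "\<lambda>w. inv e (z, inv e (i j, w))"
    show "range ?h \<subseteq> {x. p x = z \<and> q x = j}" unfolding p_def q_def using i by auto
    have "inj (inv e)" by (rule bij_is_inj[OF bij_imp_bij_inv[OF e]])
    then have "inj ?h" by (intro injI) (simp add: inj_eq)
    then show "large (range ?h)" using small_inj_image[of ?h UNIV] by simp
  qed
  then show thesis by (rule that)
qed

lemma extend_to_large_fibred:
  fixes h :: "'a \<Rightarrow> 'a"
  assumes "large (- S)"
  obtains h' where "h' \<in> large_fibred" "\<forall>x\<in>S. h' x = h x"
proof -
  obtain b :: "'a \<Rightarrow> 'a" where b: "bij_betw b UNIV (- S)" by (rule large_bij[OF assms])
  obtain p :: "'a \<Rightarrow> 'a" and q :: "'a \<Rightarrow> nat" where pq: "\<And>z j. large {x. p x = z \<and> q x = j}"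
    by (rule large_fibres_cover) blast
  define h' where "h' x = (if x \<in> S then h x else p (inv b x))" for x
  have binj: "inj b" using b bij_betw_imp_inj_on by blast
  have bS: "b x \<notin> S" for x using bij_betwE[OF b] by auto
  have l: "large (h' -` {z})" for z
  proof (rule large_mono)
    show "b ` {x. p x = z \<and> q x = 0} \<subseteq> h' -` {z}"
      unfolding h'_def using bS binj by auto
    show "large (b ` {x. p x = z \<and> q x = 0})"
      using pq small_inj_image[OF inj_on_subset[OF binj subset_UNIV]] by blast
  qed
  show thesis
  proof (rule that[of h'])
    show "h' \<in> large_fibred" by (rule large_fibredI[OF l])
  qed (simp add: h'_def)
qed

text \<open>Points labelled 0 reproduce the tuples of values of \<open>ms\<close>, so no value of
  \<open>subst f ms\<close> is lost. Points labelled \<open>Suc j\<close> insert an absent value of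
  \<open>R j\<close> into position \<open>j\<close> of one fixed tuple, so the new values of
  \<open>f\<close> are indexed by the gaps \<open>R j - range (ms ! j)\<close>. All entries depend
  only on \<open>p x\<close> and \<open>q x\<close>, whence the large fibres.\<close>

lemma fill_ranges:
  fixes ms :: "('a \<Rightarrow> 'a) list"
  assumes "\<And>j. j < length ms \<Longrightarrow> range (ms ! j) \<subseteq> R j"
  obtains ns E where "length ns = length ms"
    "\<forall>j<length ms. ns ! j \<in> large_fibred" "\<forall>j<length ms. range (ns ! j) = R j"
    "\<forall>f. subst f ns \<in> large_fibred" "\<forall>f. range (subst f ms) \<subseteq> range (subst f ns)"
    "\<forall>f. range (subst f ns) \<subseteq> range (subst f ms) \<union> (\<Union>j<length ms. E f j ` (R j - range (ms ! j)))"
proof -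
  let ?n = "length ms"
  obtain p :: "'a \<Rightarrow> 'a" and q :: "'a \<Rightarrow> nat" where pq: "\<And>z j. large {x. p x = z \<and> q x = j}"
    by (rule large_fibres_cover) blast
  have hit: "\<exists>x. p x = z \<and> q x = j" for z j using large_nonempty[OF pq[of z j]] by auto
  define extra where "extra j z = (map (\<lambda>m. m undefined) ms)[j := z]" for j z
  define \<tau> where "\<tau> k z = (case k of 0 \<Rightarrow> map (\<lambda>m. m z) ms
    | Suc j \<Rightarrow> if j < ?n \<and> z \<in> R j - range (ms ! j) then extra j z else map (\<lambda>m. m z) ms)" for k z
  define ns where "ns = map (\<lambda>k x. \<tau> (q x) (p x) ! k) [0..<?n]"
  have len: "length (\<tau> k z) = ?n" for k z unfolding \<tau>_def extra_def by (auto split: nat.split)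
  have nth: "\<tau> k z ! j \<in> R j" if "j < ?n" for k z j
    using assms[OF that] that unfolding \<tau>_def extra_def by (auto split: nat.split simp: nth_list_update)
  have sub: "subst f ns x = f (\<tau> (q x) (p x))" for f x
    unfolding subst_def ns_def using len[of "q x" "p x"]
    by (auto intro!: arg_cong[where f = f] nth_equalityI)
  have LF: "(\<lambda>x. h (q x) (p x)) \<in> large_fibred" for h :: "nat \<Rightarrow> 'a \<Rightarrow> 'a"
  proof (rule large_fibredI)
    fix x show "large ((\<lambda>x. h (q x) (p x)) -` {h (q x) (p x)})"
      by (rule large_mono[OF _ pq[of "p x" "q x"]]) auto
  qed
  show thesis
  proof (rule that[of ns "\<lambda>f j z. f (extra j z)"])
    show "length ns = ?n" unfolding ns_def by simp
    show "\<forall>f. subst f ns \<in> large_fibred"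
    proof
      fix f show "subst f ns \<in> large_fibred" using LF[of "\<lambda>k z. f (\<tau> k z)"] unfolding sub[abs_def] .
    qed
    show "\<forall>f. range (subst f ms) \<subseteq> range (subst f ns)"
    proof (intro allI subsetI)
      fix f y assume "y \<in> range (subst f ms)"
      then obtain z where z: "y = subst f ms z" by blast
      obtain x where "p x = z" "q x = 0" using hit by blast
      then have "subst f ns x = y" unfolding sub z by (simp add: \<tau>_def subst_def)
      then show "y \<in> range (subst f ns)" by blast
    qed
    show "\<forall>f. range (subst f ns) \<subseteq> range (subst f ms) \<union> (\<Union>j<?n. (\<lambda>z. f (extra j z)) ` (R j - range (ms ! j)))"
    proof (intro allI subsetI)
      fix f y assume "y \<in> range (subst f ns)"
      then obtain x where y: "y = f (\<tau> (q x) (p x))" unfolding sub by blast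
      show "y \<in> range (subst f ms) \<union> (\<Union>j<?n. (\<lambda>z. f (extra j z)) ` (R j - range (ms ! j)))"
        unfolding y \<tau>_def by (cases "q x") (auto simp: subst_def)
    qed
    have nsj: "ns ! j = (\<lambda>x. \<tau> (q x) (p x) ! j)" if "j < ?n" for j unfolding ns_def using that by simp
    show "\<forall>j<?n. ns ! j \<in> large_fibred"
      using nsj LF[of "\<lambda>k z. \<tau> k z ! j" for j] by simp
    show "\<forall>j<?n. range (ns ! j) = R j"
    proof (intro allI impI equalityI subsetI)
      fix j y assume j: "j < ?n"
      { assume "y \<in> range (ns ! j)" then show "y \<in> R j" unfolding nsj[OF j] using nth[OF j] by blast }
      assume y: "y \<in> R j"
      have "\<exists>k z. \<tau> k z ! j = y"
      proof (cases "y \<in> range (ms ! j)")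
        case True
        then obtain z where "y = (ms ! j) z" by blast
        then have "\<tau> 0 z ! j = y" using j by (simp add: \<tau>_def)
        then show ?thesis by blast
      next
        case False
        then have "\<tau> (Suc j) y ! j = y" using j y by (simp add: \<tau>_def extra_def)
        then show ?thesis by blast
      qed
      then obtain k z where kz: "\<tau> k z ! j = y" by blast
      obtain x where "p x = z" "q x = k" using hit by blast
      then show "y \<in> range (ns ! j)" unfolding nsj[OF j] using kz by blast
    qed
  qed
qed

end

section \<open>Unary operations obtained from violated sets of functions\<close>

locale clone_above_permutations = ramsey_cardinal X for X :: "'a itself" +
  fixes C :: "'a operation set"
  assumes C: "clone C" and perms: "permutation_ops \<subseteq> C"
begin

lemma bij_unaries: "bij \<pi> \<Longrightarrow> \<pi> \<in> unaries C"
  using perms unfolding permutation_ops_def unaries_def by auto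

lemma unaries_agree:
  assumes f: "(n, f) \<in> C" "length ms = n"
    and ms: "\<And>m. m \<in> set ms \<Longrightarrow> \<exists>p\<in>unaries C. \<forall>x\<in>W. p x = m x"
  obtains F where "F \<in> unaries C" "\<And>x. x \<in> W \<Longrightarrow> F x = subst f ms x"
proof -
  have "\<forall>m\<in>set ms. \<exists>p. p \<in> unaries C \<and> (\<forall>x\<in>W. p x = m x)" using ms by blast
  then obtain \<chi> where \<chi>: "\<And>m. m \<in> set ms \<Longrightarrow> \<chi> m \<in> unaries C"
    "\<And>m x. m \<in> set ms \<Longrightarrow> x \<in> W \<Longrightarrow> \<chi> m x = m x" by metis
  show thesis
  proof (rule that)
    show "subst f (map \<chi> ms) \<in> unaries C"
      by (rule subst_unaries[OF C]) (use f \<chi>(1) member_operation_of[OF C] in auto)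
    show "subst f (map \<chi> ms) x = subst f ms x" if "x \<in> W" for x
      unfolding subst_def using \<chi>(2)[OF _ that] by (simp add: comp_def cong: map_cong)
  qed
qed

text \<open>A large fibre of \<open>subst f ms\<close> contains a large set on which every
  \<open>m\<close> is injective, for constancy there would give \<open>m\<close> a large fibre.
  Giving up half of this set makes room for permutations that agree with the \<open>m\<close> on the
  other half.\<close>

lemma unary_with_large_fibre:
  assumes "\<not> C \<subseteq> Pol small_fibred"
  obtains g c where "g \<in> unaries C" "large (g -` {c})"
proof -
  obtain n f ms where f: "(n, f) \<in> C" "length ms = n" "set ms \<subseteq> small_fibred"
    "subst f ms \<notin> (small_fibred :: ('a \<Rightarrow> 'a) set)"
    by (rule not_subset_PolE[OF clone_subset[OF C] assms])
  then obtain c where c: "large (subst f ms -` {c})" unfolding small_fibred_def by blast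
  obtain Z where Z: "Z \<subseteq> subst f ms -` {c}" "large Z"
    "\<And>m. m \<in> set ms \<Longrightarrow> inj_on m Z \<or> (\<exists>c. \<forall>z\<in>Z. m z = c)"
    using injective_or_constant_list[OF c, of ms] by blast
  have inj: "inj_on m Z" if m: "m \<in> set ms" for m
  proof (rule ccontr)
    assume "\<not> inj_on m Z"
    then obtain d where "\<forall>z\<in>Z. m z = d" using Z(3)[OF m] by blast
    then have "Z \<subseteq> m -` {d}" by blast
    moreover have "small (m -` {d})" using f(3) m unfolding small_fibred_def by blast
    ultimately show False using small_mono Z(2) by blast
  qed
  obtain Z1 where Z1: "Z1 \<subseteq> Z" "large Z1" "large (Z - Z1)" by (rule large_split[OF Z(2)])
  have "\<exists>p\<in>unaries C. \<forall>x\<in>Z1. p x = m x" if m: "m \<in> set ms" for m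
  proof -
    have i1: "inj_on m Z1" using inj[OF m] Z1(1) by (rule inj_on_subset)
    have "large (m ` (Z - Z1))"
      using small_inj_image[OF inj_on_subset[OF inj[OF m]], of "Z - Z1"] Z1(3) by auto
    moreover have "m ` (Z - Z1) \<subseteq> - (m ` Z1)"
      using inj_onD[OF inj[OF m]] Z1(1) by blast
    ultimately have "large (- (m ` Z1))" using large_mono by blast
    moreover have "large (- Z1)" by (rule large_mono[OF _ Z1(3)]) blast
    ultimately obtain \<pi> where "bij \<pi>" "\<And>x. x \<in> Z1 \<Longrightarrow> \<pi> x = m x"
      using extend_to_bij[OF i1] by blast
    then show ?thesis by (intro bexI[of _ \<pi>] ballI bij_unaries)
  qed
  then obtain F where F: "F \<in> unaries C" "\<And>x. x \<in> Z1 \<Longrightarrow> F x = subst f ms x"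
    by (rule unaries_agree[OF f(1,2), of Z1]) blast+
  have "Z1 \<subseteq> F -` {c}" using F(2) Z1(1) Z(1) by auto
  then show thesis using that[OF F(1), of c] Z1(2) large_mono by blast
qed

end

section \<open>Unary operations of a clone above the permutations\<close>

context ramsey_cardinal
begin

text \<open>A constant value on a block has a large fibre, and \<open>m\<close> has few such values;
  by the pigeonhole principle one constant serves a large set of blocks.\<close>

lemma uniform_types:
  fixes ms :: "('a \<Rightarrow> 'a) list"
  assumes Y: "large Y" and Z: "\<And>y. y \<in> Y \<Longrightarrow> large (Z y)"
    and ms: "set ms \<subseteq> mostly_small_fibred"
    and types: "\<And>y m. y \<in> Y \<Longrightarrow> m \<in> set ms \<Longrightarrow> inj_on m (Z y) \<or> (\<exists>d. \<forall>z\<in>Z y. m z = d)"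
  shows "\<exists>Y' \<subseteq> Y. large Y' \<and>
    (\<forall>m\<in>set ms. (\<forall>y\<in>Y'. inj_on m (Z y)) \<or> (\<exists>d. \<forall>y\<in>Y'. \<forall>z\<in>Z y. m z = d))"
  using ms types
proof (induction ms)
  case Nil
  then show ?case using Y by auto
next
  case (Cons m ms)
  then obtain Y1 where Y1: "Y1 \<subseteq> Y" "large Y1"
    "\<And>m. m \<in> set ms \<Longrightarrow> (\<forall>y\<in>Y1. inj_on m (Z y)) \<or> (\<exists>d. \<forall>y\<in>Y1. \<forall>z\<in>Z y. m z = d)"
    by auto
  have "\<exists>Y2 \<subseteq> Y1. large Y2 \<and> ((\<forall>y\<in>Y2. inj_on m (Z y)) \<or> (\<exists>d. \<forall>y\<in>Y2. \<forall>z\<in>Z y. m z = d))"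
  proof (cases "large {y \<in> Y1. inj_on m (Z y)}")
    case True
    then show ?thesis by (intro exI[of _ "{y \<in> Y1. inj_on m (Z y)}"]) auto
  next
    case False
    define Y3 where "Y3 = Y1 - {y \<in> Y1. inj_on m (Z y)}"
    have Y3: "large Y3" unfolding Y3_def using False by (intro large_Diff Y1(2)) simp
    have "\<forall>y\<in>Y3. \<exists>d. \<forall>z\<in>Z y. m z = d"
      using Cons.prems(2)[of _ m] Y1(1) unfolding Y3_def by auto
    then obtain d where d: "\<And>y z. y \<in> Y3 \<Longrightarrow> z \<in> Z y \<Longrightarrow> m z = d y" by metis
    have "d ` Y3 \<subseteq> {c. large (m -` {c})}"
    proof clarify
      fix y assume y: "y \<in> Y3" and sm: "small (m -` {d y})"
      have "Z y \<subseteq> m -` {d y}" using d[OF y] by auto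
      moreover have "large (Z y)" using y Y1(1) Z unfolding Y3_def by blast
      ultimately show False using small_mono sm by blast
    qed
    moreover have "small {c. large (m -` {c})}"
      using Cons.prems(1) unfolding mostly_small_fibred_def by simp
    ultimately have "small (d ` Y3)" by (rule small_mono)
    then obtain c where c: "large {y \<in> Y3. d y = c}" using pigeonhole[OF Y3] by blast
    have "{y \<in> Y3. d y = c} \<subseteq> Y1" unfolding Y3_def by auto
    then show ?thesis using c d by (intro exI[of _ "{y \<in> Y3. d y = c}"]) auto
  qed
  then obtain Y2 where Y2: "Y2 \<subseteq> Y1" "large Y2"
    "(\<forall>y\<in>Y2. inj_on m (Z y)) \<or> (\<exists>d. \<forall>y\<in>Y2. \<forall>z\<in>Z y. m z = d)" by blast
  have "(\<forall>y\<in>Y2. inj_on m' (Z y)) \<or> (\<exists>d. \<forall>y\<in>Y2. \<forall>z\<in>Z y. m' z = d)" if "m' \<in> set ms" for m'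
    using Y1(3)[OF that] Y2(1) by (meson subsetD)
  then show ?case using Y2 Y1(1) by (intro exI[of _ Y2]) auto
qed

lemma singleton_fibre_small:
  fixes m :: "'a \<Rightarrow> 'a"
  assumes "inj_on m A"
  shows "small {z \<in> A. m z = c}"
proof -
  have "z = z'" if "z \<in> A" "m z = c" "z' \<in> A" "m z' = c" for z z'
    using inj_onD[OF assms, of z z'] that by simp
  then have "{z \<in> A. m z = c} = {} \<or> (\<exists>z. {z \<in> A. m z = c} = {z})" by blast
  then show ?thesis
    by (elim disjE exE) (simp_all only: small_empty small_singleton)
qed

text \<open>Points are chosen so that no \<open>m\<close> in \<open>J\<close> repeats a value. One
  half of them forms \<open>W\<close>; the other half keeps the complements of \<open>W\<close> and
  of its images large.\<close>

lemma large_transversal: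
  fixes J :: "('a \<Rightarrow> 'a) set"
  assumes Y: "large Y" and Z: "\<And>y. y \<in> Y \<Longrightarrow> large (Z y)" and J: "finite J"
    and inj: "\<And>m y. m \<in> J \<Longrightarrow> y \<in> Y \<Longrightarrow> inj_on m (Z y)"
  obtains W where "W \<subseteq> (\<Union>y\<in>Y. Z y)" "\<And>y. y \<in> Y \<Longrightarrow> large (W \<inter> Z y)" "large (- W)"
    "\<And>m. m \<in> J \<Longrightarrow> inj_on m W" "\<And>m. m \<in> J \<Longrightarrow> large (- (m ` W))"
proof -
  obtain b :: "'a \<Rightarrow> 'a" where b: "bij_betw b UNIV Y" by (rule large_bij[OF Y])
  obtain e :: "'a \<Rightarrow> 'a \<times> 'a" where e: "bij e" by (rule prod_bij)
  \<comment> \<open>The first entry of the pair coded by \<open>i\<close> names the block to be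
    visited, so every block is visited fully often. The second entry, later tested against
    \<open>U\<close>, halves the points within each block.\<close>
  define v where "v i = b (fst (e i))" for i
  have vY: "v i \<in> Y" for i unfolding v_def using bij_betwE[OF b] by auto
  define Bad where "Bad i P = (\<Union>p\<in>P. {p} \<union> (\<Union>m\<in>J. {z \<in> Z (v i). m z = m p}))" for i P
  have Bad: "small (Bad i P)" if "small P" for i P
    unfolding Bad_def
    by (intro small_UN[OF that] small_Un small_singleton small_finite_UN[OF J] singleton_fibre_small inj vY)
  have "\<exists>w :: 'a \<Rightarrow> 'a. \<forall>i. w i \<in> Z (v i) \<and> w i \<notin> Bad i (w ` seg i)"
    by (rule select[of "\<lambda>i. Z (v i)" Bad]) (use Z vY Bad in auto)
  then obtain w :: "'a \<Rightarrow> 'a" where w: "\<And>i. w i \<in> Z (v i)" "\<And>i. w i \<notin> Bad i (w ` seg i)" by blast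
  have neq: "w i \<noteq> w k \<and> (\<forall>m\<in>J. m (w i) \<noteq> m (w k))" if "k \<sqsubset> i" for i k
  proof -
    have k: "w k \<in> w ` seg i" using that by blast
    show ?thesis using w[of i] k unfolding Bad_def by auto
  qed
  have winj: "inj w" by (rule injI) (metis neq wo.neq_iff)
  have minj: "inj_on m (range w)" if "m \<in> J" for m
  proof (rule inj_onI)
    fix x y assume "x \<in> range w" "y \<in> range w" "m x = m y"
    then obtain i k where ik: "x = w i" "y = w k" "m (w i) = m (w k)" by auto
    then have "i = k" using neq[of i k] neq[of k i] that by (cases i k rule: wo.linorder_cases) auto
    then show "x = y" using ik by simp
  qed
  obtain U where U: "large U" "large (- U)"
    using large_split[OF large_UNIV] unfolding Compl_eq_Diff_UNIV by blast
  have block: "large (w ` {i. fst (e i) = a \<and> snd (e i) \<in> B})" if "large B" for a B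
  proof (rule large_mono)
    let ?h = "\<lambda>u. w (inv e (a, u))"
    show "?h ` B \<subseteq> w ` {i. fst (e i) = a \<and> snd (e i) \<in> B}"
      using bij_is_surj[OF e] by (auto simp: surj_f_inv_f)
    have "inj_on ?h B"
      using winj bij_is_inj[OF bij_imp_bij_inv[OF e]] by (intro inj_onI) (simp add: inj_eq)
    then show "large (?h ` B)" using that small_inj_image by blast
  qed
  define W where "W = w ` {i. snd (e i) \<in> U}"
  define W' where "W' = w ` {i. snd (e i) \<in> - U}"
  have W': "large W'" by (rule large_mono[OF _ block[OF U(2)]]) (auto simp: W'_def)
  have disj: "W \<inter> W' = {}" unfolding W_def W'_def using winj by (auto dest: injD)
  show thesis
  proof (rule that[of W])
    show "W \<subseteq> (\<Union>y\<in>Y. Z y)" using w(1) vY unfolding W_def by auto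
    show "large (W \<inter> Z y)" if "y \<in> Y" for y
    proof -
      have "y \<in> range b" using bij_betw_imp_surj_on[OF b] that by simp
      then obtain a where a: "b a = y" by blast
      have "w ` {i. fst (e i) = a \<and> snd (e i) \<in> U} \<subseteq> W \<inter> Z y"
        using w(1) a unfolding W_def v_def by auto
      then show ?thesis using large_mono block[OF U(1)] by blast
    qed
    show "large (- W)" by (rule large_mono[OF _ W']) (use disj in auto)
    show "inj_on m W" if "m \<in> J" for m
      using minj[OF that] by (rule inj_on_subset) (auto simp: W_def)
    show "large (- (m ` W))" if "m \<in> J" for m
    proof (rule large_mono)
      have sub: "W \<subseteq> range w" "W' \<subseteq> range w" unfolding W_def W'_def by auto
      show "m ` W' \<subseteq> - (m ` W)"
        using inj_on_image_Int[OF minj[OF that] sub] disj by auto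
      show "large (m ` W')"
        using small_inj_image[OF inj_on_subset[OF minj[OF that] sub(2)]] W' by blast
    qed
  qed
qed

end

context clone_above_permutations
begin

text \<open>Permutations on both sides move \<open>W\<close> into the fibre and \<open>c\<close> to
  \<open>d\<close>. Half of the fibre is given up because \<open>W\<close> has to be matched with a
  set whose complement is large as well.\<close>

lemma unary_constant_on:
  assumes g: "g \<in> unaries C" "large (g -` {c})" and W: "large W" "large (- W)"
  shows "\<exists>p\<in>unaries C. \<forall>x\<in>W. p x = d"
proof -
  obtain G where G: "G \<subseteq> g -` {c}" "large G" "large (g -` {c} - G)" by (rule large_split[OF g(2)])
  have G': "large (- G)" by (rule large_mono[OF _ G(3)]) blast
  obtain \<pi> :: "'a \<Rightarrow> 'a" where \<pi>: "bij \<pi>" "\<pi> ` W = G"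
    by (rule bij_image_eq[OF large_eqpoll[OF W(1) G(2)] large_eqpoll[OF W(2) G']])
  have "{c} \<approx> {d}" "- {c} \<approx> - {d}"
    by (rule singleton_eqpoll) (intro large_eqpoll large_Compl small_singleton)
  then obtain \<sigma> :: "'a \<Rightarrow> 'a" where \<sigma>: "bij \<sigma>" "\<sigma> ` {c} = {d}" by (rule bij_image_eq)
  have "\<sigma> \<circ> (g \<circ> \<pi>) \<in> unaries C"
    by (intro unaries_comp[OF C] bij_unaries \<pi>(1) \<sigma>(1) g(1))
  moreover have "(\<sigma> \<circ> (g \<circ> \<pi>)) x = d" if "x \<in> W" for x
    using that \<pi>(2) \<sigma>(2) G(1) by auto
  ultimately show ?thesis by blast
qed

text \<open>The argument of \<open>unary_with_large_fibre\<close> for a large family of fibres at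
  once. An \<open>m\<close> may now be constant on the blocks, and then the operation
  \<open>g\<close> with its large fibre imitates it.\<close>

lemma unary_with_many_large_fibres:
  assumes "\<not> C \<subseteq> Pol small_fibred" and A: "\<not> C \<subseteq> Pol mostly_small_fibred"
  obtains h where "h \<in> unaries C" "large {y. large (h -` {y})}"
proof -
  obtain g c where g: "g \<in> unaries C" "large (g -` {c})"
    by (rule unary_with_large_fibre[OF assms(1)])
  obtain n f ms where f: "(n, f) \<in> C" "length ms = n" "set ms \<subseteq> mostly_small_fibred"
    "subst f ms \<notin> (mostly_small_fibred :: ('a \<Rightarrow> 'a) set)"
    by (rule not_subset_PolE[OF clone_subset[OF C] A])
  define F where "F = subst f ms"
  define Y where "Y = {y. large (F -` {y})}"
  have Y: "large Y" using f(4) unfolding Y_def F_def mostly_small_fibred_def by simp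
  have "\<forall>y\<in>Y. \<exists>Z \<subseteq> F -` {y}. large Z \<and> (\<forall>m\<in>set ms. inj_on m Z \<or> (\<exists>c. \<forall>z\<in>Z. m z = c))"
    using injective_or_constant_list unfolding Y_def by blast
  then obtain Z where Z: "\<And>y. y \<in> Y \<Longrightarrow> Z y \<subseteq> F -` {y}" "\<And>y. y \<in> Y \<Longrightarrow> large (Z y)"
    "\<And>y m. y \<in> Y \<Longrightarrow> m \<in> set ms \<Longrightarrow> inj_on m (Z y) \<or> (\<exists>c. \<forall>z\<in>Z y. m z = c)" by metis
  have "\<exists>Y' \<subseteq> Y. large Y' \<and>
    (\<forall>m\<in>set ms. (\<forall>y\<in>Y'. inj_on m (Z y)) \<or> (\<exists>d. \<forall>y\<in>Y'. \<forall>z\<in>Z y. m z = d))"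
    by (rule uniform_types[of Y Z, OF Y Z(2) f(3) Z(3)])
  then obtain Y' where Y': "Y' \<subseteq> Y" "large Y'"
    "\<forall>m\<in>set ms. (\<forall>y\<in>Y'. inj_on m (Z y)) \<or> (\<exists>d. \<forall>y\<in>Y'. \<forall>z\<in>Z y. m z = d)"
    by (elim exE conjE)
  define J where "J = {m \<in> set ms. \<forall>y\<in>Y'. inj_on m (Z y)}"
  obtain W where W: "W \<subseteq> (\<Union>y\<in>Y'. Z y)" "\<And>y. y \<in> Y' \<Longrightarrow> large (W \<inter> Z y)" "large (- W)"
    "\<And>m. m \<in> J \<Longrightarrow> inj_on m W" "\<And>m. m \<in> J \<Longrightarrow> large (- (m ` W))"
  proof (rule large_transversal[OF Y'(2), of Z J])
    show "large (Z y)" if "y \<in> Y'" for y using Z(2) Y'(1) that by blast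
  qed (auto simp: J_def)
  have lW: "large W"
  proof -
    obtain y where "y \<in> Y'" using large_nonempty[OF Y'(2)] by blast
    then show ?thesis using large_mono[OF _ W(2)] by blast
  qed
  have "\<exists>p\<in>unaries C. \<forall>x\<in>W. p x = m x" if m: "m \<in> set ms" for m
  proof (cases "m \<in> J")
    case True
    obtain \<pi> where "bij \<pi>" "\<And>x. x \<in> W \<Longrightarrow> \<pi> x = m x"
      using extend_to_bij[OF W(4)[OF True] W(3) W(5)[OF True]] by blast
    then show ?thesis by (intro bexI[of _ \<pi>] ballI bij_unaries)
  next
    case False
    then obtain d where "\<forall>y\<in>Y'. \<forall>z\<in>Z y. m z = d" using bspec[OF Y'(3) m] m unfolding J_def by blast
    then have "\<And>x. x \<in> W \<Longrightarrow> m x = d" using W(1) by blast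
    then show ?thesis using unary_constant_on[OF g lW W(3), of d] by auto
  qed
  then obtain h where h: "h \<in> unaries C" "\<And>x. x \<in> W \<Longrightarrow> h x = F x"
    unfolding F_def by (rule unaries_agree[OF f(1,2), of W]) blast+
  have "Y' \<subseteq> {y. large (h -` {y})}"
  proof clarify
    fix y assume y: "y \<in> Y'" and sm: "small (h -` {y})"
    have "W \<inter> Z y \<subseteq> h -` {y}" using h(2) Z(1) y Y'(1) by auto
    then show False using W(2)[OF y] sm small_mono by blast
  qed
  then show thesis using that[OF h(1)] large_mono Y'(2) by blast
qed

text \<open>In \<open>s = h \<circ> (\<pi> \<circ> h)\<close> the permutation sends half of the
  values with large fibre onto representatives of all of \<open>range h\<close>. Every point of
  \<open>range h\<close> is then attained on a whole large fibre of \<open>h\<close>.\<close>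

lemma unary_large_fibred:
  assumes h: "h \<in> unaries C" and Q: "large {y. large (h -` {y})}"
  obtains s where "s \<in> unaries C" "s \<in> large_fibred" "large (range s)"
proof -
  obtain Q1 where Q1: "Q1 \<subseteq> {y. large (h -` {y})}" "large Q1" "large ({y. large (h -` {y})} - Q1)"
    by (rule large_split[OF Q])
  have "{y. large (h -` {y})} \<subseteq> range h" using large_nonempty by blast
  then have lr: "large (range h)" using Q large_mono by blast
  obtain b where b: "bij_betw b Q1 (range h)"
    using large_eqpoll[OF Q1(2) lr] unfolding eqpoll_def by blast
  have brange: "b y \<in> range h" if "y \<in> Q1" for y using bij_betwE[OF b] that by blast
  have inv: "h (inv h (b y)) = b y" if "y \<in> Q1" for y by (rule f_inv_into_f[OF brange[OF that]])
  have inj: "inj_on (\<lambda>y. inv h (b y)) Q1"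
    by (rule inj_onI) (metis inv b bij_betw_imp_inj_on inj_onD)
  obtain y0 where y0: "y0 \<in> Q1" using large_nonempty[OF Q1(2)] by blast
  \<comment> \<open>The representatives meet the large fibre over \<open>y0\<close> in at most one
    point; the rest of it is the room needed for extending to a permutation.\<close>
  have "large (- ((\<lambda>y. inv h (b y)) ` Q1))"
  proof (rule large_mono)
    show "h -` {y0} - {inv h y0} \<subseteq> - ((\<lambda>y. inv h (b y)) ` Q1)" using inv by auto
    show "large (h -` {y0} - {inv h y0})" using y0 Q1(1) by (intro large_Diff small_singleton) auto
  qed
  moreover have "large (- Q1)" by (rule large_mono[OF _ Q1(3)]) blast
  ultimately obtain \<pi> where \<pi>: "bij \<pi>" "\<And>y. y \<in> Q1 \<Longrightarrow> \<pi> y = inv h (b y)"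
    using extend_to_bij[OF inj] by blast
  define s where "s = h \<circ> (\<pi> \<circ> h)"
  have hs: "s x = b y" if "h x = y" "y \<in> Q1" for x y
    unfolding s_def using that \<pi>(2) inv by simp
  show thesis
  proof (rule that[of s])
    show "s \<in> unaries C" unfolding s_def by (intro unaries_comp[OF C] h bij_unaries \<pi>(1))
    have bs: "b ` Q1 = range h" by (rule bij_betw_imp_surj_on[OF b])
    have fib: "\<exists>y\<in>Q1. h -` {y} \<subseteq> s -` {z} \<and> large (h -` {y})" if "z \<in> range h" for z
    proof -
      have "z \<in> b ` Q1" using that bs by simp
      then obtain y where y: "y \<in> Q1" "b y = z" by blast
      have "h -` {y} \<subseteq> s -` {z}" using hs[OF _ y(1)] y(2) by auto
      then show ?thesis using y(1) Q1(1) by blast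
    qed
    have "large (s -` {s x})" for x
    proof -
      have "s x \<in> range h" unfolding s_def by simp
      then obtain y where "h -` {y} \<subseteq> s -` {s x}" "large (h -` {y})" using fib by blast
      then show ?thesis by (rule large_mono)
    qed
    then show "s \<in> large_fibred" by (rule large_fibredI)
    have "range h \<subseteq> range s"
    proof
      fix z assume "z \<in> range h"
      then obtain y where "h -` {y} \<subseteq> s -` {z}" "large (h -` {y})" using fib by blast
      then have "large (s -` {z})" by (rule large_mono)
      from large_nonempty[OF this] show "z \<in> range s" by auto
    qed
    then show "large (range s)" using lr large_mono by blast
  qed
qed

text \<open>\<open>\<sigma>\<close> matches the ranges. Corresponding fibres are all of full size,
  so bijections between them glue to a permutation \<open>\<pi>\<close> with
  \<open>t = \<sigma> \<circ> (s \<circ> \<pi>)\<close>.\<close>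

lemma large_fibred_unaries:
  assumes s: "s \<in> unaries C" "s \<in> large_fibred" and t: "t \<in> large_fibred"
    and rng: "range s \<approx> range t" "- range s \<approx> - range t"
  shows "t \<in> unaries C"
proof -
  obtain \<sigma> :: "'a \<Rightarrow> 'a" where \<sigma>: "bij \<sigma>" "\<sigma> ` range s = range t" by (rule bij_image_eq[OF rng])
  have "\<exists>\<beta>. bij_betw \<beta> (t -` {\<sigma> y}) (s -` {y})" if y: "y \<in> range s" for y
  proof -
    obtain x x' where "y = s x" "\<sigma> y = t x'" using y \<sigma>(2) by (metis imageE imageI)
    then have "t -` {\<sigma> y} \<approx> s -` {y}"
      using large_fibredD[OF s(2), of x] large_fibredD[OF t, of x'] by (intro large_eqpoll) auto
    then show ?thesis unfolding eqpoll_def .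
  qed
  then obtain \<beta> where \<beta>: "\<And>y. y \<in> range s \<Longrightarrow> bij_betw (\<beta> y) (t -` {\<sigma> y}) (s -` {y})" by metis
  define \<pi> where "\<pi> x = \<beta> (inv \<sigma> (t x)) x" for x
  have inv: "inv \<sigma> (\<sigma> y) = y" "\<sigma> (inv \<sigma> y) = y" for y
    using \<sigma>(1) by (simp_all add: bij_is_inj bij_is_surj surj_f_inv_f)
  have mem: "inv \<sigma> (t x) \<in> range s" for x
  proof -
    have "t x \<in> \<sigma> ` range s" using \<sigma>(2) by simp
    then show ?thesis using inv(1) by auto
  qed
  have s\<pi>: "s (\<pi> x) = inv \<sigma> (t x)" for x
    using bij_betwE[OF \<beta>[OF mem[of x]]] unfolding \<pi>_def by (auto simp: inv)
  have "bij \<pi>"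
  proof (rule bijI)
    show "inj \<pi>"
    proof (rule injI)
      fix x x' assume eq: "\<pi> x = \<pi> x'"
      then have "inv \<sigma> (t x) = inv \<sigma> (t x')" using s\<pi>[of x] s\<pi>[of x'] by simp
      then have "t x = t x'" by (metis inv(2))
      then show "x = x'"
        using eq inj_onD[OF bij_betw_imp_inj_on[OF \<beta>[OF mem[of x]]], of x x'] unfolding \<pi>_def by (simp add: inv)
    qed
    show "surj \<pi>"
      unfolding surj_def
    proof
      fix z
      have "z \<in> s -` {s z}" by simp
      also have "s -` {s z} = \<beta> (s z) ` (t -` {\<sigma> (s z)})"
        using bij_betw_imp_surj_on[OF \<beta>[of "s z"]] by simp
      finally obtain x where "t x = \<sigma> (s z)" "\<beta> (s z) x = z" by auto
      then have "z = \<pi> x" unfolding \<pi>_def by (simp add: inv)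
      then show "\<exists>x. z = \<pi> x" ..
    qed
  qed
  moreover have "t = \<sigma> \<circ> (s \<circ> \<pi>)" by (rule ext) (simp add: s\<pi> inv)
  ultimately show ?thesis using unaries_comp[OF C] bij_unaries \<sigma>(1) s(1) by metis
qed

end

section \<open>From one function with large fibres to all of them\<close>

context clone_above_permutations
begin

text \<open>Take the omitted set \<open>V\<close> of least cardinality. A violation of
  \<open>missing V\<close> turns functions that omit at least as many values into one that omits
  fewer. \<open>fill_ranges\<close> lets the former omit exactly as many as \<open>s\<close>, which
  puts them into \<open>C\<close> and contradicts minimality.\<close>

lemma surjective_large_fibred:
  assumes H: "\<And>V. V \<noteq> {} \<Longrightarrow> \<not> C \<subseteq> Pol (missing V)"
    and s0: "s0 \<in> unaries C" "s0 \<in> large_fibred" "large (range s0)"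
  obtains s where "s \<in> unaries C" "s \<in> large_fibred" "range s = UNIV"
proof -
  define P where "P V \<longleftrightarrow> (\<exists>s \<in> unaries C. s \<in> large_fibred \<and> large (range s) \<and> V = - range s)" for V
  have "P (- range s0)" unfolding P_def using s0 by blast
  then obtain V where V: "P V" "\<forall>V'. P V' \<longrightarrow> V \<lesssim> V'" by (rule minimal_lepoll)
  obtain s where s: "s \<in> unaries C" "s \<in> large_fibred" "large (range s)" "V = - range s"
    using V(1) unfolding P_def by blast
  have "V = {}"
  proof (rule ccontr)
    assume "V \<noteq> {}"
    obtain n f ms where f: "(n, f) \<in> C" "length ms = n" "set ms \<subseteq> missing V" "subst f ms \<notin> missing V"
      by (rule not_subset_PolE[OF clone_subset[OF C] H[OF \<open>V \<noteq> {}\<close>]])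
    have "\<forall>m\<in>set ms. \<exists>V'. V' \<subseteq> - range m \<and> V' \<approx> V \<and> large (- V')"
    proof
      fix m assume "m \<in> set ms"
      then have "V \<lesssim> - range m" using f(3) unfolding missing_def by blast
      then show "\<exists>V'. V' \<subseteq> - range m \<and> V' \<approx> V \<and> large (- V')"
        by (rule embed_with_large_complement) blast
    qed
    then obtain \<nu> where \<nu>: "\<And>m. m \<in> set ms \<Longrightarrow> \<nu> m \<subseteq> - range m"
      "\<And>m. m \<in> set ms \<Longrightarrow> \<nu> m \<approx> V" "\<And>m. m \<in> set ms \<Longrightarrow> large (- \<nu> m)" by metis
    have "range (ms ! j) \<subseteq> - \<nu> (ms ! j)" if "j < length ms" for j
      using \<nu>(1)[OF nth_mem[OF that]] by blast
    then obtain ns E where ns0: "length ns = length ms"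
      "\<forall>j<length ms. ns ! j \<in> large_fibred"
      "\<forall>j<length ms. range (ns ! j) = - \<nu> (ms ! j)"
      "\<forall>f. subst f ns \<in> large_fibred" "\<forall>f. range (subst f ms) \<subseteq> range (subst f ns)"
      "\<forall>f. range (subst f ns) \<subseteq> range (subst f ms) \<union>
        (\<Union>j<length ms. E f j ` (- \<nu> (ms ! j) - range (ms ! j)))"
      by (rule fill_ranges[of ms "\<lambda>j. - \<nu> (ms ! j)"])
    note ns = ns0[rule_format]
    have "ns ! j \<in> unaries C" if j: "j < length ms" for j
    proof (rule large_fibred_unaries[OF s(1,2) ns(2)[OF j]])
      show "range s \<approx> range (ns ! j)"
        unfolding ns(3)[OF j] by (rule large_eqpoll[OF s(3) \<nu>(3)[OF nth_mem[OF j]]])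
      have "V \<approx> \<nu> (ms ! j)" by (rule eqpoll_sym[OF \<nu>(2)[OF nth_mem[OF j]]])
      then show "- range s \<approx> - range (ns ! j)" unfolding ns(3)[OF j] s(4) by simp
    qed
    then have "set ns \<subseteq> unaries C" using ns(1) by (auto simp: in_set_conv_nth)
    then have F: "subst f ns \<in> unaries C"
      by (intro subst_unaries[OF C, of n]) (use f(1,2) ns(1) member_operation_of[OF C] in auto)
    have nV: "\<not> V \<lesssim> - range (subst f ns)"
    proof
      assume "V \<lesssim> - range (subst f ns)"
      also have "- range (subst f ns) \<lesssim> - range (subst f ms)"
        by (rule subset_imp_lepoll) (use ns(5) in blast)
      finally show False using f(4) unfolding missing_def by blast
    qed
    \<comment> \<open>A large omitted set would contain a copy of \<open>V\<close>; so it is small,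
      and the range is large as \<open>P\<close> demands.\<close>
    have "small (- range (subst f ns))" using large_lepoll[of "- range (subst f ns)" V] nV by blast
    then have "large (- (- range (subst f ns)))" by (rule large_Compl)
    then have "P (- range (subst f ns))" unfolding P_def using F ns(4) by auto
    then show False using V(2) nV by blast
  qed
  then show thesis using that[OF s(1,2)] s(4) by blast
qed

text \<open>In \<open>u = s \<circ> (\<pi> \<circ> t)\<close> a copy of \<open>V\<close> in the
  range of \<open>t\<close> goes to a section of \<open>s\<close> over \<open>V\<close>, and all
  surplus points go into the fibre of \<open>s\<close> over one element of \<open>V\<close>.\<close>

lemma large_fibred_with_range:
  assumes s: "s \<in> unaries C" "s \<in> large_fibred" "range s = UNIV"
    and t: "t \<in> unaries C" "t \<in> large_fibred" "large (- range t)"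
    and V: "V \<noteq> {}" "V \<lesssim> range t"
  obtains u where "u \<in> unaries C" "u \<in> large_fibred" "range u = V"
proof -
  let ?T = "range t"
  obtain v0 where v0: "v0 \<in> V" using V(1) by blast
  obtain j where j: "inj_on j V" "j ` V \<subseteq> ?T" using V(2) unfolding lepoll_def by blast
  define x where "x v = inv s v" for v
  have x: "s (x v) = v" for v unfolding x_def using s(3) by (simp add: surj_f_inv_f)
  \<comment> \<open>\<open>x v0\<close> is reserved for the section, the half \<open>B\<close>
    receives the surplus points, and the other half stays outside the image so that the injection
    extends to a permutation.\<close>
  have "large (s -` {v0} - {x v0})"
    using large_fibredD[OF s(2), of "x v0"] x by (intro large_Diff small_singleton) simp
  then obtain B where B: "B \<subseteq> s -` {v0} - {x v0}" "large B" "large ((s -` {v0} - {x v0}) - B)"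
    by (rule large_split)
  obtain k where k: "inj_on k ?T" "k ` ?T \<subseteq> B"
    using large_lepoll[OF B(2), of ?T] unfolding lepoll_def by blast
  define a where "a y = (if y \<in> j ` V then x (inv_into V j y) else k y)" for y
  have aj: "a (j v) = x v" if "v \<in> V" for v unfolding a_def using j(1) that by simp
  have ak: "a y = k y" if "y \<notin> j ` V" for y unfolding a_def using that by simp
  have kB: "k y \<in> B" if "y \<in> ?T" for y using k(2) that by blast
  have xB: "x v \<notin> B" for v
  proof
    assume "x v \<in> B"
    then have "s (x v) = v0" "x v \<noteq> x v0" using B(1) by auto
    then show False using x by simp
  qed
  have xinj: "x v = x v' \<longleftrightarrow> v = v'" for v v' using x by metis
  have "inj_on a ?T"
  proof (rule inj_onI)
    fix y y' assume y: "y \<in> ?T" "y' \<in> ?T" "a y = a y'"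
    consider "y \<in> j ` V" "y' \<in> j ` V" | "y \<in> j ` V" "y' \<notin> j ` V" | "y \<notin> j ` V" "y' \<in> j ` V"
      | "y \<notin> j ` V" "y' \<notin> j ` V" by blast
    then show "y = y'"
    proof cases
      case 1
      then show ?thesis using y(3) aj xinj by auto
    next
      case 2
      then show ?thesis using y(3) aj ak[OF 2(2)] xB kB[OF y(2)] by (metis imageE)
    next
      case 3
      then show ?thesis using y(3) aj ak[OF 3(1)] xB kB[OF y(1)] by (metis imageE)
    next
      case 4
      then show ?thesis using y ak inj_onD[OF k(1)] by metis
    qed
  qed
  moreover have "large (- (a ` ?T))"
  proof (rule large_mono[OF _ B(3)])
    show "s -` {v0} - {x v0} - B \<subseteq> - (a ` ?T)"
    proof (intro subsetI ComplI)
      fix z assume z0: "z \<in> s -` {v0} - {x v0} - B" and "z \<in> a ` ?T"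
      then obtain y where "z = a (t y)" by blast
      with z0 have z: "s (a (t y)) = v0" "a (t y) \<notin> B" "a (t y) \<noteq> x v0" by auto
      show False
      proof (cases "t y \<in> j ` V")
        case True
        then obtain v where v: "v \<in> V" "t y = j v" by blast
        then have "a (t y) = x v" using aj by simp
        then show False using z x by auto
      next
        case False
        then show False using ak kB z(2) by simp
      qed
    qed
  qed
  ultimately obtain \<pi> where \<pi>: "bij \<pi>" "\<And>y. y \<in> ?T \<Longrightarrow> \<pi> y = a y"
    using extend_to_bij[OF _ t(3)] by blast
  define u where "u = s \<circ> (\<pi> \<circ> t)"
  have u: "u y = s (a (t y))" for y unfolding u_def using \<pi>(2) by simp
  show thesis
  proof (rule that[of u])
    show "u \<in> unaries C" unfolding u_def by (intro unaries_comp[OF C] s(1) bij_unaries \<pi>(1) t(1))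
    show "u \<in> large_fibred" unfolding u_def comp_def by (rule large_fibred_post[OF large_fibred_post[OF t(2)]])
    show "range u = V"
    proof
      show "range u \<subseteq> V"
      proof clarify
        fix y
        show "u y \<in> V"
        proof (cases "t y \<in> j ` V")
          case True
          then obtain v where "v \<in> V" "t y = j v" by blast
          then show ?thesis unfolding u using aj x by simp
        next
          case False
          then have "a (t y) \<in> B" using ak kB by simp
          then show ?thesis unfolding u using B(1) v0 by auto
        qed
      qed
      show "V \<subseteq> range u"
      proof
        fix v assume v: "v \<in> V"
        then obtain y where "j v = t y" using j(2) by blast
        then have "u y = v" unfolding u using aj[OF v] x by simp
        then show "v \<in> range u" by blast
      qed
    qed
  qed
qed

text \<open>Let \<open>W\<close> be a least cardinality not attained by a range with large
  complement. A function in \<open>almost_onto_or_below W\<close> is either nearly onto and may be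
  filled up to \<open>UNIV\<close>, or has a range that minimality already provides. A violation
  thus yields a range of size at least \<open>W\<close>, which
  \<open>large_fibred_with_range\<close> cuts down to \<open>W\<close>.\<close>

lemma large_fibred_subset:
  assumes s: "s \<in> unaries C" "s \<in> large_fibred" "range s = UNIV"
    and F: "\<And>W. W \<noteq> {} \<Longrightarrow> \<not> C \<subseteq> Pol (almost_onto_or_below W)"
  shows "large_fibred \<subseteq> unaries C"
proof -
  define P where "P W \<longleftrightarrow> W \<noteq> {} \<and> large (- W) \<and>
    \<not> (\<exists>t \<in> unaries C. t \<in> large_fibred \<and> range t \<approx> W \<and> large (- range t))" for W
  have nP: "\<not> P W0" for W0
  proof
    assume "P W0"
    then obtain W where W: "P W" "\<forall>W'. P W' \<longrightarrow> W \<lesssim> W'" by (rule minimal_lepoll)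
    have Wne: "W \<noteq> {}" using W(1) unfolding P_def by blast
    obtain n f ms where f: "(n, f) \<in> C" "length ms = n" "set ms \<subseteq> almost_onto_or_below W"
      "subst f ms \<notin> almost_onto_or_below W"
      by (rule not_subset_PolE[OF clone_subset[OF C] F[OF Wne]])
    define R where "R j = (if small (- range (ms ! j)) then UNIV else range (ms ! j))" for j
    have "range (ms ! j) \<subseteq> R j" for j unfolding R_def by simp
    then obtain ns E where ns0: "length ns = length ms"
      "\<forall>j<length ms. ns ! j \<in> large_fibred"
      "\<forall>j<length ms. range (ns ! j) = R j"
      "\<forall>f. subst f ns \<in> large_fibred" "\<forall>f. range (subst f ms) \<subseteq> range (subst f ns)"
      "\<forall>f. range (subst f ns) \<subseteq> range (subst f ms) \<union> (\<Union>j<length ms. E f j ` (R j - range (ms ! j)))"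
      by (rule fill_ranges[of ms R])
    note ns = ns0[rule_format]
    have "ns ! j \<in> unaries C" if j: "j < length ms" for j
    proof (cases "small (- range (ms ! j))")
      case True
      then have "range (ns ! j) = UNIV" using ns(3)[OF j] unfolding R_def by simp
      then show ?thesis using large_fibred_unaries[OF s(1,2) ns(2)[OF j]] s(3) by simp
    next
      case False
      then have r: "range (ns ! j) = range (ms ! j)" using ns(3)[OF j] unfolding R_def by simp
      have "\<not> W \<lesssim> range (ms ! j)"
        using f(3) nth_mem[OF j] False unfolding almost_onto_or_below_def by blast
      then have "\<not> P (range (ms ! j))" using W(2) by blast
      then obtain t where t: "t \<in> unaries C" "t \<in> large_fibred" "range t \<approx> range (ms ! j)" "large (- range t)"
        unfolding P_def using False by blast
      show ?thesis
        by (rule large_fibred_unaries[OF t(1,2) ns(2)[OF j]])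
          (simp_all add: r t(3) large_eqpoll[OF t(4) False])
    qed
    then have "set ns \<subseteq> unaries C" using ns(1) by (auto simp: in_set_conv_nth)
    then have N: "subst f ns \<in> unaries C"
      by (intro subst_unaries[OF C, of n]) (use f(1,2) ns(1) member_operation_of[OF C] in auto)
    have fms: "large (- range (subst f ms))" "W \<lesssim> range (subst f ms)"
      using f(4) unfolding almost_onto_or_below_def by auto
    \<comment> \<open>Only nearly surjective functions were enlarged, so few new values arise and
      the complement of the range stays large.\<close>
    have "small (\<Union>j<length ms. E f j ` (R j - range (ms ! j)))"
    proof (intro small_finite_UN small_image)
      show "small (R j - range (ms ! j))" for j
      proof (cases "small (- range (ms ! j))")
        case True
        then show ?thesis by (rule small_mono[rotated]) blast
      qed (simp add: R_def)
    qed simp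
    then have "large (- range (subst f ms) - (\<Union>j<length ms. E f j ` (R j - range (ms ! j))))"
      by (rule large_Diff[OF fms(1)])
    then have l: "large (- range (subst f ns))"
      by (rule large_mono[rotated]) (use ns(6)[of f] in blast)
    have "W \<lesssim> range (subst f ns)"
      by (rule lepoll_trans[OF fms(2) subset_imp_lepoll[OF ns(5)]])
    then obtain u where u: "u \<in> unaries C" "u \<in> large_fibred" "range u = W"
      by (rule large_fibred_with_range[OF s N ns(4) l Wne]) blast
    then show False using W(1) unfolding P_def by blast
  qed
  show ?thesis
  proof
    fix t :: "'a \<Rightarrow> 'a" assume t: "t \<in> large_fibred"
    obtain W where W: "large W" "large (- W)"
      using large_split[OF large_UNIV] unfolding Compl_eq_Diff_UNIV by blast
    have "W \<noteq> {}" using W(1) by auto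
    then obtain t0 where t0: "t0 \<in> unaries C" "t0 \<in> large_fibred" "range t0 \<approx> W" "large (- range t0)"
      using nP[of W] W(2) unfolding P_def by blast
    have "W \<lesssim> range t0" by (rule eqpoll_imp_lepoll[OF eqpoll_sym[OF t0(3)]])
    then have "large (range t0)" using W(1) small_lepoll by blast
    then have "range t \<lesssim> range t0" by (rule large_lepoll)
    then obtain u where u: "u \<in> unaries C" "u \<in> large_fibred" "range u = range t"
      by (rule large_fibred_with_range[OF s t0(1,2,4), rotated]) auto
    then show "t \<in> unaries C" using large_fibred_unaries[OF u(1,2) t] by simp
  qed
qed

end

lemma Pol_operation_of:
  assumes "operation_of n F \<in> Pol T" "length ts = n" "set ts \<subseteq> T"
  shows "subst F ts \<in> T"
proof -
  have "subst (restrict F (tuples n)) ts \<in> T"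
    using assms unfolding Pol_def operation_of_def by auto
  moreover have "subst (restrict F (tuples n)) ts = subst F ts"
    using assms(2) unfolding subst_def tuples_def by auto
  ultimately show ?thesis by simp
qed

lemma clone_post_unary:
  assumes "clone C" "p \<in> unaries C" "operation_of m F \<in> C"
  shows "operation_of m (\<lambda>xs. p (F xs)) \<in> C"
  using clone_compose[OF assms(1), of 1 "\<lambda>xs. p (xs ! 0)" "[F]" m] assms(2,3)
  by (simp add: unaries_def unary_op_eq subst_def)

section \<open>The clone induced on a large set with large complement\<close>

context clone_above_permutations
begin

text \<open>The operations on the range of \<open>w\<close> induced by \<open>C\<close>, transported to the whole base set;
  \<open>r\<close> is a left inverse of \<open>w\<close>.\<close>

definition coded :: "('a \<Rightarrow> 'a) \<Rightarrow> ('a \<Rightarrow> 'a) \<Rightarrow> 'a operation set" where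
  "coded w r = {operation_of n (\<lambda>xs. r (f (map w xs))) | n f. operation_of n f \<in> C}"

context
  fixes w r :: "'a \<Rightarrow> 'a"
  assumes LF: "large_fibred \<subseteq> unaries C" and r: "r \<in> large_fibred" and rw: "\<And>x. r (w x) = x"
begin

lemma operation_arity: "operation_of n f \<in> C \<Longrightarrow> n \<ge> 1"
  using clone_subset[OF C] operationsD(1) unfolding operation_of_def by blast

lemma codedI:
  assumes "operation_of n f \<in> C" "\<And>xs. length xs = n \<Longrightarrow> F xs = r (f (map w xs))"
  shows "operation_of n F \<in> coded w r"
proof -
  have "operation_of n F = operation_of n (\<lambda>xs. r (f (map w xs)))"
    by (rule operation_of_cong[OF assms(2)])
  then show ?thesis unfolding coded_def using assms(1) by blast
qed

text \<open>Composition inserts \<open>w \<circ> r\<close> between the operations; this map has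
  large fibres because \<open>r\<close> has, and so belongs to \<open>C\<close>.\<close>

lemma clone_coded: "clone (coded w r)"
  unfolding clone_def
proof (intro conjI allI impI)
  show "coded w r \<subseteq> operations"
    unfolding coded_def using operation_arity operation_of_in_operations by blast
next
  fix n i :: nat assume i: "i < n"
  have "operation_of n (\<lambda>xs. xs ! i) \<in> coded w r"
    by (rule codedI[OF clone_projection[OF C i]]) (use i rw in simp)
  then show "projection n i \<in> coded w r" unfolding projection_def operation_of_def .
next
  fix n m F and Gs :: "('a list \<Rightarrow> 'a) list"
  assume F: "(n, F) \<in> coded w r" and Gs: "length Gs = n" "\<forall>G\<in>set Gs. (m, G) \<in> coded w r"
  obtain f where f: "operation_of n f \<in> C" "F = restrict (\<lambda>xs. r (f (map w xs))) (tuples n)"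
    using F unfolding coded_def operation_of_def by auto
  have "\<forall>G\<in>set Gs. \<exists>g. operation_of m g \<in> C \<and> G = restrict (\<lambda>xs. r (g (map w xs))) (tuples m)"
    using Gs(2) unfolding coded_def operation_of_def by auto
  then obtain \<gamma> where \<gamma>: "\<And>G. G \<in> set Gs \<Longrightarrow> operation_of m (\<gamma> G) \<in> C"
    "\<And>G. G \<in> set Gs \<Longrightarrow> G = restrict (\<lambda>xs. r (\<gamma> G (map w xs))) (tuples m)" by metis
  have wr: "(\<lambda>x. w (r x)) \<in> unaries C" using large_fibred_post[OF r] LF by blast
  have c: "operation_of m (subst f (map (\<lambda>G xs. w (r (\<gamma> G xs))) Gs)) \<in> C"
    by (rule clone_compose[OF C f(1)]) (use Gs(1) \<gamma>(1) clone_post_unary[OF C wr] in auto)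
  have "operation_of m (\<lambda>xs. F (map (\<lambda>G. G xs) Gs)) \<in> coded w r"
  proof (rule codedI[OF c])
    fix xs :: "'a list" assume xs: "length xs = m"
    have "map (\<lambda>G. G xs) Gs = map (\<lambda>G. r (\<gamma> G (map w xs))) Gs"
    proof (rule map_cong[OF refl])
      fix G assume "G \<in> set Gs"
      show "G xs = r (\<gamma> G (map w xs))"
        by (subst \<gamma>(2)[OF \<open>G \<in> set Gs\<close>]) (simp add: tuples_def xs)
    qed
    then have "map w (map (\<lambda>G. G xs) Gs) = map (\<lambda>G. w (r (\<gamma> G (map w xs)))) Gs" by simp
    then have "subst f (map (\<lambda>G xs. w (r (\<gamma> G xs))) Gs) (map w xs) = f (map w (map (\<lambda>G. G xs) Gs))"
      unfolding subst_def by (simp only: map_map comp_def)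
    then show "F (map (\<lambda>G. G xs) Gs) =
        r (subst f (map (\<lambda>G xs. w (r (\<gamma> G xs))) Gs) (map w xs))"
      using f(2) Gs(1) by (simp add: tuples_def)
  qed
  then show "compose_op m F Gs \<in> coded w r" unfolding compose_op_def operation_of_def .
qed

text \<open>Applying \<open>r\<close> to the arguments inside \<open>C\<close> cancels the
  \<open>w\<close> of the coding, so \<open>v \<circ> f\<close> is obtained on the whole base set,
  not just a copy of it on the range of \<open>w\<close>.\<close>

lemma coded_post:
  assumes "v \<in> large_fibred" "operation_of n f \<in> C"
  shows "operation_of n (\<lambda>xs. v (f xs)) \<in> coded w r"
proof -
  have r': "r \<in> unaries C" and wv: "(\<lambda>x. w (v x)) \<in> unaries C"
    using large_fibred_post[OF assms(1)] r LF by auto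
  have "operation_of n (subst f (map (\<lambda>i xs. r (xs ! i)) [0..<n])) \<in> C"
    by (rule clone_compose[OF C assms(2)])
      (use clone_post_unary[OF C r'] clone_projection[OF C] in auto)
  then have c: "operation_of n (\<lambda>xs. w (v (subst f (map (\<lambda>i xs. r (xs ! i)) [0..<n]) xs))) \<in> C"
    by (rule clone_post_unary[OF C wv])
  show ?thesis
  proof (rule codedI[OF c])
    fix xs :: "'a list" assume "length xs = n"
    then have "map (\<lambda>i. r (map w xs ! i)) [0..<n] = xs" by (auto simp: list_eq_iff_nth_eq rw)
    then show "v (f xs) = r (w (v (subst f (map (\<lambda>i xs. r (xs ! i)) [0..<n]) (map w xs))))"
      by (simp add: rw subst_def comp_def)
  qed
qed

lemma unaries_coded: "unaries (coded w r) = UNIV"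
proof -
  have "u \<in> unaries (coded w r)" for u
  proof -
    have "(\<lambda>x. w (u (r x))) \<in> unaries C"
      using large_fibred_post[OF r, of "\<lambda>x. w (u x)"] LF by blast
    then have "operation_of 1 (\<lambda>xs. w (u (r (xs ! 0)))) \<in> C" by (simp add: unaries_def unary_op_eq)
    then have "operation_of 1 (\<lambda>xs. u (xs ! 0)) \<in> coded w r" by (rule codedI) (simp add: rw)
    then show ?thesis by (simp add: unaries_def unary_op_eq)
  qed
  then show ?thesis by blast
qed

text \<open>The injective map \<open>w\<close> is not known to be in \<open>C\<close>, so an
  argument cannot be coded directly. Its two coordinates under \<open>e\<close> do have large fibres
  and together determine it; hence a binary function is represented by a coded operation of four
  arguments.\<close>

lemma coded_full:
  assumes full: "coded w r = operations"
  shows "C = operations"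
proof (rule binaries_generate[OF C])
  obtain e :: "'a \<Rightarrow> 'a \<times> 'a" where e: "bij e" by (rule prod_bij)
  have [simp]: "inv e (e x) = x" "e (inv e z) = z" for x z
    using e by (simp_all add: bij_is_inj bij_is_surj surj_f_inv_f)
  have lf: "(\<lambda>x. h (fst (e x))) \<in> large_fibred" "(\<lambda>x. h (snd (e x))) \<in> large_fibred" for h :: "'a \<Rightarrow> 'a"
  proof -
    have inj: "inj (inv e)" by (rule bij_is_inj[OF bij_imp_bij_inv[OF e]])
    have "inj (\<lambda>u. inv e (a, u))" "inj (\<lambda>u. inv e (u, a))" for a
      by (intro injI, simp add: inj_eq[OF inj])+
    then have l: "large (range (\<lambda>u. inv e (a, u)))" "large (range (\<lambda>u. inv e (u, a)))" for a
      using small_inj_image[of "\<lambda>u. inv e (a, u)" UNIV] small_inj_image[of "\<lambda>u. inv e (u, a)" UNIV]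
      by simp_all
    have "large ((\<lambda>x. h (fst (e x))) -` {h (fst (e x))})" for x
      by (rule large_mono[OF _ l(1)[of "fst (e x)"]]) auto
    then show "(\<lambda>x. h (fst (e x))) \<in> large_fibred" by (rule large_fibredI)
    have "large ((\<lambda>x. h (snd (e x))) -` {h (snd (e x))})" for x
      by (rule large_mono[OF _ l(2)[of "snd (e x)"]]) auto
    then show "(\<lambda>x. h (snd (e x))) \<in> large_fibred" by (rule large_fibredI)
  qed
  have "\<phi> \<in> binaries C" for \<phi>
  proof -
    define F where "F xs = \<phi> (inv e (xs ! 0, xs ! 1), inv e (xs ! 2, xs ! 3))" for xs
    have "operation_of 4 F \<in> coded w r" unfolding full by (rule operation_of_in_operations) simp
    then obtain f where f: "operation_of 4 f \<in> C"
      "restrict F (tuples 4) = restrict (\<lambda>xs. r (f (map w xs))) (tuples 4)"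
      unfolding coded_def operation_of_def by auto
    have Ff: "F xs = r (f (map w xs))" if "length xs = 4" for xs
      using fun_cong[OF f(2), of xs] that by (simp add: tuples_def)
    let ?ps = "[\<lambda>z. w (fst (e (fst z))), \<lambda>z. w (snd (e (fst z))),
      \<lambda>z. w (fst (e (snd z))), \<lambda>z. w (snd (e (snd z)))]"
    have "(\<lambda>x. w (fst (e x))) \<in> unaries C" "(\<lambda>x. w (snd (e x))) \<in> unaries C"
      using lf[of w] LF by auto
    then have "set ?ps \<subseteq> binaries C"
      using binaries_unary[OF C _ binaries_fst[OF C]] binaries_unary[OF C _ binaries_snd[OF C]] by auto
    then have "subst f ?ps \<in> binaries C" by (intro subst_binaries[OF C f(1)]) simp_all
    then have "(\<lambda>z. r (subst f ?ps z)) \<in> binaries C"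
      using binaries_unary[OF C] r LF by blast
    also have "(\<lambda>z. r (subst f ?ps z)) = \<phi>"
    proof
      fix z
      have "r (subst f ?ps z) = F [fst (e (fst z)), snd (e (fst z)), fst (e (snd z)), snd (e (snd z))]"
        by (subst Ff) (simp_all add: subst_def)
      also have "\<dots> = \<phi> z" by (simp add: F_def numeral_2_eq_2 numeral_3_eq_3)
      finally show "r (subst f ?ps z) = \<phi> z" .
    qed
    finally show ?thesis .
  qed
  then show "binaries C = UNIV" by blast
qed

text \<open>The violation must survive composition with some \<open>v\<close> in
  \<open>large_fibred\<close>, and such a \<open>v\<close> can be the identity on a nonempty set
  only if the complement is large. Halving \<open>S0\<close> ensures this: by injectivity the row of
  a point \<open>a\<close> outside \<open>S\<close> contributes a large set of values not taken on
  \<open>diag S\<close>.\<close>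

lemma coded_not_nowhere_injective:
  assumes "\<not> C \<subseteq> Pol nowhere_injective"
  shows "\<not> coded w r \<subseteq> Pol nowhere_injective"
proof -
  obtain n f ts where f: "(n, f) \<in> C" "length ts = n" "set ts \<subseteq> nowhere_injective"
    "subst f ts \<notin> (nowhere_injective :: ('a \<times> 'a \<Rightarrow> 'a) set)"
    by (rule not_subset_PolE[OF clone_subset[OF C] assms])
  let ?t = "subst f ts"
  obtain S0 where S0: "large S0" "inj_on ?t (diag S0)"
    using f(4) unfolding nowhere_injective_def by blast
  obtain S where S: "S \<subseteq> S0" "large S" "large (S0 - S)" by (rule large_split[OF S0(1)])
  obtain a where a: "a \<in> S0 - S" using large_nonempty[OF S(3)] by blast
  define B where "B = {y \<in> S0 - S. a \<sqsubset> y}"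
  have "B = (S0 - S) - {y. y \<sqsubseteq> a}" unfolding B_def by (auto simp: wo.not_le)
  then have lB: "large B" using large_Diff[OF S(3) small_atMost[of a]] by simp
  have aB: "(a, y) \<in> diag S0" if "y \<in> B" for y using that a unfolding B_def diag_def by auto
  have "inj_on (\<lambda>y. ?t (a, y)) B"
    by (rule inj_onI) (use inj_onD[OF S0(2)] aB in blast)
  then have "large ((\<lambda>y. ?t (a, y)) ` B)" using lB small_inj_image by blast
  moreover have "(\<lambda>y. ?t (a, y)) ` B \<subseteq> - (?t ` diag S)"
  proof clarify
    fix y p q assume y: "y \<in> B" and pq: "(p, q) \<in> diag S" and eq: "?t (a, y) = ?t (p, q)"
    have "(p, q) \<in> diag S0" using pq diag_mono[OF S(1)] by blast
    then have "(a, y) = (p, q)" using inj_onD[OF S0(2) eq aB[OF y]] by blast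
    then show False using pq a unfolding diag_def by auto
  qed
  ultimately have "large (- (?t ` diag S))" using large_mono by blast
  then obtain v where v: "v \<in> large_fibred" "\<forall>x\<in>?t ` diag S. v x = x"
    by (rule extend_to_large_fibred[of "?t ` diag S" "\<lambda>x. x"])
  have c: "operation_of n (\<lambda>xs. v (f xs)) \<in> coded w r"
    using coded_post[OF v(1)] f(1) member_operation_of[OF C] by blast
  have "inj_on (subst (\<lambda>xs. v (f xs)) ts) (diag S)"
  proof (rule inj_onI)
    fix z z' assume z: "z \<in> diag S" "z' \<in> diag S"
      and "subst (\<lambda>xs. v (f xs)) ts z = subst (\<lambda>xs. v (f xs)) ts z'"
    then have "v (?t z) = v (?t z')" unfolding subst_def by simp
    then have "?t z = ?t z'" using v(2) z by simp
    then show "z = z'" using inj_onD[OF S0(2)] z diag_mono[OF S(1)] by blast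
  qed
  then have "subst (\<lambda>xs. v (f xs)) ts \<notin> nowhere_injective"
    using S(2) unfolding nowhere_injective_def by blast
  then show ?thesis using c Pol_operation_of[OF _ f(2,3)] by blast
qed

lemma large_subsets_large_complement:
  assumes "large A" "large B"
  obtains A' B' where "A' \<subseteq> A" "B' \<subseteq> B" "large A'" "large B'" "large (- (A' \<union> B' :: 'a set))"
proof -
  obtain P where P: "P \<subseteq> A" "large P" "large (A - P)" by (rule large_split[OF assms(1)])
  have "B = (B - (A - P)) \<union> (B \<inter> (A - P))" by blast
  then consider "large (B - (A - P))" | "large (B \<inter> (A - P))"
    using large_Un_cases assms(2) by metis
  then show thesis
  proof cases
    case 1
    have "large (- (P \<union> (B - (A - P))))" by (rule large_mono[OF _ P(3)]) blast
    then show thesis using that[of P "B - (A - P)"] P(1,2) 1 by blast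
  next
    case 2
    obtain Q where Q: "Q \<subseteq> B \<inter> (A - P)" "large Q" "large (B \<inter> (A - P) - Q)"
      by (rule large_split[OF 2])
    have "large (- (P \<union> Q))" by (rule large_mono[OF _ Q(3)]) blast
    then show thesis using that[of P Q] P(1,2) Q(1,2) by blast
  qed
qed

text \<open>One row and one column with large ranges witness the violation. It suffices that
  \<open>v\<close> fixes large parts of these two ranges, chosen so that their union has a large
  complement.\<close>

lemma coded_not_almost_unary:
  assumes "\<not> C \<subseteq> Pol almost_unary"
  shows "\<not> coded w r \<subseteq> Pol almost_unary"
proof -
  obtain n f ts where f: "(n, f) \<in> C" "length ts = n" "set ts \<subseteq> almost_unary"
    "subst f ts \<notin> (almost_unary :: ('a \<times> 'a \<Rightarrow> 'a) set)"
    by (rule not_subset_PolE[OF clone_subset[OF C] assms])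
  let ?t = "subst f ts"
  obtain x0 y0 where xy: "large (range (\<lambda>y. ?t (x0, y)))" "large (range (\<lambda>x. ?t (x, y0)))"
    using f(4) unfolding almost_unary_def by blast
  obtain A B where AB: "A \<subseteq> range (\<lambda>y. ?t (x0, y))" "B \<subseteq> range (\<lambda>x. ?t (x, y0))"
    "large A" "large B" "large (- (A \<union> B))"
    by (rule large_subsets_large_complement[OF xy])
  obtain v where v: "v \<in> large_fibred" "\<forall>x\<in>A \<union> B. v x = x"
    by (rule extend_to_large_fibred[OF AB(5), of "\<lambda>x. x"])
  have c: "operation_of n (\<lambda>xs. v (f xs)) \<in> coded w r"
    using coded_post[OF v(1)] f(1) member_operation_of[OF C] by blast
  have sv: "subst (\<lambda>xs. v (f xs)) ts z = v (?t z)" for z unfolding subst_def by simp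
  have "A \<subseteq> range (\<lambda>y. v (?t (x0, y)))"
  proof
    fix a assume "a \<in> A"
    then obtain y where "a = ?t (x0, y)" "v a = a" using AB(1) v(2) by blast
    then have "a = v (?t (x0, y))" by simp
    then show "a \<in> range (\<lambda>y. v (?t (x0, y)))" by (rule range_eqI)
  qed
  then have l1: "large (range (\<lambda>y. v (?t (x0, y))))" using large_mono AB(3) by blast
  have "B \<subseteq> range (\<lambda>x. v (?t (x, y0)))"
  proof
    fix a assume "a \<in> B"
    then obtain x where "a = ?t (x, y0)" "v a = a" using AB(2) v(2) by blast
    then have "a = v (?t (x, y0))" by simp
    then show "a \<in> range (\<lambda>x. v (?t (x, y0)))" by (rule range_eqI)
  qed
  then have l2: "large (range (\<lambda>x. v (?t (x, y0))))" using large_mono AB(4) by blast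
  have "subst (\<lambda>xs. v (f xs)) ts \<notin> almost_unary"
    using l1 l2 unfolding almost_unary_def sv by blast
  then show ?thesis using c Pol_operation_of[OF _ f(2,3)] by blast
qed

end

theorem cover:
  assumes "C \<noteq> operations"
  shows "C \<subseteq> Pol small_fibred \<or> C \<subseteq> Pol mostly_small_fibred \<or>
    C \<subseteq> Pol almost_unary \<or> C \<subseteq> Pol nowhere_injective \<or>
    (\<exists>V. V \<noteq> {} \<and> C \<subseteq> Pol (missing V)) \<or> (\<exists>W. W \<noteq> {} \<and> C \<subseteq> Pol (almost_onto_or_below W))"
proof (rule ccontr)
  assume "\<not> ?thesis"
  then have not: "\<not> C \<subseteq> Pol small_fibred" "\<not> C \<subseteq> Pol mostly_small_fibred"
    "\<not> C \<subseteq> Pol almost_unary" "\<not> C \<subseteq> Pol nowhere_injective"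
    "\<And>V. V \<noteq> {} \<Longrightarrow> \<not> C \<subseteq> Pol (missing V)" "\<And>W. W \<noteq> {} \<Longrightarrow> \<not> C \<subseteq> Pol (almost_onto_or_below W)"
    by auto
  obtain h where h: "h \<in> unaries C" "large {y. large (h -` {y})}"
    by (rule unary_with_many_large_fibres[OF not(1,2)])
  obtain s0 where s0: "s0 \<in> unaries C" "s0 \<in> large_fibred" "large (range s0)"
    by (rule unary_large_fibred[OF h])
  obtain s where s: "s \<in> unaries C" "s \<in> large_fibred" "range s = UNIV"
    by (rule surjective_large_fibred[OF not(5) s0])
  have LF: "large_fibred \<subseteq> unaries C" by (rule large_fibred_subset[OF s not(6)])
  obtain S where S: "large S" "large (- S)"
    using large_split[OF large_UNIV] unfolding Compl_eq_Diff_UNIV by blast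
  obtain w :: "'a \<Rightarrow> 'a" where w: "bij_betw w UNIV S" by (rule large_bij[OF S(1)])
  obtain r where r: "r \<in> large_fibred" "\<forall>x\<in>S. r x = inv w x"
    by (rule extend_to_large_fibred[OF S(2), of "inv w"])
  have rw: "r (w x) = x" for x
    using bspec[OF r(2), of "w x"] bij_betwE[OF w] inv_f_f[OF bij_betw_imp_inj_on[OF w]] by simp
  have "coded w r = operations"
    by (rule clone_above_unaries[OF clone_coded[OF LF r(1) rw] unaries_coded[OF LF r(1) rw]
          coded_not_almost_unary[OF LF r(1) rw not(3)] coded_not_nowhere_injective[OF LF r(1) rw not(4)]])
  then show False using coded_full[OF LF r(1) rw] assms by blast
qed

end

section \<open>Maximal clones above the permutations\<close>

lemma missing_cong:
  assumes "V \<approx> W"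
  shows "missing V = missing W"
  unfolding missing_def using lepoll_trans1[OF assms] lepoll_trans1[OF eqpoll_sym[OF assms]] by blast

lemma almost_onto_or_below_cong:
  assumes "V \<approx> W"
  shows "almost_onto_or_below V = almost_onto_or_below W"
  unfolding almost_onto_or_below_def
  using lepoll_trans1[OF assms] lepoll_trans1[OF eqpoll_sym[OF assms]] by blast

lemma operation_of_PolI:
  fixes T :: "('b \<Rightarrow> 'a) set"
  assumes "n \<ge> 1" "\<And>ts. length ts = n \<Longrightarrow> set ts \<subseteq> T \<Longrightarrow> subst F ts \<in> T"
  shows "operation_of n F \<in> Pol T"
proof -
  have "subst (restrict F (tuples n)) ts = subst F ts" if "length ts = n" for ts :: "('b \<Rightarrow> 'a) list"
    using that unfolding subst_def tuples_def by auto
  then show ?thesis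
    using assms operation_of_in_operations[OF assms(1)] unfolding Pol_def operation_of_def by auto
qed

lemma unary_op_PolI:
  fixes T :: "('b \<Rightarrow> 'a) set"
  assumes "\<And>t. t \<in> T \<Longrightarrow> u \<circ> t \<in> T"
  shows "unary_op u \<in> Pol T"
  unfolding unary_op_eq
proof (rule operation_of_PolI)
  fix ts :: "('b \<Rightarrow> 'a) list" assume "length ts = 1" "set ts \<subseteq> T"
  then obtain t where "ts = [t]" "t \<in> T" by (auto simp: length_Suc_conv)
  then show "subst (\<lambda>xs. u (xs ! 0)) ts \<in> T" using assms[of t] by (simp add: subst_def comp_def)
qed simp

lemma binary_PolI:
  fixes T :: "('b \<Rightarrow> 'a) set"
  assumes "\<And>s t. s \<in> T \<Longrightarrow> t \<in> T \<Longrightarrow> (\<lambda>z. p (s z, t z)) \<in> T"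
  shows "operation_of 2 (\<lambda>xs. p (xs ! 0, xs ! 1)) \<in> Pol T"
proof (rule operation_of_PolI)
  fix ts :: "('b \<Rightarrow> 'a) list" assume "length ts = 2" "set ts \<subseteq> T"
  then obtain s t where "ts = [s, t]" "s \<in> T" "t \<in> T" by (auto simp: length_Suc_conv numeral_2_eq_2)
  then show "subst (\<lambda>xs. p (xs ! 0, xs ! 1)) ts \<in> T" using assms[of s t] by (simp add: subst_def)
qed simp

lemma unary_op_operations: "unary_op u \<in> operations"
  unfolding unary_op_eq by (rule operation_of_in_operations) simp

lemma permutations_Pol_missing: "permutation_ops \<subseteq> Pol (missing V)"
proof -
  have "unary_op \<pi> \<in> Pol (missing V)" if \<pi>: "bij \<pi>" for \<pi> :: "'a \<Rightarrow> 'a"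
  proof (rule unary_op_PolI)
    fix t assume "t \<in> missing V"
    then have "V \<lesssim> - range t" unfolding missing_def by blast
    also have "- range t \<approx> \<pi> ` (- range t)"
      by (rule eqpoll_sym[OF inj_on_image_eqpoll_self[OF inj_on_subset[OF bij_is_inj[OF \<pi>]]]]) simp
    also have "\<pi> ` (- range t) = - range (\<pi> \<circ> t)"
      using bij_image_Compl_eq[OF \<pi>] by (simp add: image_comp)
    finally show "\<pi> \<circ> t \<in> missing V" unfolding missing_def by blast
  qed
  then show ?thesis unfolding permutation_ops_def by blast
qed

lemma infinite_lepoll_Un:
  assumes "infinite V" "V \<lesssim> A \<union> B"
  shows "V \<lesssim> A \<or> V \<lesssim> B"
proof (rule ccontr)
  assume "\<not> ?thesis"
  then have "ordLess2 (card_of A) (card_of V)" "ordLess2 (card_of B) (card_of V)"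
    unfolding lepoll_def card_of_ordLeq
    by (simp_all add: not_ordLeq_iff_ordLess[symmetric] card_of_Well_order)
  then have "ordLess2 (card_of (A \<union> B)) (card_of V)"
    using card_of_Un_ordLess_infinite[OF assms(1)] by blast
  then show False
    using assms(2) unfolding lepoll_def card_of_ordLeq
    by (simp add: not_ordLess_iff_ordLeq[symmetric] card_of_Well_order)
qed

section \<open>Comparison and maximality of the clones preserving \<open>missing V\<close>\<close>

context ramsey_cardinal
begin

lemma Pol_missing_proper:
  assumes "V \<noteq> {}"
  shows "Pol (missing V) \<noteq> (operations :: 'a operation set)"
proof
  assume eq: "Pol (missing V) = operations"
  obtain V' where V': "V' \<subseteq> UNIV" "V' \<approx> V" "large (- V')"
    by (rule embed_with_large_complement[OF subset_imp_lepoll[OF subset_UNIV]])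
  obtain m :: "'a \<Rightarrow> 'a" where m: "bij_betw m UNIV (- V')" by (rule large_bij[OF V'(3)])
  have "m \<in> missing V"
    unfolding missing_def using eqpoll_imp_lepoll[OF eqpoll_sym[OF V'(2)]] bij_betw_imp_surj_on[OF m] by simp
  then have "inv m \<circ> m \<in> missing V"
    using unary_op_operations[of "inv m"] unfolding eq[symmetric] by (rule unary_Pol[rotated])
  then show False using assms inv_o_cancel[OF bij_betw_imp_inj_on[OF m]] unfolding missing_def by simp
qed

lemma Pol_missing_large_codomain:
  assumes "n \<ge> 1" "\<And>xs. F xs \<in> D" "large (- D)"
  shows "operation_of n F \<in> Pol (missing V)"
proof (rule operation_of_PolI[OF assms(1)])
  fix ts :: "('a \<Rightarrow> 'a) list"
  have "V \<lesssim> - D" using assms(3) by (rule large_lepoll)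
  also have "- D \<lesssim> - range (subst F ts)"
    by (rule subset_imp_lepoll) (use assms(2) in \<open>auto simp: subst_def\<close>)
  finally show "subst F ts \<in> missing V" unfolding missing_def by blast
qed

text \<open>It excludes the other unary alternatives of \<open>cover\<close> for clones above some
  \<open>Pol (missing V)\<close>: those sets all contain \<open>id\<close> but not \<open>u\<close>,
  which has large range, large complement of the range and large fibres.\<close>

lemma witness_unary:
  obtains u :: "'a \<Rightarrow> 'a" where "\<forall>V. unary_op u \<in> Pol (missing V)" "unary_op u \<notin> Pol small_fibred"
    "unary_op u \<notin> Pol mostly_small_fibred" "\<forall>W. unary_op u \<notin> Pol (almost_onto_or_below W)"
proof -
  obtain D where D: "large D" "large (- D)"
    using large_split[OF large_UNIV] unfolding Compl_eq_Diff_UNIV by blast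
  obtain b :: "'a \<Rightarrow> 'a" where b: "bij_betw b UNIV D" by (rule large_bij[OF D(1)])
  obtain p :: "'a \<Rightarrow> 'a" and q :: "'a \<Rightarrow> nat" where pq: "\<And>z j. large {x. p x = z \<and> q x = j}"
    by (rule large_fibres_cover) blast
  define u where "u = b \<circ> p"
  have fibre: "large (u -` {b z})" for z
    by (rule large_mono[OF _ pq[of z 0]]) (auto simp: u_def)
  have uD: "u x \<in> D" for x unfolding u_def using bij_betwE[OF b] by simp
  have Db: "D = range b" using bij_betw_imp_surj_on[OF b] by simp
  have sub: "D \<subseteq> {y. large (u -` {y})}" unfolding Db using fibre by blast
  have "D \<subseteq> range u"
  proof
    fix y assume "y \<in> D"
    then have "large (u -` {y})" using sub by blast
    from large_nonempty[OF this] show "y \<in> range u" by auto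
  qed
  then have lr: "large (range u)" using large_mono D(1) by blast
  have lc: "large (- range u)" by (rule large_mono[OF _ D(2)]) (use uD in auto)
  show thesis
  proof (rule that[of u])
    show "\<forall>V. unary_op u \<in> Pol (missing V)"
      unfolding unary_op_eq by (intro allI Pol_missing_large_codomain[OF _ _ D(2)] uD) simp
    have id: "id \<in> (small_fibred :: ('a \<Rightarrow> 'a) set)" "id \<in> (mostly_small_fibred :: ('a \<Rightarrow> 'a) set)"
      "id \<in> (almost_onto_or_below W :: ('a \<Rightarrow> 'a) set)" for W
      unfolding small_fibred_def mostly_small_fibred_def almost_onto_or_below_def by simp_all
    have "u \<notin> small_fibred" using fibre unfolding small_fibred_def by blast
    then show "unary_op u \<notin> Pol small_fibred" using unary_Pol[OF _ id(1)] by auto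
    have "u \<notin> mostly_small_fibred"
      using large_mono[OF sub D(1)] unfolding mostly_small_fibred_def by blast
    then show "unary_op u \<notin> Pol mostly_small_fibred" using unary_Pol[OF _ id(2)] by auto
    have "u \<notin> almost_onto_or_below W" for W
      using lc large_lepoll[OF lr, of W] unfolding almost_onto_or_below_def by blast
    then show "\<forall>W. unary_op u \<notin> Pol (almost_onto_or_below W)" using unary_Pol[OF _ id(3)] by auto
  qed
qed

text \<open>The binary counterpart of \<open>witness_unary\<close>: an injection with large
  complement of the range violates both sets, each of which contains \<open>fst\<close> and
  \<open>snd\<close>.\<close>

lemma witness_binary:
  obtains p :: "'a \<times> 'a \<Rightarrow> 'a" where
    "\<forall>V. operation_of 2 (\<lambda>xs. p (xs ! 0, xs ! 1)) \<in> Pol (missing V)"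
    "operation_of 2 (\<lambda>xs. p (xs ! 0, xs ! 1)) \<notin> Pol almost_unary"
    "operation_of 2 (\<lambda>xs. p (xs ! 0, xs ! 1)) \<notin> Pol nowhere_injective"
proof -
  obtain D where D: "large D" "large (- D)"
    using large_split[OF large_UNIV] unfolding Compl_eq_Diff_UNIV by blast
  obtain b :: "'a \<Rightarrow> 'a" where b: "bij_betw b UNIV D" by (rule large_bij[OF D(1)])
  obtain e :: "'a \<times> 'a \<Rightarrow> 'a" where e: "bij e" by (rule pairing)
  define p where "p z = b (e z)" for z
  have pD: "p z \<in> D" for z unfolding p_def using bij_betwE[OF b] by simp
  have pinj: "p z = p z' \<longleftrightarrow> z = z'" for z z'
    unfolding p_def using bij_is_inj[OF e] bij_betw_imp_inj_on[OF b] by (simp add: inj_eq)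
  show thesis
  proof (rule that[of p])
    show "\<forall>V. operation_of 2 (\<lambda>xs. p (xs ! 0, xs ! 1)) \<in> Pol (missing V)"
      by (intro allI Pol_missing_large_codomain[OF _ _ D(2)] pD) simp
    have "fst \<in> (almost_unary :: ('a \<times> 'a \<Rightarrow> 'a) set)" "snd \<in> (almost_unary :: ('a \<times> 'a \<Rightarrow> 'a) set)"
      unfolding almost_unary_def by simp_all
    moreover have "p \<notin> almost_unary"
    proof -
      have "inj (\<lambda>y. p (x, y))" "inj (\<lambda>y. p (y, x))" for x by (simp_all add: inj_def pinj)
      then have "large (range (\<lambda>y. p (x, y)))" "large (range (\<lambda>y. p (y, x)))" for x
        using small_inj_image[of "\<lambda>y. p (x, y)" UNIV] small_inj_image[of "\<lambda>y. p (y, x)" UNIV] by simp_all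
      then show ?thesis unfolding almost_unary_def by simp
    qed
    ultimately show "operation_of 2 (\<lambda>xs. p (xs ! 0, xs ! 1)) \<notin> Pol almost_unary"
      using binary_Pol[of p almost_unary fst snd] by auto
    have "fst \<in> (nowhere_injective :: ('a \<times> 'a \<Rightarrow> 'a) set)"
      "snd \<in> (nowhere_injective :: ('a \<times> 'a \<Rightarrow> 'a) set)"
    proof -
      have "\<not> inj_on fst (diag S) \<and> \<not> inj_on snd (diag S)" if S: "large S" for S
      proof -
        obtain x where x: "x \<in> S" using large_nonempty[OF S] by blast
        obtain y where y: "y \<in> S" "x \<sqsubset> y" using large_above[OF S] by blast
        obtain z where z: "z \<in> S" "y \<sqsubset> z" using large_above[OF S] by blast
        have xz: "x \<sqsubset> z" by (rule wo.less_trans[OF y(2) z(2)])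
        have "(x, y) \<in> diag S" "(x, z) \<in> diag S" "(y, z) \<in> diag S"
          using x y z xz unfolding diag_def by auto
        then show ?thesis
          using inj_onD[of fst "diag S" "(x, y)" "(x, z)"] inj_onD[of snd "diag S" "(x, z)" "(y, z)"] y z
          by auto
      qed
      then show "fst \<in> (nowhere_injective :: ('a \<times> 'a \<Rightarrow> 'a) set)"
        "snd \<in> (nowhere_injective :: ('a \<times> 'a \<Rightarrow> 'a) set)"
        unfolding nowhere_injective_def by auto
    qed
    moreover have "p \<notin> nowhere_injective"
      unfolding nowhere_injective_def by (auto intro!: exI[of _ UNIV] simp: inj_on_def pinj)
    ultimately show "operation_of 2 (\<lambda>xs. p (xs ! 0, xs ! 1)) \<notin> Pol nowhere_injective"
      using binary_Pol[of p nowhere_injective fst snd] by auto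
  qed
qed

text \<open>The range of \<open>u\<close> avoids a copy \<open>L\<close> of \<open>V\<close>, hence
  so does everything followed by \<open>u\<close>. But \<open>u \<circ> m = k\<close> omits exactly
  \<open>L\<close>, although \<open>m\<close> is in \<open>missing W\<close>.\<close>

lemma Pol_missing_less:
  assumes "\<not> W \<lesssim> (V :: 'a set)"
  shows "\<not> Pol (missing V) \<subseteq> Pol (missing (W :: 'a set))"
proof
  assume sub: "Pol (missing V) \<subseteq> Pol (missing W)"
  obtain L where L: "L \<approx> V" "large (- L)"
    using embed_with_large_complement[OF subset_imp_lepoll[OF subset_UNIV], of V] by blast
  obtain A where A: "A \<approx> W" "large (- A)"
    using embed_with_large_complement[OF subset_imp_lepoll[OF subset_UNIV], of W] by blast
  obtain m :: "'a \<Rightarrow> 'a" where m: "bij_betw m UNIV (- A)" by (rule large_bij[OF A(2)])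
  obtain k :: "'a \<Rightarrow> 'a" where k: "bij_betw k UNIV (- L)" by (rule large_bij[OF L(2)])
  define u where "u x = k (inv m x)" for x
  have um: "u \<circ> m = k" unfolding u_def using inv_f_f[OF bij_betw_imp_inj_on[OF m]] by auto
  have "unary_op u \<in> Pol (missing V)"
  proof (rule unary_op_PolI)
    fix t :: "'a \<Rightarrow> 'a"
    have "V \<lesssim> L" by (rule eqpoll_imp_lepoll[OF eqpoll_sym[OF L(1)]])
    also have "L \<lesssim> - range (u \<circ> t)"
      by (rule subset_imp_lepoll) (use bij_betwE[OF k] in \<open>auto simp: u_def\<close>)
    finally show "u \<circ> t \<in> missing V" unfolding missing_def by blast
  qed
  moreover have "m \<in> missing W"
    unfolding missing_def using eqpoll_imp_lepoll[OF eqpoll_sym[OF A(1)]] bij_betw_imp_surj_on[OF m] by simp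
  ultimately have "k \<in> missing W" using unary_Pol[of u "missing W" m] sub um by auto
  then have "W \<lesssim> L" unfolding missing_def using bij_betw_imp_surj_on[OF k] by simp
  then show False using lepoll_trans2[OF _ L(1)] assms by blast
qed

text \<open>\<open>u\<close> undoes the injection \<open>m\<close> and so turns a member of
  \<open>missing W\<close> into the identity. From an omitted set it loses at most the points in
  \<open>A\<close> and the point \<open>c\<close>, fewer than \<open>V\<close> many, and for
  infinite \<open>V\<close> such a loss leaves a copy of \<open>V\<close>.\<close>

lemma Pol_missing_greater_infinite:
  assumes V: "infinite V" "\<not> V \<lesssim> (W :: 'a set)" and W: "W \<noteq> {}"
  shows "\<not> Pol (missing V) \<subseteq> Pol (missing W)"
proof
  assume sub: "Pol (missing V) \<subseteq> Pol (missing W)"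
  obtain A where A: "A \<approx> W" "large (- A)"
    using embed_with_large_complement[OF subset_imp_lepoll[OF subset_UNIV], of W] by blast
  obtain m :: "'a \<Rightarrow> 'a" where m: "bij_betw m UNIV (- A)" by (rule large_bij[OF A(2)])
  have minj: "inj m" by (rule bij_betw_imp_inj_on[OF m])
  define c where "c = inv m undefined"
  define u where "u x = (if x \<in> A then c else inv m x)" for x
  have mA: "m x \<notin> A" for x using bij_betwE[OF m] by auto
  have um: "u \<circ> m = id" unfolding u_def using inv_f_f[OF minj] mA by auto
  have um': "m (u x) = x" if "x \<notin> A" for x
    unfolding u_def using that bij_betw_imp_surj_on[OF m] by (simp add: f_inv_into_f)
  have nA: "\<not> V \<lesssim> A" using lepoll_trans2[OF _ A(1)] V(2) by blast
  have "unary_op u \<in> Pol (missing V)"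
  proof (rule unary_op_PolI)
    fix t assume "t \<in> missing V"
    then have "V \<lesssim> - range t" unfolding missing_def by blast
    also have "- range t \<lesssim> (- range t - A) \<union> A" by (rule subset_imp_lepoll) blast
    finally have "V \<lesssim> - range t - A" using infinite_lepoll_Un[OF V(1)] nA by blast
    also have "- range t - A \<approx> u ` (- range t - A)"
    proof (rule eqpoll_sym[OF inj_on_image_eqpoll_self])
      show "inj_on u (- range t - A)" by (rule inj_on_inverseI[of _ m]) (use um' in auto)
    qed
    also have "u ` (- range t - A) \<lesssim> (u ` (- range t - A) - {c}) \<union> {c}"
      by (rule subset_imp_lepoll) blast
    finally have "V \<lesssim> u ` (- range t - A) - {c} \<or> V \<lesssim> {c}" by (rule infinite_lepoll_Un[OF V(1)])
    moreover have "\<not> V \<lesssim> {c}"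
      using V(1) inj_on_finite[of _ V "{c}"] unfolding lepoll_def by blast
    moreover have "u ` (- range t - A) - {c} \<subseteq> - range (u \<circ> t)"
    proof
      fix y assume y: "y \<in> u ` (- range t - A) - {c}"
      then obtain x where x: "y = u x" "x \<notin> range t" "x \<notin> A" by auto
      show "y \<in> - range (u \<circ> t)"
      proof
        assume "y \<in> range (u \<circ> t)"
        then obtain z where z: "y = u (t z)" by auto
        have "t z \<notin> A" using y z unfolding u_def by auto
        then have "t z = m (u (t z))" by (rule um'[symmetric])
        also have "\<dots> = m (u x)" using x(1) z by (simp only:)
        also have "\<dots> = x" by (rule um'[OF x(3)])
        finally have "t z = x" .
        then show False using x(2) by blast
      qed
    qed
    ultimately show "u \<circ> t \<in> missing V"
      unfolding missing_def using lepoll_trans[OF _ subset_imp_lepoll] by blast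
  qed
  moreover have "m \<in> missing W"
    unfolding missing_def using eqpoll_imp_lepoll[OF eqpoll_sym[OF A(1)]] bij_betw_imp_surj_on[OF m] by simp
  ultimately have "id \<in> missing W" using unary_Pol[of u "missing W" m] sub um by auto
  then show False using W unfolding missing_def by simp
qed

lemma finite_lepollD:
  assumes "finite V" "V \<lesssim> S"
  obtains S' where "S' \<subseteq> S" "finite S'" "card S' = card V"
  using assms unfolding lepoll_def by (metis card_image finite_imageI)

text \<open>A binary operation whose values are labels \<open>v x\<close> of rows and \<open>w y\<close> of columns. The rows in
  \<open>W\<close> and the column \<open>b\<close> carry no label of their own, so deleting the rows \<open>W\<close> and \<open>card W\<close>
  columns including \<open>b\<close> loses only \<open>card W - 1\<close> labels, while deleting \<open>card V > card W\<close> rows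
  and columns loses at least \<open>card V\<close>.\<close>

lemma Pol_missing_greater_finite:
  assumes V: "finite V" "\<not> V \<lesssim> (W :: 'a set)" and W: "W \<noteq> {}"
  shows "\<not> Pol (missing V) \<subseteq> Pol (missing W)"
proof
  assume sub: "Pol (missing V) \<subseteq> Pol (missing W)"
  have fW: "finite W" using V finite_lepoll_infinite by blast
  have card: "card W < card V" using V fW lepoll_iff_card_le by (metis not_le)
  have cW: "card W > 0" using W fW by (simp add: card_gt_0_iff)
  obtain b where bW: "b \<in> W" using W by blast
  obtain y1 where y1: "y1 \<noteq> b" using infinite_UNIV ex_new_if_finite[of "{b}"] by auto
  obtain P where P: "large P" "large (- P)"
    using large_split[OF large_UNIV] unfolding Compl_eq_Diff_UNIV by blast
  have lW: "large (- W)" by (rule large_Compl[OF small_finite[OF fW]])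
  obtain v where v: "bij_betw v (- W) P" using large_eqpoll[OF lW P(1)] unfolding eqpoll_def by blast
  obtain w where w: "bij_betw w (- {b}) (- P)"
    using large_eqpoll[OF large_Compl[OF small_singleton] P(2)] unfolding eqpoll_def by blast
  define f where "f z = (case z of (x, y) \<Rightarrow>
    if x \<notin> W \<and> (y = b \<or> x \<sqsubset> y) then v x else if y = b then w y1 else w y)" for z
  have vP: "v x \<in> P" if "x \<notin> W" for x using bij_betwE[OF v] that by simp
  have wP: "w y \<notin> P" if "y \<noteq> b" for y using bij_betwE[OF w] that by auto
  have vinj: "x = x'" if "x \<notin> W" "x' \<notin> W" "v x = v x'" for x x'
    using inj_onD[OF bij_betw_imp_inj_on[OF v] that(3)] that(1,2) by simp
  have winj: "y = y'" if "y \<noteq> b" "y' \<noteq> b" "w y = w y'" for y y'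
    using inj_onD[OF bij_betw_imp_inj_on[OF w] that(3)] that(1,2) by simp
  have f_v: "x = x0" if "x0 \<notin> W" "f (x, y) = v x0" for x y x0
    using that vP[OF that(1)] wP[of y1] wP[of y] y1 vinj[of x x0] unfolding f_def by (auto split: if_splits)
  have f_w: "y = y0 \<or> (y = b \<and> y0 = y1)" if "y0 \<noteq> b" "f (x, y) = w y0" for x y y0
    using that vP[of x] wP[OF that(1)] winj[of y y0] winj[of y1 y0] y1 unfolding f_def
    by (auto split: if_splits)
  have "operation_of 2 (\<lambda>xs. f (xs ! 0, xs ! 1)) \<in> Pol (missing V)"
  proof (rule binary_PolI)
    fix s t assume "s \<in> missing V" "t \<in> missing V"
    then have "V \<lesssim> - range s" "V \<lesssim> - range t" unfolding missing_def by auto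
    then obtain S T where S: "S \<subseteq> - range s" "finite S" "card S = card V"
      and T: "T \<subseteq> - range t" "finite T" "card T = card V"
      using finite_lepollD[OF V(1)] by metis
    \<comment> \<open>The label of column \<open>y1\<close> also occurs in column \<open>b\<close>,
      at the rows in \<open>W\<close>, and \<open>b\<close> has no label of its own. So
      \<open>b\<close> is discarded if it lies in \<open>T\<close>; otherwise \<open>y1\<close> is,
      because its label may still be attained.\<close>
    define c where "c = (if b \<in> T then b else y1)"
    have bT: "b \<notin> T - {c}" unfolding c_def by auto
    have "v ` (S - W) \<union> w ` (T - {c}) \<subseteq> - range (\<lambda>z. f (s z, t z))"
    proof clarsimp
      show "v ` (S - W) \<subseteq> - range (\<lambda>z. f (s z, t z)) \<and> w ` (T - {c}) \<subseteq> - range (\<lambda>z. f (s z, t z))"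
      proof (intro conjI subsetI ComplI)
        fix z assume "z \<in> v ` (S - W)" "z \<in> range (\<lambda>z. f (s z, t z))"
        then obtain x0 x where "x0 \<in> S" "x0 \<notin> W" "f (s x, t x) = v x0" by auto
        then show False using f_v[of x0 "s x" "t x"] S(1) by auto
      next
        fix z assume "z \<in> w ` (T - {c})" "z \<in> range (\<lambda>z. f (s z, t z))"
        then obtain y0 x where "y0 \<in> T - {c}" "z = w y0" "z = f (s x, t x)" by blast
        then have y0: "y0 \<in> T - {c}" "f (s x, t x) = w y0" by simp_all
        then have "y0 \<noteq> b" using bT by auto
        from f_w[OF this y0(2)] show False
        proof
          assume "t x = y0"
          then show False using y0(1) T(1) by auto
        next
          assume a: "t x = b \<and> y0 = y1"
          then have "b \<notin> T" using T(1) by auto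
          then show False using a y0(1) unfolding c_def by simp
        qed
      qed
    qed
    moreover have "V \<lesssim> v ` (S - W) \<union> w ` (T - {c})"
    proof -
      have cv: "card (v ` (S - W)) = card (S - W)"
        by (rule card_image[OF inj_on_subset[OF bij_betw_imp_inj_on[OF v]]]) auto
      have cw: "card (w ` (T - {c})) = card (T - {c})"
        by (rule card_image[OF inj_on_subset[OF bij_betw_imp_inj_on[OF w]]]) (use bT in auto)
      have "v ` (S - W) \<inter> w ` (T - {c}) = {}"
      proof -
        have "v ` (S - W) \<subseteq> P" using vP by auto
        moreover have "w ` (T - {c}) \<subseteq> - P"
        proof (intro image_subsetI ComplI)
          fix y assume "y \<in> T - {c}" "w y \<in> P"
          moreover from this have "y \<noteq> b" using bT by auto
          ultimately show False using wP by blast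
        qed
        ultimately show ?thesis by blast
      qed
      then have "card (v ` (S - W) \<union> w ` (T - {c})) = card (S - W) + card (T - {c})"
        using cv cw S(2) T(2) by (simp add: card_Un_disjoint)
      moreover have "card (S - W) \<ge> card S - card W" by (rule diff_card_le_card_Diff[OF fW])
      moreover have "card (T - {c}) \<ge> card T - card {c}" by (rule diff_card_le_card_Diff) simp
      \<comment> \<open>The count is at least \<open>(card V - card W) + (card V - 1)\<close>, which
        reaches \<open>card V\<close> because \<open>card W < card V\<close>.\<close>
      ultimately have "card V \<le> card (v ` (S - W) \<union> w ` (T - {c}))"
        using S(3) T(3) card by simp
      then show ?thesis using lepoll_iff_card_le V(1) S(2) T(2) by (metis finite_Diff finite_UnI finite_imageI)
    qed
    ultimately show "(\<lambda>z. f (s z, t z)) \<in> missing V"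
      unfolding missing_def using lepoll_trans[OF _ subset_imp_lepoll] by blast
  qed
  then have fPol: "operation_of 2 (\<lambda>xs. f (xs ! 0, xs ! 1)) \<in> Pol (missing W)" using sub by blast
  obtain a :: "'a \<Rightarrow> 'a" where a: "bij_betw a UNIV (- W)" by (rule large_bij[OF lW])
  obtain e :: "'a \<Rightarrow> 'a \<times> 'a" where e: "bij e" by (rule prod_bij)
  \<comment> \<open>\<open>s\<close> and \<open>t\<close> jointly run through exactly the pairs with
    both entries outside \<open>W\<close>, so the omitted values of \<open>f\<close> are those
    absent from this square.\<close>
  define s where "s x = a (fst (e x))" for x
  define t where "t x = a (snd (e x))" for x
  have st: "\<exists>z. s z = x \<and> t z = y" if "x \<notin> W" "y \<notin> W" for x y
  proof -
    have "x \<in> range a" "y \<in> range a" using that bij_betw_imp_surj_on[OF a] by simp_all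
    then obtain x' y' where "x = a x'" "y = a y'" by blast
    then have "s (inv e (x', y')) = x \<and> t (inv e (x', y')) = y"
      unfolding s_def t_def using bij_is_surj[OF e] by (simp add: surj_f_inv_f)
    then show ?thesis by blast
  qed
  have "s x \<notin> W" "t x \<notin> W" for x unfolding s_def t_def using bij_betwE[OF a] by auto
  then have "W \<subseteq> - range s" "W \<subseteq> - range t" by auto
  then have "s \<in> missing W" "t \<in> missing W" unfolding missing_def by (auto intro: subset_imp_lepoll)
  then have "(\<lambda>z. f (s z, t z)) \<in> missing W" by (rule binary_Pol[OF fPol])
  then have "W \<lesssim> - range (\<lambda>z. f (s z, t z))" unfolding missing_def by blast
  moreover have "- range (\<lambda>z. f (s z, t z)) \<subseteq> w ` (W - {b})"
  proof
    fix y assume y: "y \<in> - range (\<lambda>z. f (s z, t z))"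
    have nf: "f (x', y') \<noteq> y" if "x' \<notin> W" "y' \<notin> W" for x' y'
      using st[OF that] y by auto
    show "y \<in> w ` (W - {b})"
    proof (cases "y \<in> P")
      case True
      then obtain x where x: "x \<notin> W" "v x = y" using bij_betw_imp_surj_on[OF v] by blast
      obtain y' where "y' \<in> - W" "x \<sqsubset> y'" using large_above[OF lW] by blast
      then have "f (x, y') = y" using x unfolding f_def by simp
      then show ?thesis using nf[of x y'] x(1) \<open>y' \<in> - W\<close> by simp
    next
      case False
      then have "y \<in> w ` (- {b})" using bij_betw_imp_surj_on[OF w] by simp
      then obtain y' where y': "y' \<noteq> b" "w y' = y" by auto
      obtain x where x: "x \<in> - W" "y' \<sqsubset> x" using large_above[OF lW] by blast
      then have "\<not> x \<sqsubset> y'" by (simp add: wo.less_imp_le wo.not_less)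
      then have "f (x, y') = y" using y' unfolding f_def by simp
      then have "y' \<in> W" using nf[of x y'] x(1) by auto
      then show ?thesis using y' by blast
    qed
  qed
  ultimately have "W \<lesssim> w ` (W - {b})" using lepoll_trans[OF _ subset_imp_lepoll] by blast
  then have "W \<lesssim> W - {b}" using image_lepoll lepoll_trans by blast
  then have "card W \<le> card (W - {b})" using lepoll_iff_card_le fW by (metis finite_Diff)
  then show False using bW fW cW by simp
qed

lemma Pol_missing_subset_iff:
  assumes "V \<noteq> {}" "W \<noteq> {}" "Pol (missing V) \<subseteq> Pol (missing (W :: 'a set))"
  shows "V \<approx> W"
proof (rule lepoll_antisym)
  show "W \<lesssim> V" using Pol_missing_less assms(3) by blast
  show "V \<lesssim> W"
    using Pol_missing_greater_infinite[of V W] Pol_missing_greater_finite[of V W] assms by blast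
qed

lemma maximal_Pol_missing:
  assumes V: "V \<noteq> {}"
  shows "maximal_clone (Pol (missing (V :: 'a set)))"
  unfolding maximal_clone_def
proof (intro conjI notI)
  show "clone (Pol (missing V))" by (rule clone_Pol)
  show "Pol (missing V) = operations \<Longrightarrow> False" using Pol_missing_proper[OF V] by blast
  assume "\<exists>D. clone D \<and> Pol (missing V) \<subset> D \<and> D \<subset> operations"
  then obtain D where D: "clone D" "Pol (missing V) \<subset> D" "D \<subset> operations" by blast
  interpret clone_above_permutations X D
    by unfold_locales (use D(1,2) permutations_Pol_missing in auto)
  obtain u :: "'a \<Rightarrow> 'a" where u: "\<forall>V. unary_op u \<in> Pol (missing V)" "unary_op u \<notin> Pol small_fibred"
    "unary_op u \<notin> Pol mostly_small_fibred" "\<forall>W. unary_op u \<notin> Pol (almost_onto_or_below W)"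
    by (rule witness_unary)
  obtain p :: "'a \<times> 'a \<Rightarrow> 'a" where p: "\<forall>V. operation_of 2 (\<lambda>xs. p (xs ! 0, xs ! 1)) \<in> Pol (missing V)"
    "operation_of 2 (\<lambda>xs. p (xs ! 0, xs ! 1)) \<notin> Pol almost_unary"
    "operation_of 2 (\<lambda>xs. p (xs ! 0, xs ! 1)) \<notin> Pol nowhere_injective"
    by (rule witness_binary)
  have uD: "unary_op u \<in> D" and pD: "operation_of 2 (\<lambda>xs. p (xs ! 0, xs ! 1)) \<in> D"
    using u(1) p(1) D(2) by blast+
  have "D \<noteq> operations" using D(3) by blast
  from cover[OF this] obtain W where W: "W \<noteq> {}" "D \<subseteq> Pol (missing W)"
    using u(2-4) p(2,3) uD pD by blast
  then have "V \<approx> W" using Pol_missing_subset_iff[OF V W(1)] D(2) by blast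
  from missing_cong[OF this] show False using D(2) W(2) by auto
qed

lemma maximal_clones_cases:
  fixes M :: "'a operation set"
  assumes M: "maximal_clone M" "permutation_ops \<subseteq> M"
  shows "M \<in> {Pol small_fibred, Pol mostly_small_fibred, Pol almost_unary, Pol nowhere_injective} \<union>
    range (\<lambda>V. Pol (missing V)) \<union> range (\<lambda>W. Pol (almost_onto_or_below W))"
proof -
  have cl: "clone M" "M \<noteq> operations" using M(1) unfolding maximal_clone_def by auto
  interpret clone_above_permutations X M by unfold_locales (use cl(1) M(2) in auto)
  have eq: "M = L" if "M \<subseteq> L" "clone L" "L \<noteq> operations" for L
    using M(1) that clone_subset[OF that(2)] unfolding maximal_clone_def by blast
  obtain u :: "'a \<Rightarrow> 'a" where u: "\<forall>V. unary_op u \<in> Pol (missing V)" "unary_op u \<notin> Pol small_fibred"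
    "unary_op u \<notin> Pol mostly_small_fibred" "\<forall>W. unary_op u \<notin> Pol (almost_onto_or_below W)"
    by (rule witness_unary)
  obtain p :: "'a \<times> 'a \<Rightarrow> 'a" where p: "\<forall>V. operation_of 2 (\<lambda>xs. p (xs ! 0, xs ! 1)) \<in> Pol (missing V)"
    "operation_of 2 (\<lambda>xs. p (xs ! 0, xs ! 1)) \<notin> Pol almost_unary"
    "operation_of 2 (\<lambda>xs. p (xs ! 0, xs ! 1)) \<notin> Pol nowhere_injective"
    by (rule witness_binary)
  have proper: "Pol small_fibred \<noteq> (operations :: 'a operation set)"
    "Pol mostly_small_fibred \<noteq> (operations :: 'a operation set)"
    "Pol almost_unary \<noteq> (operations :: 'a operation set)"
    "Pol nowhere_injective \<noteq> (operations :: 'a operation set)"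
    "Pol (almost_onto_or_below W) \<noteq> (operations :: 'a operation set)" for W
    using u(2-4) p(2,3) unary_op_operations[of u] operation_of_in_operations[of 2] by force+
  from cover[OF cl(2)] show ?thesis
    using eq[OF _ clone_Pol proper(1)] eq[OF _ clone_Pol proper(2)] eq[OF _ clone_Pol proper(3)]
      eq[OF _ clone_Pol proper(4)] eq[OF _ clone_Pol proper(5)] eq[OF _ clone_Pol Pol_missing_proper]
    by blast
qed

text \<open>The elements singled out are the nonzero cardinals below the full one, as initial
  ordinals. If all lay below some \<open>b\<close>, the power set of \<open>seg b\<close>, small by
  the strong limit property, would have its cardinal among them and so embed into
  \<open>seg b\<close>, against Cantor's theorem.\<close>

lemma many_cardinalities: "large {x :: 'a. seg x \<noteq> {} \<and> (\<forall>y. y \<sqsubset> x \<longrightarrow> \<not> seg x \<lesssim> seg y)}"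
proof
  let ?K = "{x :: 'a. seg x \<noteq> {} \<and> (\<forall>y. y \<sqsubset> x \<longrightarrow> \<not> seg x \<lesssim> seg y)}"
  assume "small ?K"
  then obtain b where b: "\<And>x. x \<in> ?K \<Longrightarrow> x \<sqsubset> b" by (rule small_bounded) blast
  let ?V = "seg b"
  have nP: "\<not> (UNIV :: 'a set) \<lesssim> Pow ?V" by (rule small_Pow[OF small_seg])
  then have "Pow ?V \<lesssim> (UNIV :: 'a set)" using lepoll_total by blast
  then obtain j :: "'a set \<Rightarrow> 'a" where j: "inj_on j (Pow ?V)" unfolding lepoll_def by blast
  let ?J = "j ` Pow ?V"
  have J: "?J \<approx> Pow ?V" by (rule inj_on_image_eqpoll_self[OF j])
  have "small ?J"
    unfolding small_iff_not_lepoll using nP lepoll_trans2[OF _ J] by blast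
  then obtain x0 :: 'a where "?J \<approx> seg x0" using eqpoll_seg_or_large[of ?J] by blast
  then have ex: "?J \<approx> seg (wo.Least (\<lambda>x :: 'a. ?J \<approx> seg x))" by (rule wo.LeastI)
  define x where "x = wo.Least (\<lambda>x :: 'a. ?J \<approx> seg x)"
  have Jx: "?J \<approx> seg x" unfolding x_def by (rule ex)
  have "seg x \<noteq> {}"
  proof
    assume "seg x = {}"
    then have "?J = {}" using Jx by simp
    then show False by blast
  qed
  moreover have "\<not> seg x \<lesssim> seg y" if y: "y \<sqsubset> x" for y
  proof
    assume le: "seg x \<lesssim> seg y"
    have "seg y \<subseteq> seg x"
    proof clarify
      fix z assume "z \<sqsubset> y"
      then show "z \<sqsubset> x" using y by (rule wo.less_trans)
    qed
    then have "seg x \<approx> seg y" by (intro lepoll_antisym[OF le] subset_imp_lepoll)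
    then have "?J \<approx> seg y" by (rule eqpoll_trans[OF Jx])
    then have "x \<sqsubseteq> y" unfolding x_def by (rule wo.Least_le)
    then show False using y by (simp add: wo.not_le[symmetric])
  qed
  ultimately have "x \<sqsubset> b" by (intro b) simp
  have "seg x \<subseteq> seg b"
  proof clarify
    fix z assume "z \<sqsubset> x"
    then show "z \<sqsubset> b" using \<open>x \<sqsubset> b\<close> by (rule wo.less_trans)
  qed
  then have "seg x \<lesssim> ?V" by (rule subset_imp_lepoll)
  moreover have "Pow ?V \<approx> seg x" by (rule eqpoll_trans[OF eqpoll_sym[OF J] Jx])
  ultimately have "Pow ?V \<lesssim> ?V" using lepoll_trans1 by blast
  then show False using lesspoll_Pow_self[of ?V] lesspoll_trans2 by blast
qed

section \<open>Counting the maximal clones\<close>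

lemma lepoll_UNIV_Un:
  assumes "A \<lesssim> (UNIV :: 'a set)" "B \<lesssim> (UNIV :: 'a set)"
  shows "A \<union> B \<lesssim> (UNIV :: 'a set)"
proof -
  obtain P where P: "large P" "large (- P)"
    using large_split[OF large_UNIV] unfolding Compl_eq_Diff_UNIV by blast
  have "A \<lesssim> P" "B \<lesssim> - P"
    using lepoll_trans[OF assms(1) large_lepoll[OF P(1)]] lepoll_trans[OF assms(2) large_lepoll[OF P(2)]]
    by blast+
  then have "A \<union> B \<lesssim> P \<union> - P" by (rule Un_lepoll_mono) (simp add: disjnt_def)
  then show ?thesis by simp
qed

lemma range_invariant_lepoll:
  fixes \<Phi> :: "'a set \<Rightarrow> 'b"
  assumes inv: "\<And>V W. V \<approx> W \<Longrightarrow> \<Phi> V = \<Phi> W"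
  shows "range \<Phi> \<lesssim> (UNIV :: 'a set)"
proof -
  have "range \<Phi> \<subseteq> range (\<lambda>x. \<Phi> (seg x)) \<union> {\<Phi> UNIV}"
  proof (rule image_subsetI)
    fix V
    show "\<Phi> V \<in> range (\<lambda>x. \<Phi> (seg x)) \<union> {\<Phi> UNIV}"
      using eqpoll_seg_or_large[of V] inv[of V] unfolding small_def by blast
  qed
  then have "range \<Phi> \<lesssim> range (\<lambda>x. \<Phi> (seg x)) \<union> {\<Phi> UNIV}" by (rule subset_imp_lepoll)
  also have "\<dots> \<lesssim> (UNIV :: 'a set)"
    by (rule lepoll_UNIV_Un[OF image_lepoll finite_lepoll_infinite[OF infinite_UNIV]]) simp
  finally show ?thesis .
qed

theorem maximal_clones_eqpoll:
  "{M :: 'a operation set. maximal_clone M \<and> permutation_ops \<subseteq> M} \<approx> (UNIV :: 'a set)"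
proof (rule lepoll_antisym)
  let ?M = "{M :: 'a operation set. maximal_clone M \<and> permutation_ops \<subseteq> M}"
  let ?L = "{Pol small_fibred, Pol mostly_small_fibred, Pol almost_unary, Pol nowhere_injective} \<union>
    range (\<lambda>V. Pol (missing V)) \<union> range (\<lambda>W. Pol (almost_onto_or_below W)) :: 'a operation set set"
  have "?M \<subseteq> ?L" using maximal_clones_cases by blast
  then have "?M \<lesssim> ?L" by (rule subset_imp_lepoll)
  also have "?L \<lesssim> (UNIV :: 'a set)"
  proof (intro lepoll_UNIV_Un range_invariant_lepoll)
    show "{Pol small_fibred, Pol mostly_small_fibred, Pol almost_unary, Pol nowhere_injective} \<lesssim> (UNIV :: 'a set)"
      by (rule finite_lepoll_infinite[OF infinite_UNIV]) simp
    show "Pol (missing V) = Pol (missing W)"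
      "Pol (almost_onto_or_below V) = Pol (almost_onto_or_below W)" if "V \<approx> W" for V W :: "'a set"
      by (simp_all only: missing_cong[OF that] almost_onto_or_below_cong[OF that])
  qed
  finally show "?M \<lesssim> (UNIV :: 'a set)" .
  let ?K = "{x :: 'a. seg x \<noteq> {} \<and> (\<forall>y. y \<sqsubset> x \<longrightarrow> \<not> seg x \<lesssim> seg y)}"
  have "inj_on (\<lambda>x. Pol (missing (seg x))) ?K"
  proof (rule inj_onI)
    fix x y assume xy: "x \<in> ?K" "y \<in> ?K" and eq: "Pol (missing (seg x)) = Pol (missing (seg y))"
    have e: "seg x \<approx> seg y" using Pol_missing_subset_iff[of "seg x" "seg y"] xy eq by auto
    show "x = y"
      using xy eqpoll_imp_lepoll[OF e] eqpoll_imp_lepoll[OF eqpoll_sym[OF e]]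
      by (cases x y rule: wo.linorder_cases) auto
  qed
  moreover have "(\<lambda>x. Pol (missing (seg x))) ` ?K \<subseteq> ?M"
    by (intro image_subsetI CollectI conjI maximal_Pol_missing permutations_Pol_missing) blast
  ultimately have "?K \<lesssim> ?M" unfolding lepoll_def by blast
  moreover have "(UNIV :: 'a set) \<lesssim> ?K" by (rule large_lepoll[OF many_cardinalities])
  ultimately show "(UNIV :: 'a set) \<lesssim> ?M" using lepoll_trans by blast
qed

end

lemma ramsey_cardinalI:
  assumes "(infinite (UNIV :: 'a set) \<and> countable (UNIV :: 'a set)) \<or>
           weakly_compact_cardinality (UNIV :: 'a set)"
  shows "ramsey_cardinal TYPE('a)"
proof
  show "infinite (UNIV :: 'a set)"
    using assms unfolding weakly_compact_cardinality_def by (auto intro: countable_finite)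
  fix c :: "'a set \<Rightarrow> bool"
  define k where "k e = (if c e then 1 else 0 :: nat)" for e
  have k: "(\<forall>e\<in>nsets H 2. c e) \<or> (\<forall>e\<in>nsets H 2. \<not> c e)" if "k ` nsets H 2 \<subseteq> {i}" for H i
    using that unfolding k_def by (auto split: if_splits)
  from assms show "\<exists>H. H \<approx> (UNIV :: 'a set) \<and> ((\<forall>e\<in>nsets H 2. c e) \<or> (\<forall>e\<in>nsets H 2. \<not> c e))"
  proof
    assume ct: "infinite (UNIV :: 'a set) \<and> countable (UNIV :: 'a set)"
    have "k ` nsets (UNIV :: 'a set) 2 \<subseteq> {..<2}" unfolding k_def by auto
    then obtain H i where H: "infinite H" "k ` nsets H 2 \<subseteq> {i}"
      using Ramsey_nsets[of "UNIV :: 'a set" k 2 2] ct by metis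
    have ct': "infinite (UNIV :: 'a set)" "countable (UNIV :: 'a set)" using ct by auto
    have "countable H" by (rule countable_subset[OF subset_UNIV ct'(2)])
    then have "bij_betw (from_nat_into H) UNIV H"
      using H(1) by (rule bij_betw_from_nat_into)
    moreover have "bij_betw (from_nat_into (UNIV :: 'a set)) UNIV UNIV"
      using ct'(2,1) by (rule bij_betw_from_nat_into)
    ultimately have "(UNIV :: nat set) \<approx> H" "(UNIV :: nat set) \<approx> (UNIV :: 'a set)"
      unfolding eqpoll_def by blast+
    then have "H \<approx> (UNIV :: 'a set)" by (rule eqpoll_trans[OF eqpoll_sym])
    then show ?thesis using k[OF H(2)] by blast
  next
    assume "weakly_compact_cardinality (UNIV :: 'a set)"
    moreover have "k \<in> nsets (UNIV :: 'a set) 2 \<rightarrow> {..<2}" unfolding k_def by auto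
    ultimately obtain H i where "H \<approx> (UNIV :: 'a set)" "k ` nsets H 2 \<subseteq> {i}"
      unfolding weakly_compact_cardinality_def by blast
    then show ?thesis using k by blast
  qed
qed

theorem corollary3:
  assumes "(infinite (UNIV :: 'a set) \<and> countable (UNIV :: 'a set)) \<or>
           weakly_compact_cardinality (UNIV :: 'a set)"
  shows "{C :: 'a operation set. maximal_clone C \<and> permutation_ops \<subseteq> C} \<approx> (UNIV :: 'a set)"
proof -
  interpret ramsey_cardinal "TYPE('a)" by (rule ramsey_cardinalI[OF assms])
  show ?thesis by (rule maximal_clones_eqpoll)
qed

end
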